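(* Let $(\mathcal{A}\to M,\rho,[\cdot,\cdot]_{\mathcal{A}})$ be a Lie algebroid over a smooth manifold $M$ and let $\mathcal{B}\subset\mathcal{A}$ be a coorientable Lie subalgebroid over $M$ of corank $q$. Let $\alpha\in\Omega^q(\mathcal{A})$ be a defining form of $\mathcal{B}$ and let $\beta\in\Omega^1(\mathcal{A})$ satisfy $d_{\mathcal{A}}\alpha=\beta\wedge\alpha$. Then the cohomology class $$[\beta\wedge(d_{\mathcal{A}}\beta)^q]\in H^{2q+1}(\mathcal{A})$$ is (well defined and) independent of the choice of the forms $\alpha$ and $\beta$, and thus is uniquely determined by the Lie subalgebroid $\mathcal{B}$.
   Context: **Lie algebroids.** A Lie algebroid on $M$ is a vector bundle $\mathcal{A}\to M$ with a bundle map $\rho:\mathcal{A}\to TM$ (the anchor) and a Lie bracket $[\cdot,\cdot]_{\mathcal{A}}$ on $\Gamma(\mathcal{A})$ satisfying $[v,fw]_{\mathcal{A}}=f[v,w]_{\mathcal{A}}+(\mathcal{L}_{\rho(v)}f)w$ for $v,w\in\Gamma(\mathcal{A})$, $f\in C^\infty(M)$. **Cohomology.** Set $\Omega^k(\mathcal{A})=\Gamma(\wedge^k\mathcal{A}^* )$ and define $d_{\mathcal{A}}:\Omega^k(\mathcal{A})\to\Omega^{k+1}(\mathcal{A})$ by $$d_{\mathcal{A}}\eta(v_0,\dots,v_k)=\sum_{i=0}^k(-1)^i\mathcal{L}_{\rho(v_i)}(\eta(v_0,\dots,\hat{v_i},\dots,v_k))+\sum_{0\le i<j\le k}(-1)^{i+j}\eta([v_i,v_j]_{\mathcal{A}},v_0,\dots,\hat{v_i},\dots,\hat{v_j},\dots,v_k).$$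 One has $d_{\mathcal{A}}\circ d_{\mathcal{A}}=0$; $H^k(\mathcal{A})$ is the $k$-th cohomology of $(\Omega^\bullet(\mathcal{A}),d_{\mathcal{A}})$. The wedge product is normalized so that $d_{\mathcal{A}}$ is a graded derivation, e.g. $(\beta\wedge\alpha)(v_0,v_1)=\beta(v_0)\alpha(v_1)-\beta(v_1)\alpha(v_0)$ for $1$-forms. **Lie subalgebroids.** A Lie subalgebroid $\mathcal{B}\subset\mathcal{A}$ over $M$ is a vector subbundle over $M$ with $[\Gamma(\mathcal{B}),\Gamma(\mathcal{B})]_{\mathcal{A}}\subset\Gamma(\mathcal{B})$. It is coorientable if the quotient bundle $\mathcal{A}/\mathcal{B}$ is trivial. Its corank is $q=\operatorname{rank}(\mathcal{A}/\mathcal{B})$. **Defining forms.** A defining form of $\mathcal{B}$ is a nowhere vanishing form $\alpha\in\Omega^q(\mathcal{A})$ which is locally decomposable, i.e. near every point there is an open set $U$ with $\alpha|_U=\alpha_1\wedge\cdots\wedge\alpha_q$, $\alpha_i\in\Omega^1(\mathcal{A}|_U)$, and satisfies $\mathcal{B}|_U=\bigcap_{i=1}^q\ker\alpha_i$ for such decompositions; equivalently, $\Gamma(\mathcal{B})=\{v\in\Gamma(\mathcal{A})\mid\eta(v)=0\text{ for all }\eta\in\mathcal{I}\}$ where $\mathcal{I}=\{\eta\in\Omega^1(\mathcal{A})\mid\eta\wedge\alpha=0\}$. Since $\mathcal{B}$ is coorientable, a global defining form exists. The condition $[\Gamma(\mathcal{B}),\Gamma(\mathcal{B})]_{\mathcal{A}}\subset\Gamma(\mathcal{B})$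 is expressed as $d_{\mathcal{A}}\alpha=\beta\wedge\alpha$ for some $\beta\in\Omega^1(\mathcal{A})$. *)

theory Defs
  imports "HOL-Analysis.Analysis" "HOL-Combinatorics.Permutations"
begin

section \<open>Smooth manifolds\<close>

primrec Ck_on :: "nat \<Rightarrow> 'e::real_normed_vector set \<Rightarrow> ('e \<Rightarrow> 'f::real_normed_vector) \<Rightarrow> bool" where
  "Ck_on 0 S f \<longleftrightarrow> continuous_on S f"
| "Ck_on (Suc k) S f \<longleftrightarrow> (\<forall>x\<in>S. f differentiable (at x)) \<and>
     (\<forall>v. Ck_on k S (\<lambda>x. frechet_derivative f (at x) v))"

text \<open>Only used for open \<open>S\<close> in a finite-dimensional space.\<close>

definition smooth_on :: "'e::real_normed_vector set \<Rightarrow> ('e \<Rightarrow> 'f::real_normed_vector) \<Rightarrow> bool" where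
  "smooth_on S f \<longleftrightarrow> (\<forall>k. Ck_on k S f)"

text \<open>The manifold is the whole type \<open>'m\<close>, with a smooth atlas of charts \<open>(U, \<phi>)\<close>.
  The model space is a finite-dimensional inner product space rather than a type of class
  \<open>euclidean_space\<close>, because that class excludes dimension 0, and Lie algebroids over a point
  (that is, Lie algebras) must be covered.\<close>

definition smooth_manifold ::
  "('m::{t2_space,second_countable_topology} set \<times> ('m \<Rightarrow> 'e::real_inner)) set \<Rightarrow> bool" where
  "smooth_manifold \<U> \<longleftrightarrow>
     (\<exists>b :: 'e set. finite b \<and> span b = UNIV) \<and>
     (\<Union>(U, \<phi>)\<in>\<U>. U) = UNIV \<and>
     (\<forall>(U, \<phi>)\<in>\<U>. open U \<and> open (\<phi> ` U) \<and> (\<exists>\<psi>. homeomorphism U (\<phi> ` U) \<phi> \<psi>)) \<and>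
     (\<forall>(U, \<phi>)\<in>\<U>. \<forall>(V, \<psi>)\<in>\<U>. smooth_on (\<phi> ` (U \<inter> V)) (\<psi> \<circ> inv_into U \<phi>))"

definition smooth_fun ::
  "('m::{t2_space,second_countable_topology} set \<times> ('m \<Rightarrow> 'e::real_inner)) set \<Rightarrow>
     'm set \<Rightarrow> ('m \<Rightarrow> real) \<Rightarrow> bool" where
  "smooth_fun \<U> U f \<longleftrightarrow> (\<forall>(V, \<phi>)\<in>\<U>. smooth_on (\<phi> ` (U \<inter> V)) (f \<circ> inv_into V \<phi>))"

abbreviation smooth_funs ("C\<infinity>") where
  "C\<infinity> \<U> \<equiv> {f. smooth_fun \<U> UNIV f}"


section \<open>Vector bundles\<close>

text \<open>The fibres are finite-dimensional subspaces of one real vector space \<open>'a\<close>, which only serves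
  as a carrier: it has no topology and may have any dimension, so that every family of fibres
  \<open>E\<^sub>x\<close> is covered (take \<open>'a\<close> to be their direct sum). Fibres over different points need not be
  disjoint; a point of the total space is a pair of \<open>x\<close> and \<open>v \<in> fib E x\<close>.
  The smooth structure is given by local trivialisations, each written as its local frame:
  \<open>(V, e)\<close> stands for the trivialisation that maps \<open>x \<in> V\<close> and \<open>c \<in> \<real>\<^sup>r\<close> to
  \<open>\<Sum>i<r. c\<^sub>i e\<^sub>i(x)\<close>.\<close>

record ('m, 'e, 'a) vbundle =
  charts :: "('m set \<times> ('m \<Rightarrow> 'e)) set"
  fib :: "'m \<Rightarrow> 'a set"
  rk :: nat
  frames :: "('m set \<times> (nat \<Rightarrow> 'm \<Rightarrow> 'a)) set"

definition is_basis :: "'a::real_vector set \<Rightarrow> nat \<Rightarrow> (nat \<Rightarrow> 'a) \<Rightarrow> bool" where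
  "is_basis V r b \<longleftrightarrow> inj_on b {..<r} \<and> independent (b ` {..<r}) \<and> span (b ` {..<r}) = V"

definition local_section ::
  "('m::{t2_space,second_countable_topology}, 'e::real_inner, 'a::real_vector, 'z) vbundle_scheme \<Rightarrow>
     'm set \<Rightarrow> ('m \<Rightarrow> 'a) \<Rightarrow> bool" where
  "local_section E U s \<longleftrightarrow>
     (\<forall>x\<in>U. s x \<in> fib E x) \<and>
     (\<forall>(V, e)\<in>frames E. \<exists>c. (\<forall>i<rk E. smooth_fun (charts E) (U \<inter> V) (c i)) \<and>
        (\<forall>x\<in>U \<inter> V. s x = (\<Sum>i<rk E. c i x *\<^sub>R e i x)))"

abbreviation sections ("\<Gamma>") where
  "\<Gamma> E \<equiv> {s. local_section E UNIV s}"

text \<open>Smoothness of the frames as sections is smoothness of the transition functions.\<close>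

definition vector_bundle ::
  "('m::{t2_space,second_countable_topology}, 'e::real_inner, 'a::real_vector, 'z) vbundle_scheme \<Rightarrow>
     bool" where
  "vector_bundle E \<longleftrightarrow>
     smooth_manifold (charts E) \<and>
     (\<Union>(V, e)\<in>frames E. V) = UNIV \<and>
     (\<forall>(V, e)\<in>frames E. open V \<and>
        (\<forall>x\<in>V. is_basis (fib E x) (rk E) (\<lambda>i. e i x)) \<and>
        (\<forall>i<rk E. local_section E V (e i)))"

text \<open>A subbundle of corank \<open>q\<close>, described by local frames of \<open>E\<close> adapted to it.\<close>

definition subbundle ::
  "('m::{t2_space,second_countable_topology}, 'e::real_inner, 'a::real_vector, 'z) vbundle_scheme \<Rightarrow>
     ('m \<Rightarrow> 'a set) \<Rightarrow> nat \<Rightarrow> bool" where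
  "subbundle E B q \<longleftrightarrow> q \<le> rk E \<and>
     (\<forall>x. \<exists>U f. open U \<and> x \<in> U \<and> (\<forall>i<rk E. local_section E U (f i)) \<and>
        (\<forall>y\<in>U. is_basis (fib E y) (rk E) (\<lambda>i. f i y) \<and>
                is_basis (B y) (rk E - q) (\<lambda>i. f i y)))"

text \<open>Sections of the quotient bundle \<open>E/B\<close>, whose fibre at \<open>x\<close> consists of the cosets
  \<open>v + B x\<close>. Smooth sections of \<open>E/B\<close> are those that lift locally to smooth sections of \<open>E\<close>.\<close>

definition coset :: "('m \<Rightarrow> 'a::real_vector set) \<Rightarrow> 'm \<Rightarrow> 'a \<Rightarrow> 'a set" where
  "coset B x v = (\<lambda>b. v + b) ` B x"

definition quotient_section ::
  "('m::{t2_space,second_countable_topology}, 'e::real_inner, 'a::real_vector, 'z) vbundle_scheme \<Rightarrow>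
     ('m \<Rightarrow> 'a set) \<Rightarrow> ('m \<Rightarrow> 'a set) \<Rightarrow> bool" where
  "quotient_section E B \<sigma> \<longleftrightarrow>
     (\<forall>x. \<exists>U s. open U \<and> x \<in> U \<and> local_section E U s \<and> (\<forall>y\<in>U. \<sigma> y = coset B y (s y)))"

text \<open>\<open>E/B\<close> is trivial, i.e. it has a global smooth frame \<open>\<sigma>\<^sub>0, \<dots>, \<sigma>\<^sub>q\<^sub>-\<^sub>1\<close>. Linear combinations
  of cosets are formed by means of representatives.\<close>

definition coorientable ::
  "('m::{t2_space,second_countable_topology}, 'e::real_inner, 'a::real_vector, 'z) vbundle_scheme \<Rightarrow>
     ('m \<Rightarrow> 'a set) \<Rightarrow> nat \<Rightarrow> bool" where
  "coorientable E B q \<longleftrightarrow>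
     (\<exists>\<sigma>. (\<forall>i<q. quotient_section E B (\<sigma> i)) \<and>
        (\<forall>x. \<forall>Q \<in> coset B x ` fib E x.
           \<exists>!c. c \<in> {..<q} \<rightarrow>\<^sub>E (UNIV :: real set) \<and>
                (\<exists>w. (\<forall>i<q. w i \<in> \<sigma> i x) \<and> coset B x (\<Sum>i<q. c i *\<^sub>R w i) = Q)))"


section \<open>Forms\<close>

text \<open>An alternating \<open>k\<close>-linear form on \<open>V\<close> takes its arguments from a sequence
  \<open>v\<^sub>0, \<dots>, v\<^sub>k\<^sub>-\<^sub>1\<close> in \<open>V\<close>. The last two conjuncts only fix its values on
  meaningless arguments, so that equality of forms is equality of functions.\<close>

definition alt_form :: "nat \<Rightarrow> 'a::real_vector set \<Rightarrow> ((nat \<Rightarrow> 'a) \<Rightarrow> real) \<Rightarrow> bool" where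
  "alt_form k V \<omega> \<longleftrightarrow>
     (\<forall>v i. (\<forall>j<k. v j \<in> V) \<and> i < k \<longrightarrow>
        (\<forall>a b. \<forall>x\<in>V. \<forall>y\<in>V.
           \<omega> (v(i := a *\<^sub>R x + b *\<^sub>R y)) = a * \<omega> (v(i := x)) + b * \<omega> (v(i := y)))) \<and>
     (\<forall>v i j. (\<forall>j<k. v j \<in> V) \<and> i < k \<and> j < k \<and> i \<noteq> j \<and> v i = v j \<longrightarrow> \<omega> v = 0) \<and>
     (\<forall>v w. (\<forall>j<k. v j = w j) \<longrightarrow> \<omega> v = \<omega> w) \<and>
     (\<forall>v. (\<exists>j<k. v j \<notin> V) \<longrightarrow> \<omega> v = 0)"

type_synonym ('m, 'a) form = "'m \<Rightarrow> (nat \<Rightarrow> 'a) \<Rightarrow> real"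

text \<open>\<open>forms E U k\<close> are the smooth sections over \<open>U\<close> of the \<open>k\<close>-th exterior power of the dual
  bundle; a smooth section is one whose components with respect to the local frames of
  \<open>E\<close> are smooth.\<close>

definition forms ::
  "('m::{t2_space,second_countable_topology}, 'e::real_inner, 'a::real_vector, 'z) vbundle_scheme \<Rightarrow>
     'm set \<Rightarrow> nat \<Rightarrow> ('m, 'a) form set" where
  "forms E U k = {\<omega>. (\<forall>x\<in>U. alt_form k (fib E x) (\<omega> x)) \<and>
     (\<forall>(V, e)\<in>frames E. \<forall>I. (\<forall>j<k. I j < rk E) \<longrightarrow>
        smooth_fun (charts E) (U \<inter> V) (\<lambda>x. \<omega> x (\<lambda>j. e (I j) x)))}"

abbreviation global_forms ("\<Omega>") where
  "\<Omega> E k \<equiv> forms E UNIV k"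

text \<open>The wedge product of a \<open>k\<close>-form and an \<open>l\<close>-form; for 1-forms it is
  \<open>\<omega>(v\<^sub>0) \<eta>(v\<^sub>1) - \<omega>(v\<^sub>1) \<eta>(v\<^sub>0)\<close>.\<close>

definition wedge :: "nat \<Rightarrow> nat \<Rightarrow> ('m, 'a) form \<Rightarrow> ('m, 'a) form \<Rightarrow> ('m, 'a) form" where
  "wedge k l \<omega> \<eta> = (\<lambda>x v.
     (\<Sum>\<sigma> | \<sigma> permutes {..<k + l}.
        of_int (sign \<sigma>) * \<omega> x (\<lambda>i. v (\<sigma> i)) * \<eta> x (\<lambda>i. v (\<sigma> (k + i)))) / (fact k * fact l))"

primrec wedge_power :: "nat \<Rightarrow> ('m, 'a) form \<Rightarrow> nat \<Rightarrow> ('m, 'a) form" where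
  "wedge_power k \<omega> 0 = (\<lambda>x v. 1)"
| "wedge_power k \<omega> (Suc n) = wedge k (k * n) \<omega> (wedge_power k \<omega> n)"

primrec wedge_list :: "('m, 'a) form list \<Rightarrow> ('m, 'a) form" where
  "wedge_list [] = (\<lambda>x v. 1)"
| "wedge_list (\<omega> # \<omega>s) = wedge 1 (length \<omega>s) \<omega> (wedge_list \<omega>s)"


section \<open>Lie algebroids\<close>

text \<open>Tangent vectors at \<open>x\<close> are the derivations of the smooth functions at \<open>x\<close>, and
  \<open>anchor A x v f\<close> is the derivative of \<open>f\<close> along the tangent vector \<open>\<rho>(v)\<close>,
  where \<open>v \<in> fib A x\<close>.\<close>

record ('m, 'e, 'a) algebroid = "('m, 'e, 'a) vbundle" +
  anchor :: "'m \<Rightarrow> 'a \<Rightarrow> ('m \<Rightarrow> real) \<Rightarrow> real"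
  bracket :: "('m \<Rightarrow> 'a) \<Rightarrow> ('m \<Rightarrow> 'a) \<Rightarrow> ('m \<Rightarrow> 'a)"

definition tangent_vector ::
  "('m::{t2_space,second_countable_topology} set \<times> ('m \<Rightarrow> 'e::real_inner)) set \<Rightarrow>
     'm \<Rightarrow> (('m \<Rightarrow> real) \<Rightarrow> real) \<Rightarrow> bool" where
  "tangent_vector \<U> x X \<longleftrightarrow>
     (\<forall>f\<in>C\<infinity> \<U>. \<forall>g\<in>C\<infinity> \<U>. \<forall>a b. X (\<lambda>y. a * f y + b * g y) = a * X f + b * X g) \<and>
     (\<forall>f\<in>C\<infinity> \<U>. \<forall>g\<in>C\<infinity> \<U>. X (\<lambda>y. f y * g y) = f x * X g + g x * X f)"

definition lie_derivative ::
  "('m, 'e, 'a, 'z) algebroid_scheme \<Rightarrow> ('m \<Rightarrow> 'a) \<Rightarrow> ('m \<Rightarrow> real) \<Rightarrow> ('m \<Rightarrow> real)" where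
  "lie_derivative A v f = (\<lambda>x. anchor A x (v x) f)"

text \<open>The anchor is a smooth bundle map to the tangent bundle: it is linear on the fibres and maps
  smooth sections to smooth vector fields, that is, to fields of tangent vectors that map
  smooth functions to smooth functions.\<close>

definition anchor_map ::
  "('m::{t2_space,second_countable_topology}, 'e::real_inner, 'a::real_vector, 'z) algebroid_scheme \<Rightarrow>
     bool" where
  "anchor_map A \<longleftrightarrow>
     (\<forall>x. \<forall>v\<in>fib A x. tangent_vector (charts A) x (anchor A x v)) \<and>
     (\<forall>x. \<forall>v\<in>fib A x. \<forall>w\<in>fib A x. \<forall>a b. \<forall>f\<in>C\<infinity> (charts A).
        anchor A x (a *\<^sub>R v + b *\<^sub>R w) f = a * anchor A x v f + b * anchor A x w f) \<and>
     (\<forall>v\<in>\<Gamma> A. \<forall>f\<in>C\<infinity> (charts A). lie_derivative A v f \<in> C\<infinity> (charts A))"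

definition lie_bracket ::
  "('m::{t2_space,second_countable_topology}, 'e::real_inner, 'a::real_vector, 'z) algebroid_scheme \<Rightarrow>
     bool" where
  "lie_bracket A \<longleftrightarrow>
     (\<forall>u\<in>\<Gamma> A. \<forall>v\<in>\<Gamma> A. bracket A u v \<in> \<Gamma> A) \<and>
     (\<forall>u\<in>\<Gamma> A. \<forall>v\<in>\<Gamma> A. \<forall>w\<in>\<Gamma> A. \<forall>a b.
        bracket A (\<lambda>x. a *\<^sub>R u x + b *\<^sub>R v x) w
          = (\<lambda>x. a *\<^sub>R bracket A u w x + b *\<^sub>R bracket A v w x) \<and>
        bracket A w (\<lambda>x. a *\<^sub>R u x + b *\<^sub>R v x)
          = (\<lambda>x. a *\<^sub>R bracket A w u x + b *\<^sub>R bracket A w v x)) \<and>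
     (\<forall>u\<in>\<Gamma> A. bracket A u u = (\<lambda>x. 0)) \<and>
     (\<forall>u\<in>\<Gamma> A. \<forall>v\<in>\<Gamma> A. \<forall>w\<in>\<Gamma> A. \<forall>x.
        bracket A u (bracket A v w) x + bracket A v (bracket A w u) x
          + bracket A w (bracket A u v) x = 0)"

definition lie_algebroid ::
  "('m::{t2_space,second_countable_topology}, 'e::real_inner, 'a::real_vector, 'z) algebroid_scheme \<Rightarrow>
     bool" where
  "lie_algebroid A \<longleftrightarrow> vector_bundle A \<and> anchor_map A \<and> lie_bracket A \<and>
     (\<forall>v\<in>\<Gamma> A. \<forall>w\<in>\<Gamma> A. \<forall>f\<in>C\<infinity> (charts A).
        bracket A v (\<lambda>x. f x *\<^sub>R w x)
          = (\<lambda>x. f x *\<^sub>R bracket A v w x + lie_derivative A v f x *\<^sub>R w x))"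

definition lie_subalgebroid ::
  "('m::{t2_space,second_countable_topology}, 'e::real_inner, 'a::real_vector, 'z) algebroid_scheme \<Rightarrow>
     ('m \<Rightarrow> 'a set) \<Rightarrow> nat \<Rightarrow> bool" where
  "lie_subalgebroid A B q \<longleftrightarrow> subbundle A B q \<and>
     (\<forall>v\<in>\<Gamma> A. \<forall>w\<in>\<Gamma> A. (\<forall>x. v x \<in> B x) \<and> (\<forall>x. w x \<in> B x) \<longrightarrow> (\<forall>x. bracket A v w x \<in> B x))"


section \<open>Cohomology\<close>

definition omit :: "nat \<Rightarrow> (nat \<Rightarrow> 'b) \<Rightarrow> nat \<Rightarrow> 'b" where
  "omit i v = (\<lambda>j. if j < i then v j else v (Suc j))"

text \<open>The value at \<open>x\<close> of the right-hand side of the formula for \<open>d\<eta>(v\<^sub>0, \<dots>, v\<^sub>k)\<close>. In the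
  second sum \<open>v\<^sub>j\<close> is omitted first; since \<open>i < j\<close>, this does not change the position of \<open>v\<^sub>i\<close>.\<close>

definition d_formula ::
  "('m::{t2_space,second_countable_topology}, 'e::real_inner, 'a::real_vector, 'z) algebroid_scheme \<Rightarrow>
     nat \<Rightarrow> ('m, 'a) form \<Rightarrow> (nat \<Rightarrow> 'm \<Rightarrow> 'a) \<Rightarrow> 'm \<Rightarrow> real" where
  "d_formula A k \<eta> v x =
     (\<Sum>i\<le>k. (-1) ^ i * lie_derivative A (v i) (\<lambda>y. \<eta> y (\<lambda>m. omit i v m y)) x) +
     (\<Sum>j\<le>k. \<Sum>i<j. (-1) ^ (i + j) *
        \<eta> x (case_nat (bracket A (v i) (v j) x) (\<lambda>m. omit i (omit j v) m x)))"

definition dA ::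
  "('m::{t2_space,second_countable_topology}, 'e::real_inner, 'a::real_vector, 'z) algebroid_scheme \<Rightarrow>
     nat \<Rightarrow> ('m, 'a) form \<Rightarrow> ('m, 'a) form" where
  "dA A k \<eta> = (THE \<omega>. \<omega> \<in> \<Omega> A (Suc k) \<and>
     (\<forall>v. (\<forall>i\<le>k. v i \<in> \<Gamma> A) \<longrightarrow> (\<forall>x. \<omega> x (\<lambda>i. v i x) = d_formula A k \<eta> v x)))"

definition cocycles ::
  "('m::{t2_space,second_countable_topology}, 'e::real_inner, 'a::real_vector, 'z) algebroid_scheme \<Rightarrow>
     nat \<Rightarrow> ('m, 'a) form set" where
  "cocycles A k = {\<omega> \<in> \<Omega> A k. dA A k \<omega> = (\<lambda>x v. 0)}"

definition coboundaries ::
  "('m::{t2_space,second_countable_topology}, 'e::real_inner, 'a::real_vector, 'z) algebroid_scheme \<Rightarrow>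
     nat \<Rightarrow> ('m, 'a) form set" where
  "coboundaries A k = (case k of 0 \<Rightarrow> {\<lambda>x v. 0} | Suc n \<Rightarrow> dA A n ` \<Omega> A n)"

definition cohomologous ::
  "('m::{t2_space,second_countable_topology}, 'e::real_inner, 'a::real_vector, 'z) algebroid_scheme \<Rightarrow>
     nat \<Rightarrow> (('m, 'a) form \<times> ('m, 'a) form) set" where
  "cohomologous A k = {(\<omega>, \<omega>'). \<omega> \<in> cocycles A k \<and> \<omega>' \<in> cocycles A k \<and>
     (\<lambda>x v. \<omega> x v - \<omega>' x v) \<in> coboundaries A k}"

definition cohomology ::
  "('m::{t2_space,second_countable_topology}, 'e::real_inner, 'a::real_vector, 'z) algebroid_scheme \<Rightarrow>
     nat \<Rightarrow> ('m, 'a) form set set" where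
  "cohomology A k = cocycles A k // cohomologous A k"

definition cohomology_class ::
  "('m::{t2_space,second_countable_topology}, 'e::real_inner, 'a::real_vector, 'z) algebroid_scheme \<Rightarrow>
     nat \<Rightarrow> ('m, 'a) form \<Rightarrow> ('m, 'a) form set" where
  "cohomology_class A k \<omega> = cohomologous A k `` {\<omega>}"


section \<open>Defining forms\<close>

text \<open>\<open>\<alpha>|\<^sub>U\<close> is the wedge product of the 1-forms \<open>\<alpha>s\<close> on \<open>U\<close>. A form of degree
  0, i.e. a function, counts as decomposable even if it is not the empty product 1.\<close>

definition decomposition ::
  "('m::{t2_space,second_countable_topology}, 'e::real_inner, 'a::real_vector, 'z) vbundle_scheme \<Rightarrow>
     nat \<Rightarrow> ('m, 'a) form \<Rightarrow> 'm set \<Rightarrow> ('m, 'a) form list \<Rightarrow> bool" where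
  "decomposition E q \<alpha> U \<alpha>s \<longleftrightarrow> open U \<and> length \<alpha>s = q \<and> set \<alpha>s \<subseteq> forms E U 1 \<and>
     (q > 0 \<longrightarrow> (\<forall>x\<in>U. \<alpha> x = wedge_list \<alpha>s x))"

definition defining_form ::
  "('m::{t2_space,second_countable_topology}, 'e::real_inner, 'a::real_vector, 'z) vbundle_scheme \<Rightarrow>
     ('m \<Rightarrow> 'a set) \<Rightarrow> nat \<Rightarrow> ('m, 'a) form \<Rightarrow> bool" where
  "defining_form E B q \<alpha> \<longleftrightarrow> \<alpha> \<in> \<Omega> E q \<and>
     (\<forall>x. \<exists>v. \<alpha> x v \<noteq> 0) \<and>
     (\<forall>x. \<exists>U \<alpha>s. x \<in> U \<and> decomposition E q \<alpha> U \<alpha>s) \<and>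
     (\<forall>U \<alpha>s. decomposition E q \<alpha> U \<alpha>s \<longrightarrow>
        (\<forall>x\<in>U. B x = {v \<in> fib E x. \<forall>\<omega>\<in>set \<alpha>s. \<omega> x (\<lambda>_. v) = 0}))"

text \<open>The form \<open>\<beta> \<and> (d\<beta>)\<^sup>q\<close>, of degree \<open>2q + 1\<close>.\<close>

definition gv_form ::
  "('m::{t2_space,second_countable_topology}, 'e::real_inner, 'a::real_vector, 'z) algebroid_scheme \<Rightarrow>
     nat \<Rightarrow> ('m, 'a) form \<Rightarrow> ('m, 'a) form" where
  "gv_form A q \<beta> = wedge 1 (2 * q) \<beta> (wedge_power 2 (dA A 1 \<beta>) q)"

end

(* A form is turned into a cochain, a function on lists of global sections.  On lists the exterior
   product becomes the alternating shuffle product and d is determined by Cartan's formula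
   i_u d = L_u - d i_u, so that the Leibniz rule and d d = 0 are inductions on the list.  At a point x,
   let F_p be the cochains that vanish as soon as fewer than p arguments lie outside B; then
   F_p F_r is contained in F_(p+r), and forms in F_(q+1) vanish because B has corank q.

   For a section u of B one has i_u alpha = 0, hence L_u alpha = beta(u) alpha, and the identity
   L_[u,v] = [L_u, L_v] shows that w = d beta lies in F_1.  So d (beta w^q) = w^(q+1) = 0.
   If alpha' = f alpha, then h = ln|f| satisfies beta' = beta + c + d h with c in F_1.  Define
   E_0 = 0 and E_(n+1) = w' E_n + beta c w^n, where w' = d beta' = w + d c.  By induction
   d E_n + beta (w'^n - w^n) lies in F_(n+1), so that
   beta' w'^q - beta w^q - d (h w'^q - E_q) lies in F_(q+1) and therefore vanishes. *)

theory Submission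
  imports Defs "HOL-Complex_Analysis.Cauchy_Integral_Formula" "HOL-Library.Function_Algebras"
begin

text \<open>Two gaps separate this algebra from the forms of the statement. First, \<open>dA\<close>
  is a definite description and coboundaries are images of forms, so a cochain that serves as a
  derivative or as a primitive must be shown to come from a smooth form. The means is tensoriality:
  an alternating cochain that is linear over the smooth functions depends at x only on the values of
  its arguments at x, and bump functions extend vectors and local frames to global sections. Second,
  the anchor yields derivations of global functions, of which only linearity and the product rule
  are given. The formula d(ln|f|) = df/f therefore comes from a factorisation ln t = ln a + (t - a)
  S(t) with S smooth and S(a) = 1/a. The function h has the following origin. For u in B, L_u(f
  alpha) equals both beta'(u) f alpha and (f beta(u) + L_u f) alpha. Since alpha has no zero it can
  be cancelled, so beta' - beta - df/f vanishes on B. The same cancellation turns w(u,v) alpha = 0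
  into w(u,v) = 0.\<close>

section \<open>Smooth functions on open sets\<close>

lemma Ck_on_cong:
  assumes "open S" "\<And>x. x \<in> S \<Longrightarrow> f x = g x" "Ck_on k S f"
  shows "Ck_on k S g"
  using assms(2,3)
proof (induction k arbitrary: f g)
  case 0
  then show ?case using continuous_on_cong[of S S f g] by simp
next
  case (Suc k)
  have *: "(g has_derivative frechet_derivative f (at x)) (at x)" if "x \<in> S" for x
    using has_derivative_transform_within_open[OF _ \<open>open S\<close> that, of f _ UNIV g] Suc.prems that
    by (auto simp: frechet_derivative_works)
  then have "frechet_derivative f (at x) = frechet_derivative g (at x)" if "x \<in> S" for x
    using frechet_derivative_at[OF *[OF that]] by simp
  then show ?case using Suc.IH Suc.prems(2) * unfolding Ck_on.simps
    by (smt (verit, best) differentiable_def)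
qed

lemma Ck_on_subset: "T \<subseteq> S \<Longrightarrow> Ck_on k S f \<Longrightarrow> Ck_on k T f"
  by (induction k arbitrary: f) (auto intro: continuous_on_subset)

text \<open>Derivatives are taken \<open>at x\<close> and not within the set, so only the continuity
  clause has to be passed from neighbourhoods to S.\<close>

lemma Ck_on_locally:
  assumes "\<And>x. x \<in> S \<Longrightarrow> \<exists>T. open T \<and> x \<in> T \<and> Ck_on k T f"
  shows "Ck_on k S f"
  using assms
proof (induction k arbitrary: f)
  case 0
  then show ?case
    by (metis Ck_on.simps(1) at_within_open continuous_at_imp_continuous_on continuous_on_eq_continuous_within)
next
  case (Suc k)
  then show ?case by (metis Ck_on.simps(2))
qed

lemma Ck_on_Suc_imp: "open S \<Longrightarrow> Ck_on (Suc k) S f \<Longrightarrow> Ck_on k S f"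
proof (induction k arbitrary: f)
  case 0
  then show ?case
    by (auto intro!: continuous_at_imp_continuous_on differentiable_imp_continuous_within)
qed auto

lemma Ck_on_SucI:
  assumes "open S" "\<And>x. x \<in> S \<Longrightarrow> (f has_derivative f' x) (at x)"
    "\<And>v. Ck_on k S (\<lambda>x. f' x v)"
  shows "Ck_on (Suc k) S f"
proof -
  have "frechet_derivative f (at x) = f' x" if "x \<in> S" for x
    using frechet_derivative_at[OF assms(2)[OF that]] by simp
  then have "Ck_on k S (\<lambda>x. frechet_derivative f (at x) v)" for v
    by (intro Ck_on_cong[OF assms(1) _ assms(3)[of v]]) auto
  then show ?thesis using assms(2) by (auto simp: differentiable_def)
qed

lemma Ck_on_SucD:
  assumes "Ck_on (Suc k) S f" "x \<in> S"
  shows "(f has_derivative frechet_derivative f (at x)) (at x)"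
  using assms frechet_derivative_works by auto

lemma Ck_on_const: "open S \<Longrightarrow> Ck_on k S (\<lambda>x. c)"
  by (induction k arbitrary: c) (auto intro!: Ck_on_SucI[where f'="\<lambda>x v. 0"] simp del: Ck_on.simps(2))

lemma Ck_on_add:
  assumes "open S" "Ck_on k S f" "Ck_on k S g"
  shows "Ck_on k S (\<lambda>x. f x + g x)"
  using assms(2,3)
proof (induction k arbitrary: f g)
  case (Suc k)
  show ?case
    by (rule Ck_on_SucI[OF assms(1) has_derivative_add[OF Ck_on_SucD[OF Suc.prems(1)] Ck_on_SucD[OF Suc.prems(2)]]])
       (use Suc in auto)
qed (auto intro: continuous_intros)

lemma Ck_on_bilinear:
  assumes "bounded_bilinear pr" "open S" "Ck_on k S f" "Ck_on k S g"
  shows "Ck_on k S (\<lambda>x. pr (f x) (g x))"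
  using assms(3,4)
proof (induction k arbitrary: f g)
  case 0
  then show ?case using bounded_bilinear.continuous_on[OF assms(1)] by auto
next
  case (Suc k)
  show ?case
    by (rule Ck_on_SucI[OF assms(2) bounded_bilinear.FDERIV[OF assms(1) Ck_on_SucD[OF Suc.prems(1)] Ck_on_SucD[OF Suc.prems(2)]]])
       (use Suc.prems Ck_on_Suc_imp[OF assms(2) Suc.prems(1)] Ck_on_Suc_imp[OF assms(2) Suc.prems(2)]
         in \<open>auto intro!: Ck_on_add assms(2) Suc.IH\<close>)
qed

lemmas Ck_on_mult = Ck_on_bilinear[OF bounded_bilinear_mult]
  and Ck_on_inner = Ck_on_bilinear[OF bounded_bilinear_inner]

text \<open>The chain rule writes the derivative of g o f in a direction v as that of f times g' o
  f, and g' has one order of smoothness less than g. The induction therefore keeps f and varies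
  g.\<close>

lemma Ck_on_compose_real:
  fixes g :: "real \<Rightarrow> real"
  assumes "open S" "Ck_on k S f" "Ck_on k T g" "f ` S \<subseteq> T" "open T"
  shows "Ck_on k S (\<lambda>x. g (f x))"
  using assms(2,3)
proof (induction k arbitrary: g)
  case 0
  then show ?case
    using continuous_on_compose2[of T g S f] assms by auto
next
  case (Suc k)
  let ?g' = "\<lambda>t. frechet_derivative g (at t) 1"
  have f: "Ck_on k S f" by (rule Ck_on_Suc_imp[OF assms(1) Suc.prems(1)])
  have g': "Ck_on k T ?g'" using Suc.prems(2) by auto
  have d: "((\<lambda>x. g (f x)) has_derivative (\<lambda>v. frechet_derivative f (at x) v * ?g' (f x))) (at x)"
    if "x \<in> S" for x
  proof -
    have "f x \<in> T" using that assms(4) by auto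
    have dg: "(g has_derivative frechet_derivative g (at (f x))) (at (f x))"
      using Ck_on_SucD[OF Suc.prems(2) \<open>f x \<in> T\<close>] .
    have "frechet_derivative g (at (f x)) = (\<lambda>r. r * ?g' (f x))"
    proof
      fix r show "frechet_derivative g (at (f x)) r = r * ?g' (f x)"
      using linear_scale[OF has_derivative_linear[OF dg], of r 1] by simp
    qed
    from has_derivative_compose[OF Ck_on_SucD[OF Suc.prems(1) that] has_derivative_eq_rhs[OF dg this]]
    show ?thesis .
  qed
  show ?case
  proof (rule Ck_on_SucI[OF assms(1) d])
    fix v
    have "Ck_on k S (\<lambda>x. frechet_derivative f (at x) v)" using Suc.prems(1) by simp
    then show "Ck_on k S (\<lambda>x. frechet_derivative f (at x) v * ?g' (f x))"
      by (rule Ck_on_mult[OF assms(1) _ Suc.IH[OF f g']])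
  qed
qed

section \<open>Smooth functions of one real variable: inverse, logarithm and the flat
  exponential\<close>

lemma smooth_onI_deriv:
  fixes g :: "nat \<Rightarrow> real \<Rightarrow> real"
  assumes "open S" "\<And>n x. x \<in> S \<Longrightarrow> (g n has_real_derivative g (Suc n) x) (at x)"
  shows "smooth_on S (g n)"
  unfolding smooth_on_def
proof
  fix k show "Ck_on k S (g n)"
  \<comment> \<open>Lowering the order k by one raises the index n by one, so n stays
    general.\<close>
  proof (induction k arbitrary: n)
    case 0
    have "continuous_on S (g n)"
      using assms(2) by (intro continuous_at_imp_continuous_on ballI DERIV_isCont)
    then show ?case by simp
  next
    case (Suc k)
    show ?case
      by (rule Ck_on_SucI[OF assms(1) assms(2)[unfolded has_field_derivative_def]])
         (simp_all add: Ck_on_mult Suc Ck_on_const assms(1))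
  qed
qed

lemma Ck_on_Suc_real:
  fixes g :: "real \<Rightarrow> real"
  assumes "open S" "\<And>x. x \<in> S \<Longrightarrow> (g has_real_derivative g' x) (at x)" "Ck_on k S g'"
  shows "Ck_on (Suc k) S g"
  by (rule Ck_on_SucI[OF assms(1) assms(2)[unfolded has_field_derivative_def]])
     (simp_all add: Ck_on_mult assms Ck_on_const)

lemma smooth_on_inverse: "smooth_on {x::real. x \<noteq> 0} inverse"
  unfolding smooth_on_def
proof
  have op: "open {x::real. x \<noteq> 0}" by (simp add: open_Collect_neq)
  fix k show "Ck_on k {x::real. x \<noteq> 0} inverse"
  proof (induction k)
    case 0 then show ?case by (auto intro!: continuous_intros)
  next
    case (Suc k)
    have "Ck_on k {x::real. x \<noteq> 0} (\<lambda>x. (-1) * (inverse x * inverse x))"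
      by (intro Ck_on_mult op Suc Ck_on_const)
    then show ?case
      by (rule Ck_on_Suc_real[OF op, rotated])
         (auto intro!: derivative_eq_intros simp: power2_eq_square)
  qed
qed

lemma smooth_on_ln: "smooth_on {0<..} (ln :: real \<Rightarrow> real)"
  unfolding smooth_on_def
proof
  fix k show "Ck_on k {0<..} (ln :: real \<Rightarrow> real)"
  proof (cases k)
    case 0 then show ?thesis by (auto intro!: continuous_intros)
  next
    case (Suc j)
    have "Ck_on j {0<..} (inverse :: real \<Rightarrow> real)"
      using smooth_on_inverse Ck_on_subset[of "{0<..}" "{x::real. x \<noteq> 0}" j inverse]
      by (auto simp: smooth_on_def)
    then show ?thesis unfolding Suc
      by (rule Ck_on_Suc_real[rotated -1]) (auto intro!: derivative_eq_intros simp: field_simps)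
  qed
qed

text \<open>The quotient is smooth across \<open>a\<close> because it extends to a holomorphic function.\<close>

lemma smooth_ln_quotient:
  fixes a :: real
  assumes "a > 0"
  obtains S where "smooth_on {0<..} S" "S a = 1 / a" "\<And>t. t > 0 \<Longrightarrow> ln t = ln a + (t - a) * S t"
proof -
  let ?H = "{z. Re z > 0}"
  \<comment> \<open>The difference quotient of the complex logarithm, with its removable singularity
    at a filled by the derivative.\<close>
  define G where "G z = (if z = of_real a then deriv Ln (of_real a) else (Ln z - Ln (of_real a)) / (z - of_real a))" for z
  have op: "open ?H" by (rule open_halfspace_Re_gt)
  have "Ln holomorphic_on ?H"
    by (intro holomorphic_on_Ln) (auto simp: complex_nonpos_Reals_iff)
  then have G: "G holomorphic_on ?H"
    using pole_lemma_open[of Ln ?H "of_real a"] op by (auto simp: G_def[abs_def])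
  have hol: "(deriv ^^ n) G holomorphic_on ?H" for n
    using holomorphic_higher_deriv[OF G op] .
  \<comment> \<open>Along the real axis the real parts of the complex derivatives of G form a
    sequence of successive real derivatives, as \<open>smooth_onI_deriv\<close> requires.\<close>
  define S where "S n t = Re ((deriv ^^ n) G (of_real t))" for n t
  have "(S n has_real_derivative S (Suc n) t) (at t)" if "t > 0" for n t
  proof -
    have "((deriv ^^ n) G has_field_derivative (deriv ^^ Suc n) G (of_real t)) (at (of_real t))"
      using holomorphic_derivI[OF hol op, of "of_real t" n] that by simp
    then have "((\<lambda>t. (deriv ^^ n) G (of_real t)) has_vector_derivative (deriv ^^ Suc n) G (of_real t)) (at t)"
      by (rule has_vector_derivative_real_field)
    then show ?thesis
      unfolding S_def has_real_derivative_iff_has_vector_derivative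
      by (auto intro!: derivative_eq_intros has_derivative_Re simp: has_vector_derivative_def)
  qed
  then have smooth: "smooth_on {0<..} (S 0)"
    by (intro smooth_onI_deriv) auto
  moreover have "deriv Ln (of_real a) = 1 / of_real a"
    using assms by (intro DERIV_imp_deriv) (auto intro!: derivative_eq_intros simp: complex_nonpos_Reals_iff field_simps)
  then have "G (of_real a) = of_real (1 / a)" by (simp add: G_def)
  then have "S 0 a = 1 / a" by (simp add: S_def)
  moreover have "ln t = ln a + (t - a) * S 0 t" if "t > 0" for t
  proof (cases "t = a")
    case False
    have "G (of_real t) = of_real ((ln t - ln a) / (t - a))"
      using False assms that by (simp add: G_def Ln_of_real)
    then have "S 0 t = (ln t - ln a) / (t - a)" by (simp add: S_def)
    then show ?thesis using False by simp
  qed simp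
  ultimately show ?thesis using that by blast
qed

text \<open>The flat function exp(-1/s), multiplied by a power of 1/s. The exponent n is carried
  along because differentiation leads from n to a combination of n + 1 and n + 2, so the whole
  family can be treated by one induction.\<close>

definition flat_exp :: "nat \<Rightarrow> real \<Rightarrow> real" where
  "flat_exp n s = (if s > 0 then exp (- inverse s) * inverse s ^ n else 0)"

text \<open>A single term of the exponential series already gives exp(1/s) >= s^-(n+2) / (n+2)!. Two
  surplus powers are kept so that the quotient by s still tends to 0 at the origin.\<close>

lemma flat_exp_bound: "\<bar>flat_exp n s\<bar> \<le> fact (n + 2) * s\<^sup>2"
proof (cases "s > 0")
  case True
  have "inverse s ^ (n + 2) / fact (n + 2) \<le> exp (inverse s)"
  proof -
    have "(\<lambda>i. inverse s ^ i /\<^sub>R fact i) sums exp (inverse s)" by (rule exp_converges)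
    from sum_le_suminf[OF sums_summable[OF this], of "{n + 2}"] sums_unique[OF this]
    have "inverse s ^ (n + 2) /\<^sub>R fact (n + 2) \<le> exp (inverse s)"
      using True by (simp del: fact_Suc power_Suc add_2_eq_Suc')
    then show ?thesis
      by (simp add: divide_inverse mult.commute del: fact_Suc power_Suc add_2_eq_Suc')
  qed
  then have "inverse s ^ (n + 2) \<le> fact (n + 2) * exp (inverse s)"
    by (subst (asm) pos_divide_le_eq) (auto simp: mult.commute simp del: fact_Suc power_Suc add_2_eq_Suc')
  then have "exp (- inverse s) * inverse s ^ (n + 2) \<le> exp (- inverse s) * (fact (n + 2) * exp (inverse s))"
    by (rule mult_left_mono) simp
  also have "\<dots> = fact (n + 2)"
    by (simp add: exp_minus del: fact_Suc add_2_eq_Suc')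
  finally have "exp (- inverse s) * inverse s ^ (n + 2) \<le> fact (n + 2)" .
  then have "exp (- inverse s) * inverse s ^ (n + 2) * s\<^sup>2 \<le> fact (n + 2) * s\<^sup>2"
    by (intro mult_right_mono) auto
  moreover have "exp (- inverse s) * inverse s ^ (n + 2) * s\<^sup>2 = exp (- inverse s) * inverse s ^ n"
    using True by (simp add: power_add field_simps power2_eq_square)
  ultimately have "exp (- inverse s) * inverse s ^ n \<le> fact (n + 2) * s\<^sup>2" by (simp only:)
  then show ?thesis using True
    by (simp add: flat_exp_def abs_mult del: fact_Suc add_2_eq_Suc')
qed (simp add: flat_exp_def)

text \<open>Away from 0 this is calculus on each side. At 0 the claimed derivative is 0, and the
  quadratic bound makes the difference quotient at most (n+2)! |h|.\<close>

lemma flat_exp_deriv: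
  "(flat_exp n has_real_derivative flat_exp (n + 2) s - real n * flat_exp (n + 1) s) (at s)"
proof -
  consider "s > 0" | "s = 0" | "s < 0" by linarith
  then show ?thesis
  proof cases
    case 1
    have "((\<lambda>s. exp (- inverse s) * inverse s ^ n) has_real_derivative
        flat_exp (n + 2) s - real n * flat_exp (n + 1) s) (at s)"
      using 1 by (auto intro!: derivative_eq_intros simp: flat_exp_def power_add power2_eq_square algebra_simps)
        (cases n; simp add: field_simps)
    then show ?thesis
      by (rule has_field_derivative_transform_within_open[OF _ open_greaterThan[of 0]])
         (use 1 in \<open>auto simp: flat_exp_def\<close>)
  next
    case 3
    have "((\<lambda>s. 0) has_real_derivative flat_exp (n + 2) s - real n * flat_exp (n + 1) s) (at s)"
      using 3 by (simp add: flat_exp_def)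
    then show ?thesis
      by (rule has_field_derivative_transform_within_open[OF _ open_lessThan[of 0]])
         (use 3 in \<open>auto simp: flat_exp_def\<close>)
  next
    case 2
    have "((\<lambda>h. (flat_exp n (0 + h) - flat_exp n 0) / h) \<longlongrightarrow> 0) (at 0)"
    proof (rule Lim_null_comparison)
      have *: "norm (flat_exp n h / h) \<le> fact (n + 2) * \<bar>h\<bar>" for h
      proof (cases "h = 0")
        case False
        have "\<bar>flat_exp n h\<bar> \<le> (fact (n + 2) * \<bar>h\<bar>) * \<bar>h\<bar>"
          using flat_exp_bound[of n h] by (simp add: power2_eq_square mult.assoc del: fact_Suc add_2_eq_Suc')
        then show ?thesis using False
          by (simp add: pos_divide_le_eq del: fact_Suc add_2_eq_Suc')
      qed (simp del: fact_Suc)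
      then show "\<forall>\<^sub>F h in at 0. norm ((flat_exp n (0 + h) - flat_exp n 0) / h) \<le> fact (n + 2) * \<bar>h\<bar>"
        using *[unfolded real_norm_def] by (auto simp: flat_exp_def[of n 0] intro!: always_eventually)
      show "((\<lambda>h::real. fact (n + 2) * \<bar>h\<bar>) \<longlongrightarrow> 0) (at 0)"
        by (auto intro!: tendsto_eq_intros)
    qed
    then show ?thesis using 2 by (simp add: DERIV_def flat_exp_def)
  qed
qed

lemma smooth_flat_exp: "smooth_on UNIV (flat_exp n)"
  unfolding smooth_on_def
proof
  fix k show "Ck_on k UNIV (flat_exp n)"
  proof (induction k arbitrary: n)
    case 0
    then show ?case
      using DERIV_isCont[OF flat_exp_deriv] by (auto intro!: continuous_at_imp_continuous_on)
  next
    case (Suc k)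
    have "Ck_on k UNIV (\<lambda>s. flat_exp (n + 2) s + (- real n) * flat_exp (n + 1) s)"
      by (intro Ck_on_add Ck_on_mult Ck_on_const Suc) auto
    then show ?case
      by (rule Ck_on_Suc_real[rotated -1]) (use flat_exp_deriv[of n] in auto)
  qed
qed

type_synonym ('m, 'a) cochain = "('m \<Rightarrow> 'a) list \<Rightarrow> 'm \<Rightarrow> real"

section \<open>The shuffle product\<close>

text \<open>The interior product i_u, with u entering in the first slot.\<close>

definition ins :: "'s \<Rightarrow> ('s list \<Rightarrow> 'r) \<Rightarrow> 's list \<Rightarrow> 'r" where
  "ins u \<eta> = (\<lambda>vs. \<eta> (u # vs))"

text \<open>The parity involution, multiplication by (-1)^degree with the length of the list as
  degree. It carries the signs of the graded rules, so these hold for cochains of mixed degree as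
  well.\<close>

definition bar :: "('s list \<Rightarrow> 'r::comm_ring_1) \<Rightarrow> 's list \<Rightarrow> 'r" where
  "bar \<eta> = (\<lambda>vs. (- 1) ^ length vs * \<eta> vs)"

text \<open>The recursion says that i_u is an antiderivation. Unrolled, it is the signed sum over
  all ways to deal the arguments out to the two factors in their given order, so no factorials
  appear.\<close>

fun shuffle :: "('s list \<Rightarrow> 'r::comm_ring_1) \<Rightarrow> ('s list \<Rightarrow> 'r) \<Rightarrow> 's list \<Rightarrow> 'r" where
  "shuffle \<omega> \<eta> [] = \<omega> [] * \<eta> []"
| "shuffle \<omega> \<eta> (u # vs) = shuffle (ins u \<omega>) \<eta> vs + shuffle (bar \<omega>) (ins u \<eta>) vs"

lemma ins_apply [simp]: "ins u \<eta> vs = \<eta> (u # vs)"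
  by (simp add: ins_def)

lemma ins_linear [simp]:
  "ins u (\<omega> + \<eta>) = ins u \<omega> + ins u \<eta>" "ins u (- \<omega>) = - ins u \<omega>"
  "ins u (\<omega> - \<eta>) = ins u \<omega> - ins u \<eta>" "ins u 0 = 0"
  by (auto simp: fun_eq_iff)

lemma bar_linear [simp]:
  "bar (\<omega> + \<eta>) = bar \<omega> + bar \<eta>" "bar (- \<omega>) = - bar \<omega>"
  "bar (\<omega> - \<eta>) = bar \<omega> - bar \<eta>" "bar 0 = 0"
  by (auto simp: fun_eq_iff bar_def algebra_simps)

lemma bar_bar [simp]: "bar (bar \<omega>) = \<omega>"
  by (auto simp: fun_eq_iff bar_def simp flip: mult.assoc power_mult_distrib)

lemma ins_bar [simp]: "ins u (bar \<omega>) = - bar (ins u \<omega>)"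
  by (auto simp: fun_eq_iff bar_def)

text \<open>Only lists with members from vs are ever evaluated. Hence a factor may be replaced by
  one that agrees with it merely on lists of sections.\<close>

lemma shuffle_cong:
  "(\<And>us. set us \<subseteq> set vs \<Longrightarrow> \<omega> us = \<omega>' us) \<Longrightarrow> (\<And>us. set us \<subseteq> set vs \<Longrightarrow> \<eta> us = \<eta>' us) \<Longrightarrow>
    shuffle \<omega> \<eta> vs = shuffle \<omega>' \<eta>' vs"
proof (induction vs arbitrary: \<omega> \<omega>' \<eta> \<eta>')
  case (Cons u vs)
  have "shuffle (ins u \<omega>) \<eta> vs = shuffle (ins u \<omega>') \<eta>' vs"
  proof (rule Cons.IH)
    fix us assume us: "set us \<subseteq> set vs"
    show "ins u \<omega> us = ins u \<omega>' us"
      unfolding ins_apply by (rule Cons.prems(1)) (use us in auto)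
    show "\<eta> us = \<eta>' us" by (rule Cons.prems(2)) (use us in auto)
  qed
  moreover have "shuffle (bar \<omega>) (ins u \<eta>) vs = shuffle (bar \<omega>') (ins u \<eta>') vs"
  proof (rule Cons.IH)
    fix us assume us: "set us \<subseteq> set vs"
    have "\<omega> us = \<omega>' us" by (rule Cons.prems(1)) (use us in auto)
    then show "bar \<omega> us = bar \<omega>' us" by (simp add: bar_def)
    show "ins u \<eta> us = ins u \<eta>' us"
      unfolding ins_apply by (rule Cons.prems(2)) (use us in auto)
  qed
  ultimately show ?case by simp
qed simp

lemma shuffle_add_left: "shuffle (\<omega> + \<omega>') \<eta> = shuffle \<omega> \<eta> + shuffle \<omega>' \<eta>"
proof
  fix vs show "shuffle (\<omega> + \<omega>') \<eta> vs = (shuffle \<omega> \<eta> + shuffle \<omega>' \<eta>) vs"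
    by (induction vs arbitrary: \<omega> \<omega>' \<eta>) (auto simp: algebra_simps)
qed

lemma shuffle_add_right: "shuffle \<omega> (\<eta> + \<eta>') = shuffle \<omega> \<eta> + shuffle \<omega> \<eta>'"
proof
  fix vs show "shuffle \<omega> (\<eta> + \<eta>') vs = (shuffle \<omega> \<eta> + shuffle \<omega> \<eta>') vs"
    by (induction vs arbitrary: \<omega> \<eta> \<eta>') (auto simp: algebra_simps)
qed

lemma shuffle_zero [simp]: "shuffle 0 \<eta> = 0" "shuffle \<omega> 0 = 0"
  using shuffle_add_left[of 0 0 \<eta>] shuffle_add_right[of \<omega> 0 0] by simp_all

lemma shuffle_minus [simp]: "shuffle (- \<omega>) \<eta> = - shuffle \<omega> \<eta>" "shuffle \<omega> (- \<eta>) = - shuffle \<omega> \<eta>"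
  using shuffle_add_left[of \<omega> "- \<omega>" \<eta>] shuffle_add_right[of \<omega> \<eta> "- \<eta>"]
  by (simp_all add: eq_neg_iff_add_eq_0 add.commute)

lemma shuffle_diff: "shuffle (\<omega> - \<omega>') \<eta> = shuffle \<omega> \<eta> - shuffle \<omega>' \<eta>"
  "shuffle \<omega> (\<eta> - \<eta>') = shuffle \<omega> \<eta> - shuffle \<omega> \<eta>'"
  using shuffle_add_left[of \<omega> "- \<omega>'" \<eta>] shuffle_add_right[of \<omega> \<eta> "- \<eta>'"] by simp_all

lemmas shuffle_bilinear = shuffle_add_left shuffle_add_right shuffle_diff shuffle_minus

lemma ins_shuffle: "ins u (shuffle \<omega> \<eta>) = shuffle (ins u \<omega>) \<eta> + shuffle (bar \<omega>) (ins u \<eta>)"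
  by (auto simp: fun_eq_iff)

text \<open>Degrees add under the product, so the parity involution is multiplicative. Associativity
  rests on this: its induction meets the parity of a product.\<close>

lemma shuffle_bar: "shuffle (bar \<omega>) (bar \<eta>) = bar (shuffle \<omega> \<eta>)"
proof
  fix vs show "shuffle (bar \<omega>) (bar \<eta>) vs = bar (shuffle \<omega> \<eta>) vs"
  proof (induction vs arbitrary: \<omega> \<eta>)
    case (Cons u vs)
    have "bar (shuffle \<omega> \<eta>) (u # vs) =
        - bar (shuffle (ins u \<omega>) \<eta>) vs - bar (shuffle (bar \<omega>) (ins u \<eta>)) vs"
      by (simp add: bar_def algebra_simps)
    moreover have "shuffle \<omega> (bar (ins u \<eta>)) vs = bar (shuffle (bar \<omega>) (ins u \<eta>)) vs"
      by (metis Cons.IH bar_bar)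
    moreover have "shuffle (bar \<omega>) (bar \<eta>) (u # vs) =
        - shuffle (bar (ins u \<omega>)) (bar \<eta>) vs - shuffle \<omega> (bar (ins u \<eta>)) vs"
      by simp
    ultimately show ?case by (simp only: Cons.IH)
  qed (simp add: bar_def)
qed

lemma shuffle_assoc: "shuffle (shuffle \<omega> \<eta>) \<zeta> = shuffle \<omega> (shuffle \<eta> \<zeta>)"
proof
  fix vs show "shuffle (shuffle \<omega> \<eta>) \<zeta> vs = shuffle \<omega> (shuffle \<eta> \<zeta>) vs"
    by (induction vs arbitrary: \<omega> \<eta> \<zeta>)
       (auto simp: ins_shuffle shuffle_bilinear mult.assoc simp flip: shuffle_bar)
qed

text \<open>Graded commutativity needs no alternation: it is built into the shuffle product.\<close>

lemma shuffle_even_odd_commute: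
  fixes \<omega> \<eta> :: "'s list \<Rightarrow> 'r::comm_ring_1"
  shows "(bar \<omega> = \<omega> \<longrightarrow> shuffle \<omega> \<eta> vs = shuffle \<eta> \<omega> vs) \<and>
    (bar \<omega> = - \<omega> \<longrightarrow> shuffle \<omega> \<eta> vs = shuffle (bar \<eta>) \<omega> vs)"
\<comment> \<open>Contraction exchanges even and odd cochains, so both parities go through one
  induction.\<close>
proof (induction vs arbitrary: \<omega> \<eta>)
  case (Cons u vs)
  have even: "bar (ins u \<omega>) = - ins u \<omega>" if "bar \<omega> = \<omega>"
    using ins_bar[of u \<omega>] that by (metis minus_equation_iff)
  have odd: "bar (ins u \<omega>) = ins u \<omega>" if "bar \<omega> = - \<omega>"
    using ins_bar[of u \<omega>] that by (metis ins_linear(2) neg_equal_iff_equal)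
  show ?case
  proof (intro conjI impI)
    assume *: "bar \<omega> = \<omega>"
    show "shuffle \<omega> \<eta> (u # vs) = shuffle \<eta> \<omega> (u # vs)"
    proof -
      have 1: "shuffle (ins u \<omega>) \<eta> vs = shuffle (bar \<eta>) (ins u \<omega>) vs"
        using Cons.IH[of "ins u \<omega>" \<eta>] even[OF *] by blast
      have 2: "shuffle \<omega> (ins u \<eta>) vs = shuffle (ins u \<eta>) \<omega> vs"
        using Cons.IH[of \<omega> "ins u \<eta>"] * by blast
      show ?thesis unfolding shuffle.simps * 1 2 by (rule add.commute)
    qed
  next
    assume *: "bar \<omega> = - \<omega>"
    show "shuffle \<omega> \<eta> (u # vs) = shuffle (bar \<eta>) \<omega> (u # vs)"
    proof -
      have 1: "shuffle (ins u \<omega>) \<eta> vs = shuffle \<eta> (ins u \<omega>) vs"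
        using Cons.IH[of "ins u \<omega>" \<eta>] odd[OF *] by blast
      have 2: "shuffle \<omega> (ins u \<eta>) vs = shuffle (bar (ins u \<eta>)) \<omega> vs"
        using Cons.IH[of \<omega> "ins u \<eta>"] * by blast
      show ?thesis
        unfolding shuffle.simps * ins_bar bar_bar shuffle_minus uminus_apply 1 2 by (rule add.commute)
    qed
  qed
qed (auto simp: bar_def mult.commute)

lemma shuffle_even_commute: "bar \<omega> = \<omega> \<Longrightarrow> shuffle \<omega> \<eta> = shuffle \<eta> \<omega>"
  using shuffle_even_odd_commute[of \<omega> \<eta>] by auto

lemma shuffle_even_left_commute:
  "bar \<omega> = \<omega> \<Longrightarrow> shuffle \<omega> (shuffle \<eta> \<zeta>) = shuffle \<eta> (shuffle \<omega> \<zeta>)"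
  by (metis shuffle_assoc shuffle_even_commute)

section \<open>Cartan calculus on cochains\<close>

text \<open>\<open>C\<close> stands for the smooth functions, \<open>S\<close> for the sections, \<open>L u\<close> for the derivation along the
  anchor of \<open>u\<close>.\<close>

locale lie_rinehart =
  fixes C :: "('m \<Rightarrow> real) set"
    and S :: "('m \<Rightarrow> 'a::real_vector) set"
    and L :: "('m \<Rightarrow> 'a) \<Rightarrow> ('m \<Rightarrow> real) \<Rightarrow> 'm \<Rightarrow> real"
    and br :: "('m \<Rightarrow> 'a) \<Rightarrow> ('m \<Rightarrow> 'a) \<Rightarrow> 'm \<Rightarrow> 'a"
  assumes C_const [simp]: "(\<lambda>x. c) \<in> C"
    and C_add: "f \<in> C \<Longrightarrow> g \<in> C \<Longrightarrow> f + g \<in> C"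
    and C_mult: "f \<in> C \<Longrightarrow> g \<in> C \<Longrightarrow> f * g \<in> C"
    and S_nonempty: "S \<noteq> {}"
    and S_lin: "\<lbrakk>f \<in> C; g \<in> C; u \<in> S; v \<in> S\<rbrakk> \<Longrightarrow> (\<lambda>x. f x *\<^sub>R u x + g x *\<^sub>R v x) \<in> S"
    and L_C: "u \<in> S \<Longrightarrow> f \<in> C \<Longrightarrow> L u f \<in> C"
    and L_add: "\<lbrakk>u \<in> S; f \<in> C; g \<in> C\<rbrakk> \<Longrightarrow> L u (f + g) = L u f + L u g"
    and L_mult: "\<lbrakk>u \<in> S; f \<in> C; g \<in> C\<rbrakk> \<Longrightarrow> L u (f * g) = f * L u g + g * L u f"
    and L_const: "u \<in> S \<Longrightarrow> L u (\<lambda>x. c) = 0"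
    and L_lin: "\<lbrakk>f \<in> C; g \<in> C; u \<in> S; v \<in> S; h \<in> C\<rbrakk> \<Longrightarrow>
      L (\<lambda>x. f x *\<^sub>R u x + g x *\<^sub>R v x) h = f * L u h + g * L v h"
    and br_S: "u \<in> S \<Longrightarrow> v \<in> S \<Longrightarrow> br u v \<in> S"
    and br_antisym: "u \<in> S \<Longrightarrow> v \<in> S \<Longrightarrow> br v u = (\<lambda>x. - br u v x)"
    and br_lin: "\<lbrakk>f \<in> C; g \<in> C; u \<in> S; v \<in> S; w \<in> S\<rbrakk> \<Longrightarrow>
      br w (\<lambda>x. f x *\<^sub>R u x + g x *\<^sub>R v x) =
        (\<lambda>x. (f x *\<^sub>R br w u x + L w f x *\<^sub>R u x) + (g x *\<^sub>R br w v x + L w g x *\<^sub>R v x))"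
    and br_jacobi: "\<lbrakk>u \<in> S; v \<in> S; w \<in> S\<rbrakk> \<Longrightarrow>
      br u (br v w) = (\<lambda>x. br (br u v) w x + br v (br u w) x)"
    and L_br: "\<lbrakk>u \<in> S; v \<in> S; f \<in> C\<rbrakk> \<Longrightarrow> L (br u v) f = L u (L v f) - L v (L u f)"
begin

definition val :: "('m, 'a) cochain \<Rightarrow> bool" where
  "val \<eta> \<longleftrightarrow> (\<forall>vs. set vs \<subseteq> S \<longrightarrow> \<eta> vs \<in> C)"

definition mlin :: "('m, 'a) cochain \<Rightarrow> bool" where
  "mlin \<eta> \<longleftrightarrow> (\<forall>xs ys u v. \<forall>f\<in>C. \<forall>g\<in>C. set xs \<subseteq> S \<and> set ys \<subseteq> S \<and> u \<in> S \<and> v \<in> S \<longrightarrow>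
     \<eta> (xs @ (\<lambda>x. f x *\<^sub>R u x + g x *\<^sub>R v x) # ys) = f * \<eta> (xs @ u # ys) + g * \<eta> (xs @ v # ys))"

text \<open>Adjacent swaps generate all permutations, and they fit the recursion on lists.\<close>

definition asym :: "('m, 'a) cochain \<Rightarrow> bool" where
  "asym \<eta> \<longleftrightarrow> (\<forall>xs ys u v. set xs \<subseteq> S \<and> set ys \<subseteq> S \<and> u \<in> S \<and> v \<in> S \<longrightarrow>
     \<eta> (xs @ u # v # ys) = - \<eta> (xs @ v # u # ys))"

text \<open>The recursion is the commutation rule i_v L_u = L_u i_v - i_[u,v].\<close>

fun Lie :: "('m \<Rightarrow> 'a) \<Rightarrow> ('m, 'a) cochain \<Rightarrow> ('m, 'a) cochain" where
  "Lie u \<eta> [] = L u (\<eta> [])"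
| "Lie u \<eta> (v # vs) = Lie u (ins v \<eta>) vs - \<eta> (br u v # vs)"

fun D :: "('m, 'a) cochain \<Rightarrow> ('m, 'a) cochain" where
  "D \<eta> [] = 0"
| "D \<eta> (u # vs) = Lie u \<eta> vs - D (ins u \<eta>) vs"

lemma C_zero [simp]: "0 \<in> C"
  using C_const[of 0] by (simp add: zero_fun_def)

lemma C_one [simp]: "1 \<in> C"
  using C_const[of 1] by (simp add: one_fun_def)

lemma C_minus: "f \<in> C \<Longrightarrow> - f \<in> C"
  using C_mult[OF C_const[of "-1"], of f] by (simp add: fun_Compl_def times_fun_def)

lemma C_diff: "f \<in> C \<Longrightarrow> g \<in> C \<Longrightarrow> f - g \<in> C"
  using C_add[OF _ C_minus, of f g] by simp

lemma L_zero [simp]: "u \<in> S \<Longrightarrow> L u 0 = 0"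
  using L_const[of u 0] by (simp add: zero_fun_def)

lemma S_zero: "(\<lambda>x. 0) \<in> S"
proof -
  obtain u where "u \<in> S" using S_nonempty by blast
  then show ?thesis using S_lin[of 0 0 u u] by simp
qed

lemma val_ins: "val \<eta> \<Longrightarrow> u \<in> S \<Longrightarrow> val (ins u \<eta>)"
  by (auto simp: val_def)

lemma mlin_ins:
  assumes "mlin \<eta>" "w \<in> S"
  shows "mlin (ins w \<eta>)"
  unfolding mlin_def
proof (intro allI ballI impI)
  fix xs ys u v f g
  assume "f \<in> C" "g \<in> C" "set xs \<subseteq> S \<and> set ys \<subseteq> S \<and> u \<in> S \<and> v \<in> S"
  then show "ins w \<eta> (xs @ (\<lambda>x. f x *\<^sub>R u x + g x *\<^sub>R v x) # ys)
      = f * ins w \<eta> (xs @ u # ys) + g * ins w \<eta> (xs @ v # ys)"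
    using assms(1)[unfolded mlin_def, rule_format, of f g "w # xs" ys u v] assms(2) by simp
qed

lemma asym_ins:
  assumes "asym \<eta>" "w \<in> S"
  shows "asym (ins w \<eta>)"
  unfolding asym_def
proof (intro allI ballI impI)
  fix xs ys u v
  assume "set xs \<subseteq> S \<and> set ys \<subseteq> S \<and> u \<in> S \<and> v \<in> S"
  then show "ins w \<eta> (xs @ u # v # ys) = - ins w \<eta> (xs @ v # u # ys)"
    using assms(1)[unfolded asym_def, rule_format, of "w # xs" ys u v] assms(2) by simp
qed

lemma val_bar: "val \<eta> \<Longrightarrow> val (bar \<eta>)"
proof -
  have "(- 1 :: 'm \<Rightarrow> real) ^ n \<in> C" for n
    by (induction n) (simp_all only: power_0 power_Suc C_one C_mult C_minus)
  then show "val \<eta> \<Longrightarrow> val (bar \<eta>)" by (auto simp: val_def bar_def intro: C_mult)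
qed

lemma val_arith:
  "val \<omega> \<Longrightarrow> val \<eta> \<Longrightarrow> val (\<omega> + \<eta>)" "val \<omega> \<Longrightarrow> val (- \<omega>)" "val \<omega> \<Longrightarrow> val \<eta> \<Longrightarrow> val (\<omega> - \<eta>)" "val 0"
  by (auto simp: val_def intro: C_add C_minus C_diff)

lemma val_shuffle: "val \<omega> \<Longrightarrow> val \<eta> \<Longrightarrow> val (shuffle \<omega> \<eta>)"
proof -
  have "set vs \<subseteq> S \<Longrightarrow> val \<omega> \<Longrightarrow> val \<eta> \<Longrightarrow> shuffle \<omega> \<eta> vs \<in> C" for vs
    by (induction vs arbitrary: \<omega> \<eta>) (simp_all add: C_add C_mult val_ins val_bar, simp add: C_mult val_def)
  then show "val \<omega> \<Longrightarrow> val \<eta> \<Longrightarrow> val (shuffle \<omega> \<eta>)" by (simp add: val_def)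
qed

lemma val_Lie: "val \<eta> \<Longrightarrow> u \<in> S \<Longrightarrow> val (Lie u \<eta>)"
proof -
  have "set vs \<subseteq> S \<Longrightarrow> val \<eta> \<Longrightarrow> u \<in> S \<Longrightarrow> Lie u \<eta> vs \<in> C" for vs
  proof (induction vs arbitrary: \<eta>)
    case (Cons v vs)
    have "\<eta> (br u v # vs) \<in> C" using br_S Cons.prems by (simp add: val_def)
    moreover have "Lie u (ins v \<eta>) vs \<in> C" using Cons.prems by (intro Cons.IH val_ins) auto
    ultimately show "Lie u \<eta> (v # vs) \<in> C" by (simp add: C_diff)
  qed (auto simp: val_def L_C)
  then show "val \<eta> \<Longrightarrow> u \<in> S \<Longrightarrow> val (Lie u \<eta>)" by (simp add: val_def)
qed

lemma val_D: "val \<eta> \<Longrightarrow> val (D \<eta>)"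
proof -
  have "set vs \<subseteq> S \<Longrightarrow> val \<eta> \<Longrightarrow> D \<eta> vs \<in> C" for vs
  proof (induction vs arbitrary: \<eta>)
    case (Cons v vs)
    have "Lie v \<eta> vs \<in> C" using val_Lie[of \<eta> v] Cons.prems by (simp add: val_def)
    moreover have "D (ins v \<eta>) vs \<in> C" using Cons.prems by (intro Cons.IH val_ins) auto
    ultimately show "D \<eta> (v # vs) \<in> C" by (simp add: C_diff)
  qed auto
  then show "val \<eta> \<Longrightarrow> val (D \<eta>)" by (simp add: val_def)
qed

lemma Lie_cong:
  "(\<And>us. set us \<subseteq> S \<Longrightarrow> \<eta> us = \<eta>' us) \<Longrightarrow> u \<in> S \<Longrightarrow> set vs \<subseteq> S \<Longrightarrow> Lie u \<eta> vs = Lie u \<eta>' vs"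
proof (induction vs arbitrary: \<eta> \<eta>')
  case Nil
  show "Lie u \<eta> [] = Lie u \<eta>' []" using Nil(1)[of "[]"] by simp
next
  case (Cons v vs)
  have "Lie u (ins v \<eta>) vs = Lie u (ins v \<eta>') vs"
  proof (rule Cons.IH)
    fix us assume "set us \<subseteq> S"
    then show "ins v \<eta> us = ins v \<eta>' us"
      unfolding ins_apply by (intro Cons.prems(1)) (use Cons.prems(3) in auto)
  qed (use Cons.prems in auto)
  moreover have "\<eta> (br u v # vs) = \<eta>' (br u v # vs)"
    by (rule Cons.prems(1)) (use Cons.prems(2,3) br_S in auto)
  ultimately show "Lie u \<eta> (v # vs) = Lie u \<eta>' (v # vs)" by simp
qed

lemma D_cong:
  "(\<And>us. set us \<subseteq> S \<Longrightarrow> \<eta> us = \<eta>' us) \<Longrightarrow> set vs \<subseteq> S \<Longrightarrow> D \<eta> vs = D \<eta>' vs"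
proof (induction vs arbitrary: \<eta> \<eta>')
  case (Cons u vs)
  have "D (ins u \<eta>) vs = D (ins u \<eta>') vs"
  proof (rule Cons.IH)
    fix us assume "set us \<subseteq> S"
    then show "ins u \<eta> us = ins u \<eta>' us"
      unfolding ins_apply by (intro Cons.prems(1)) (use Cons.prems(2) in auto)
  qed (use Cons.prems in auto)
  moreover have "Lie u \<eta> vs = Lie u \<eta>' vs"
    by (rule Lie_cong[OF Cons.prems(1)]) (use Cons.prems(2) in auto)
  ultimately show "D \<eta> (u # vs) = D \<eta>' (u # vs)" by simp
qed simp

lemma Lie_add:
  "val \<eta> \<Longrightarrow> val \<eta>' \<Longrightarrow> u \<in> S \<Longrightarrow> set vs \<subseteq> S \<Longrightarrow> Lie u (\<eta> + \<eta>') vs = Lie u \<eta> vs + Lie u \<eta>' vs"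
proof (induction vs arbitrary: \<eta> \<eta>')
  case (Cons v vs)
  have "Lie u (ins v \<eta> + ins v \<eta>') vs = Lie u (ins v \<eta>) vs + Lie u (ins v \<eta>') vs"
    by (rule Cons.IH; (rule val_ins)?; use Cons.prems in simp)
  then show "Lie u (\<eta> + \<eta>') (v # vs) = Lie u \<eta> (v # vs) + Lie u \<eta>' (v # vs)" by simp
qed (simp add: L_add val_def)

lemma D_add:
  "val \<eta> \<Longrightarrow> val \<eta>' \<Longrightarrow> set vs \<subseteq> S \<Longrightarrow> D (\<eta> + \<eta>') vs = D \<eta> vs + D \<eta>' vs"
proof (induction vs arbitrary: \<eta> \<eta>')
  case (Cons v vs)
  have "D (ins v \<eta> + ins v \<eta>') vs = D (ins v \<eta>) vs + D (ins v \<eta>') vs"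
    by (rule Cons.IH; (rule val_ins)?; use Cons.prems in simp)
  then show "D (\<eta> + \<eta>') (v # vs) = D \<eta> (v # vs) + D \<eta>' (v # vs)"
    using Cons.prems by (simp add: Lie_add)
qed simp

lemma Lie_zero: "u \<in> S \<Longrightarrow> Lie u 0 vs = 0"
  by (induction vs) auto

lemma D_zero: "set vs \<subseteq> S \<Longrightarrow> D 0 vs = 0"
  by (induction vs) (auto simp: Lie_zero)

lemma Lie_minus: "val \<eta> \<Longrightarrow> u \<in> S \<Longrightarrow> set vs \<subseteq> S \<Longrightarrow> Lie u (- \<eta>) vs = - Lie u \<eta> vs"
  using Lie_add[of \<eta> "- \<eta>" u vs] by (simp add: Lie_zero val_arith eq_neg_iff_add_eq_0 add.commute)

lemma D_minus: "val \<eta> \<Longrightarrow> set vs \<subseteq> S \<Longrightarrow> D (- \<eta>) vs = - D \<eta> vs"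
  using D_add[of \<eta> "- \<eta>" vs] by (simp add: D_zero val_arith eq_neg_iff_add_eq_0 add.commute)

lemma Lie_diff:
  "val \<eta> \<Longrightarrow> val \<eta>' \<Longrightarrow> u \<in> S \<Longrightarrow> set vs \<subseteq> S \<Longrightarrow> Lie u (\<eta> - \<eta>') vs = Lie u \<eta> vs - Lie u \<eta>' vs"
  using Lie_add[of \<eta> "- \<eta>'" u vs] by (simp add: val_arith Lie_minus)

lemma D_diff:
  "val \<eta> \<Longrightarrow> val \<eta>' \<Longrightarrow> set vs \<subseteq> S \<Longrightarrow> D (\<eta> - \<eta>') vs = D \<eta> vs - D \<eta>' vs"
  using D_add[of \<eta> "- \<eta>'" vs] by (simp add: val_arith D_minus)

lemma ins_Lie: "ins v (Lie u \<eta>) = Lie u (ins v \<eta>) - ins (br u v) \<eta>"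
  by (auto simp: fun_eq_iff)

lemma ins_D: "ins u (D \<eta>) = Lie u \<eta> - D (ins u \<eta>)"
  by (auto simp: fun_eq_iff)

lemma Lie_bar: "val \<eta> \<Longrightarrow> u \<in> S \<Longrightarrow> set vs \<subseteq> S \<Longrightarrow> Lie u (bar \<eta>) vs = bar (Lie u \<eta>) vs"
proof (induction vs arbitrary: \<eta>)
  case (Cons v vs)
  have IH: "Lie u (bar \<eta>) vs = bar (Lie u \<eta>) vs" if "val \<eta>" for \<eta>
    by (rule Cons.IH) (use that Cons.prems in auto)
  have "Lie u (bar \<eta>) (v # vs) = - bar (Lie u (ins v \<eta>)) vs - bar \<eta> (br u v # vs)"
    using Cons.prems by (simp add: IH val_ins val_bar Lie_minus)
  then show "Lie u (bar \<eta>) (v # vs) = bar (Lie u \<eta>) (v # vs)" by (simp add: bar_def algebra_simps)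
qed (auto simp: bar_def)

text \<open>\<open>D\<close> raises the degree by one and so anticommutes with the parity
  involution, whereas \<open>Lie\<close> preserves the degree and commutes with it.\<close>

lemma D_bar: "val \<eta> \<Longrightarrow> set vs \<subseteq> S \<Longrightarrow> D (bar \<eta>) vs = - bar (D \<eta>) vs"
proof (induction vs arbitrary: \<eta>)
  case (Cons u vs)
  have IH: "D (bar \<eta>) vs = - bar (D \<eta>) vs" if "val \<eta>" for \<eta>
    by (rule Cons.IH) (use that Cons.prems in auto)
  have "D (bar \<eta>) (u # vs) = bar (Lie u \<eta>) vs - bar (D (ins u \<eta>)) vs"
    using Cons.prems by (simp add: val_ins val_bar D_minus Lie_bar IH)
  then show "D (bar \<eta>) (u # vs) = - bar (D \<eta>) (u # vs)" by (simp add: bar_def algebra_simps)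
qed (auto simp: bar_def)

text \<open>Contraction with v replaces L_u by L_u i_v - i_[u,v]. The induction hypothesis settles
  the first term, and the second distributes over the product because every contraction is an
  antiderivation.\<close>

lemma Lie_shuffle:
  "val \<omega> \<Longrightarrow> val \<eta> \<Longrightarrow> u \<in> S \<Longrightarrow> set vs \<subseteq> S \<Longrightarrow>
    Lie u (shuffle \<omega> \<eta>) vs = shuffle (Lie u \<omega>) \<eta> vs + shuffle \<omega> (Lie u \<eta>) vs"
proof (induction vs arbitrary: \<omega> \<eta>)
  case (Cons v vs)
  note v = val_ins val_bar val_shuffle
  have IH: "Lie u (shuffle \<omega> \<eta>) vs = shuffle (Lie u \<omega>) \<eta> vs + shuffle \<omega> (Lie u \<eta>) vs"
    if "val \<omega>" "val \<eta>" for \<omega> \<eta>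
    by (rule Cons.IH) (use that Cons.prems in auto)
  have *: "shuffle (Lie u (bar \<omega>)) (ins v \<eta>) vs = shuffle (bar (Lie u \<omega>)) (ins v \<eta>) vs"
    by (rule shuffle_cong) (use Cons.prems Lie_bar in auto)
  have "Lie u (shuffle \<omega> \<eta>) (v # vs) =
      Lie u (shuffle (ins v \<omega>) \<eta>) vs + Lie u (shuffle (bar \<omega>) (ins v \<eta>)) vs
      - (shuffle (ins (br u v) \<omega>) \<eta> vs + shuffle (bar \<omega>) (ins (br u v) \<eta>) vs)"
    using Cons.prems by (simp add: ins_shuffle Lie_add v br_S)
  then show "Lie u (shuffle \<omega> \<eta>) (v # vs) = shuffle (Lie u \<omega>) \<eta> (v # vs) + shuffle \<omega> (Lie u \<eta>) (v # vs)"
    using Cons.prems * by (simp add: IH v ins_Lie shuffle_bilinear)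
qed (auto simp: L_mult val_def algebra_simps)

text \<open>After contraction with u, Cartan's formula leaves L_u of the product, treated by
  \<open>Lie_shuffle\<close>, and \<open>D\<close> of the two contracted products, treated by
  induction. The mixed terms agree because \<open>D\<close> and \<open>bar\<close>
  anticommute.\<close>

theorem D_shuffle:
  "val \<omega> \<Longrightarrow> val \<eta> \<Longrightarrow> set vs \<subseteq> S \<Longrightarrow>
    D (shuffle \<omega> \<eta>) vs = shuffle (D \<omega>) \<eta> vs + shuffle (bar \<omega>) (D \<eta>) vs"
proof (induction vs arbitrary: \<omega> \<eta>)
  case (Cons u vs)
  note v = val_ins val_bar val_shuffle
  have IH: "D (shuffle \<omega> \<eta>) vs = shuffle (D \<omega>) \<eta> vs + shuffle (bar \<omega>) (D \<eta>) vs"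
    if "val \<omega>" "val \<eta>" for \<omega> \<eta>
    by (rule Cons.IH) (use that Cons.prems in auto)
  have *: "shuffle (D (bar \<omega>)) (ins u \<eta>) vs = - shuffle (bar (D \<omega>)) (ins u \<eta>) vs"
    using Cons.prems D_bar by (subst shuffle_cong[where \<omega>'="- bar (D \<omega>)" and \<eta>'="ins u \<eta>"]) auto
  have "shuffle (Lie u (bar \<omega>)) \<zeta> vs = shuffle (bar (Lie u \<omega>)) \<zeta> vs" for \<zeta>
    by (rule shuffle_cong) (use Cons.prems Lie_bar in auto)
  then show "D (shuffle \<omega> \<eta>) (u # vs) = shuffle (D \<omega>) \<eta> (u # vs) + shuffle (bar \<omega>) (D \<eta>) (u # vs)"
    using Cons.prems * by (simp add: ins_shuffle Lie_shuffle D_add v ins_D shuffle_bilinear IH)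
qed simp

lemma mlin_add_first:
  assumes "mlin \<eta>" "u \<in> S" "v \<in> S" "set vs \<subseteq> S"
  shows "\<eta> ((\<lambda>x. u x + v x) # vs) = \<eta> (u # vs) + \<eta> (v # vs)"
  using assms(1)[unfolded mlin_def, rule_format, of 1 1 "[]" vs u v] assms by simp

lemma mlin_minus_first:
  assumes "mlin \<eta>" "u \<in> S" "set vs \<subseteq> S"
  shows "\<eta> ((\<lambda>x. - u x) # vs) = - \<eta> (u # vs)"
  using assms(1)[unfolded mlin_def, rule_format, of "- 1" 0 "[]" vs u u] assms by (simp add: C_minus)

text \<open>On functions this is the compatibility of anchor and bracket. Each further argument w
  contributes the Jacobi identity in the first slot, which is why additivity there is
  assumed.\<close>

lemma Lie_commute:
  "val \<eta> \<Longrightarrow> mlin \<eta> \<Longrightarrow> u \<in> S \<Longrightarrow> v \<in> S \<Longrightarrow> set vs \<subseteq> S \<Longrightarrow>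
    Lie (br u v) \<eta> vs = Lie u (Lie v \<eta>) vs - Lie v (Lie u \<eta>) vs"
proof (induction vs arbitrary: \<eta>)
  case (Cons w vs)
  note v = val_ins val_Lie br_S
  have IH: "Lie (br u v) \<eta> vs = Lie u (Lie v \<eta>) vs - Lie v (Lie u \<eta>) vs" if "val \<eta>" "mlin \<eta>" for \<eta>
    by (rule Cons.IH) (use that Cons.prems in auto)
  have "\<eta> (br u (br v w) # vs) = \<eta> (br (br u v) w # vs) + \<eta> (br v (br u w) # vs)"
    using Cons.prems mlin_add_first[of \<eta> "br (br u v) w" "br v (br u w)" vs]
    by (simp add: br_jacobi[of u v w] br_S)
  then show "Lie (br u v) \<eta> (w # vs) = Lie u (Lie v \<eta>) (w # vs) - Lie v (Lie u \<eta>) (w # vs)"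
    using Cons.prems by (simp add: ins_Lie Lie_diff v IH mlin_ins algebra_simps)
qed (simp add: val_def L_br)

text \<open>Contract with v: both sides reduce by Cartan's formula, and the terms that remain are
  those of \<open>Lie_commute\<close> for v and u.\<close>

lemma D_Lie:
  "val \<eta> \<Longrightarrow> mlin \<eta> \<Longrightarrow> u \<in> S \<Longrightarrow> set vs \<subseteq> S \<Longrightarrow> D (Lie u \<eta>) vs = Lie u (D \<eta>) vs"
proof (induction vs arbitrary: \<eta>)
  case (Cons v vs)
  note v = val_ins val_Lie br_S val_D
  have IH: "D (Lie u \<eta>) vs = Lie u (D \<eta>) vs" if "val \<eta>" "mlin \<eta>" for \<eta>
    by (rule Cons.IH) (use that Cons.prems in auto)
  have "D (Lie u \<eta>) (v # vs) = Lie v (Lie u \<eta>) vs - Lie u (D (ins v \<eta>)) vs + D (ins (br u v) \<eta>) vs"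
    using Cons.prems by (simp add: ins_Lie D_diff v IH mlin_ins)
  moreover have "Lie u (D \<eta>) (v # vs) = Lie u (Lie v \<eta>) vs - Lie u (D (ins v \<eta>)) vs
      - (Lie (br u v) \<eta> vs - D (ins (br u v) \<eta>) vs)"
    using Cons.prems by (simp add: ins_D Lie_diff v)
  ultimately show "D (Lie u \<eta>) (v # vs) = Lie u (D \<eta>) (v # vs)"
    using Cons.prems Lie_commute[of \<eta> u v vs] by (simp add: algebra_simps)
qed simp

text \<open>By Cartan's formula i_u D D = L_u D - D L_u + D D i_u. The first two terms cancel by
  \<open>D_Lie\<close>, and the last vanishes by induction.\<close>

theorem D_D: "val \<eta> \<Longrightarrow> mlin \<eta> \<Longrightarrow> set vs \<subseteq> S \<Longrightarrow> D (D \<eta>) vs = 0"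
proof (induction vs arbitrary: \<eta>)
  case (Cons u vs)
  have IH: "D (D \<eta>) vs = 0" if "val \<eta>" "mlin \<eta>" for \<eta>
    by (rule Cons.IH) (use that Cons.prems in auto)
  show "D (D \<eta>) (u # vs) = 0"
    using Cons.prems by (simp add: ins_D D_diff val_ins val_Lie val_D D_Lie mlin_ins IH)
qed simp

end

section \<open>Linearity over the functions, alternation, and the explicit formula for
  \<open>D\<close>\<close>

lemma map_omit_Suc:
  "map (omit (Suc i) v) [0..<Suc n] = v 0 # map (omit i (v \<circ> Suc)) [0..<n]"
  by (auto simp: map_upt_Suc omit_def simp del: upt_Suc)

lemma omit_Suc_comp: "omit (Suc i) v \<circ> Suc = omit i (v \<circ> Suc)" "omit 0 v = v \<circ> Suc"
  "omit (Suc i) v 0 = v 0"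
  by (auto simp: omit_def fun_eq_iff)

lemma bar_scale: "bar (\<lambda>vs. f * \<omega> vs) = (\<lambda>vs. f * bar \<omega> vs)"
  by (auto simp: bar_def fun_eq_iff mult.left_commute)

lemma ins_scale: "ins u (\<lambda>vs. f * \<omega> vs) = (\<lambda>vs. f * ins u \<omega> vs)"
  by (simp add: ins_def)

lemma shuffle_scale_left: "shuffle (\<lambda>vs. f * \<omega> vs) \<eta> vs = f * shuffle \<omega> \<eta> vs"
proof (induction vs arbitrary: \<omega> \<eta>)
  case (Cons u vs)
  have IH: "shuffle (\<lambda>vs. f * \<omega> vs) \<eta> vs = f * shuffle \<omega> \<eta> vs" for \<omega> \<eta> by (rule Cons.IH)
  show "shuffle (\<lambda>vs. f * \<omega> vs) \<eta> (u # vs) = f * shuffle \<omega> \<eta> (u # vs)"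
    unfolding shuffle.simps bar_scale ins_scale IH by (simp add: distrib_left ins_def)
qed (simp add: mult.assoc)

lemma shuffle_scale_right: "shuffle \<omega> (\<lambda>vs. f * \<eta> vs) vs = f * shuffle \<omega> \<eta> vs"
proof (induction vs arbitrary: \<omega> \<eta>)
  case (Cons u vs)
  have IH: "shuffle \<omega> (\<lambda>vs. f * \<eta> vs) vs = f * shuffle \<omega> \<eta> vs" for \<omega> \<eta> by (rule Cons.IH)
  show "shuffle \<omega> (\<lambda>vs. f * \<eta> vs) (u # vs) = f * shuffle \<omega> \<eta> (u # vs)"
    unfolding shuffle.simps bar_scale ins_scale IH by (simp add: distrib_left ins_def)
qed (simp add: mult.left_commute)

context lie_rinehart
begin

lemma mlinD:
  assumes "mlin \<eta>" "f \<in> C" "g \<in> C" "u \<in> S" "v \<in> S" "set xs \<subseteq> S" "set ys \<subseteq> S"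
  shows "\<eta> (xs @ (\<lambda>x. f x *\<^sub>R u x + g x *\<^sub>R v x) # ys) = f * \<eta> (xs @ u # ys) + g * \<eta> (xs @ v # ys)"
  using assms unfolding mlin_def by blast

lemma mlinD_first:
  assumes "mlin \<eta>" "f \<in> C" "g \<in> C" "u \<in> S" "v \<in> S" "set ys \<subseteq> S"
  shows "\<eta> ((\<lambda>x. f x *\<^sub>R u x + g x *\<^sub>R v x) # ys) = f * \<eta> (u # ys) + g * \<eta> (v # ys)"
  using mlinD[OF assms(1-5), of "[]" ys] assms(6) by simp

lemma asymD:
  assumes "asym \<eta>" "u \<in> S" "v \<in> S" "set xs \<subseteq> S" "set ys \<subseteq> S"
  shows "\<eta> (xs @ u # v # ys) = - \<eta> (xs @ v # u # ys)"
  using assms unfolding asym_def by blast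

lemma asymD_first:
  assumes "asym \<eta>" "u \<in> S" "v \<in> S" "set ys \<subseteq> S"
  shows "\<eta> (u # v # ys) = - \<eta> (v # u # ys)"
  using asymD[OF assms(1-3), of "[]" ys] assms(4) by simp

lemma asym_ins_swap:
  assumes "asym \<eta>" "u \<in> S" "v \<in> S" "set us \<subseteq> S"
  shows "ins u (ins v \<eta>) us = (- ins v (ins u \<eta>)) us"
  using asymD_first[OF assms(1,3,2,4)] by (simp add: fun_eq_iff)

lemma val_scale: "val \<eta> \<Longrightarrow> f \<in> C \<Longrightarrow> val (\<lambda>vs. f * \<eta> vs)"
  by (simp add: val_def C_mult)

lemma Lie_scale:
  "val \<eta> \<Longrightarrow> f \<in> C \<Longrightarrow> u \<in> S \<Longrightarrow> set vs \<subseteq> S \<Longrightarrow>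
    Lie u (\<lambda>vs. f * \<eta> vs) vs = f * Lie u \<eta> vs + L u f * \<eta> vs"
proof (induction vs arbitrary: \<eta>)
  case (Cons v vs)
  have "Lie u (\<lambda>vs. f * ins v \<eta> vs) vs = f * Lie u (ins v \<eta>) vs + L u f * ins v \<eta> vs"
    by (rule Cons.IH; (rule val_ins)?; use Cons.prems in simp)
  then show "Lie u (\<lambda>vs. f * \<eta> vs) (v # vs) = f * Lie u \<eta> (v # vs) + L u f * \<eta> (v # vs)"
    by (simp add: ins_scale algebra_simps del: ins_apply) (simp add: ins_def)
qed (simp add: val_def L_mult mult.commute)

text \<open>In the slot that is met first, the term (L_u f) \<eta>(a, ...) arises twice with
  opposite signs: from differentiating the coefficient f and from the Leibniz rule for
  [u, f a].\<close>

lemma mlin_Lie: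
  assumes "val \<eta>" "mlin \<eta>" "u \<in> S"
  shows "mlin (Lie u \<eta>)"
  unfolding mlin_def
proof (intro allI ballI impI)
  fix xs ys a b f g
  assume fg: "f \<in> C" "g \<in> C" and "set xs \<subseteq> S \<and> set ys \<subseteq> S \<and> a \<in> S \<and> b \<in> S"
  then have *: "set xs \<subseteq> S" "set ys \<subseteq> S" "a \<in> S" "b \<in> S" by auto
  let ?c = "\<lambda>x. f x *\<^sub>R a x + g x *\<^sub>R b x"
  show "Lie u \<eta> (xs @ ?c # ys) = f * Lie u \<eta> (xs @ a # ys) + g * Lie u \<eta> (xs @ b # ys)"
    using *(1) assms(1,2)
  proof (induction xs arbitrary: \<eta>)
    case Nil
    have m: "mlin \<eta>" by (rule Nil(3))
    have "Lie u (ins ?c \<eta>) ys = Lie u ((\<lambda>vs. f * ins a \<eta> vs) + (\<lambda>vs. g * ins b \<eta> vs)) ys"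
      by (rule Lie_cong) (use mlinD_first[OF m] fg * assms(3) in auto)
    also have "\<dots> = f * Lie u (ins a \<eta>) ys + L u f * \<eta> (a # ys) + (g * Lie u (ins b \<eta>) ys + L u g * \<eta> (b # ys))"
      using Nil * fg assms(3) by (simp add: Lie_add val_scale val_ins Lie_scale del: ins_apply) simp
    finally have 1: "Lie u (ins ?c \<eta>) ys = \<dots>" .
    have S: "(\<lambda>x. f x *\<^sub>R br u a x + L u f x *\<^sub>R a x) \<in> S" "(\<lambda>x. g x *\<^sub>R br u b x + L u g x *\<^sub>R b x) \<in> S"
      using * fg assms(3) by (auto intro!: S_lin br_S L_C)
    have "\<eta> (br u ?c # ys) = f * \<eta> (br u a # ys) + L u f * \<eta> (a # ys)
        + (g * \<eta> (br u b # ys) + L u g * \<eta> (b # ys))"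
      unfolding br_lin[OF fg *(3,4) assms(3)] mlin_add_first[OF m S *(2)]
      using * fg assms(3) m by (simp add: fun_eq_iff mlinD_first br_S L_C)
    then show "Lie u \<eta> ([] @ ?c # ys) = f * Lie u \<eta> ([] @ a # ys) + g * Lie u \<eta> ([] @ b # ys)"
      using 1 by (simp add: algebra_simps)
  next
    case (Cons w xs)
    have m: "mlin \<eta>" by (rule Cons.prems(3))
    have "\<eta> (br u w # xs @ ?c # ys) = f * \<eta> (br u w # xs @ a # ys) + g * \<eta> (br u w # xs @ b # ys)"
      using mlinD[OF m fg *(3,4), of "br u w # xs" ys] Cons.prems * assms(3) by (simp add: br_S)
    moreover have "Lie u (ins w \<eta>) (xs @ ?c # ys) = f * Lie u (ins w \<eta>) (xs @ a # ys) + g * Lie u (ins w \<eta>) (xs @ b # ys)"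
      by (rule Cons.IH; (rule val_ins mlin_ins)?; use Cons.prems in simp)
    ultimately show "Lie u \<eta> ((w # xs) @ ?c # ys) = f * Lie u \<eta> ((w # xs) @ a # ys) + g * Lie u \<eta> ((w # xs) @ b # ys)"
      by (simp add: algebra_simps)
  qed
qed

lemma asym_Lie:
  assumes "val \<eta>" "asym \<eta>" "u \<in> S"
  shows "asym (Lie u \<eta>)"
  unfolding asym_def
proof (intro allI impI)
  fix xs ys v w
  assume "set xs \<subseteq> S \<and> set ys \<subseteq> S \<and> v \<in> S \<and> w \<in> S"
  then have *: "set xs \<subseteq> S" "set ys \<subseteq> S" "v \<in> S" "w \<in> S" by auto
  show "Lie u \<eta> (xs @ v # w # ys) = - Lie u \<eta> (xs @ w # v # ys)"
    using *(1) assms(1,2)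
  proof (induction xs arbitrary: \<eta>)
    case Nil
    have m: "asym \<eta>" by (rule Nil(3))
    have "Lie u (ins w (ins v \<eta>)) ys = Lie u (- ins v (ins w \<eta>)) ys"
      by (rule Lie_cong[OF asym_ins_swap]) (use m * assms(3) in auto)
    then have "Lie u (ins w (ins v \<eta>)) ys = - Lie u (ins v (ins w \<eta>)) ys"
      using Nil * assms(3) by (simp add: Lie_minus val_ins)
    then show "Lie u \<eta> ([] @ v # w # ys) = - Lie u \<eta> ([] @ w # v # ys)"
      using asymD_first[OF m, of v "br u w" ys] asymD_first[OF m, of w "br u v" ys] * assms(3)
      by (simp add: br_S)
  next
    case (Cons z xs)
    have m: "asym \<eta>" by (rule Cons.prems(3))
    have "\<eta> (br u z # xs @ v # w # ys) = - \<eta> (br u z # xs @ w # v # ys)"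
      using asymD[OF m *(3,4), of "br u z # xs" ys] Cons.prems * assms(3) by (simp add: br_S)
    moreover have "Lie u (ins z \<eta>) (xs @ v # w # ys) = - Lie u (ins z \<eta>) (xs @ w # v # ys)"
      by (rule Cons.IH; (rule val_ins asym_ins)?; use Cons.prems in simp)
    ultimately show "Lie u \<eta> ((z # xs) @ v # w # ys) = - Lie u \<eta> ((z # xs) @ w # v # ys)" by simp
  qed
qed

text \<open>If the two arguments come first, the expansion has two Lie derivatives that change
  places, a term \<open>D\<close> of a double contraction that changes sign by alternation, and a
  bracket term that changes sign because the bracket is antisymmetric.\<close>

lemma asym_D:
  assumes "val \<eta>" "mlin \<eta>" "asym \<eta>"
  shows "asym (D \<eta>)"
  unfolding asym_def
proof (intro allI impI)
  fix xs ys v w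
  assume "set xs \<subseteq> S \<and> set ys \<subseteq> S \<and> v \<in> S \<and> w \<in> S"
  then have *: "set xs \<subseteq> S" "set ys \<subseteq> S" "v \<in> S" "w \<in> S" by auto
  show "D \<eta> (xs @ v # w # ys) = - D \<eta> (xs @ w # v # ys)"
    using *(1) assms
  proof (induction xs arbitrary: \<eta>)
    case Nil
    have m: "asym \<eta>" by (rule Nil(4))
    have "D (ins w (ins v \<eta>)) ys = D (- ins v (ins w \<eta>)) ys"
      by (rule D_cong[OF asym_ins_swap]) (use m * in auto)
    then have "D (ins w (ins v \<eta>)) ys = - D (ins v (ins w \<eta>)) ys"
      using Nil * by (simp add: D_minus val_ins)
    moreover have "\<eta> (br w v # ys) = - \<eta> (br v w # ys)"
      using mlin_minus_first[of \<eta> "br v w" ys] br_antisym[of v w] * Nil by (simp add: br_S)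
    ultimately show "D \<eta> ([] @ v # w # ys) = - D \<eta> ([] @ w # v # ys)" by (simp add: ins_Lie)
  next
    case (Cons z xs)
    have "D (ins z \<eta>) (xs @ v # w # ys) = - D (ins z \<eta>) (xs @ w # v # ys)"
      by (rule Cons.IH; (rule val_ins asym_ins mlin_ins)?; use Cons.prems in simp)
    moreover have "Lie z \<eta> (xs @ v # w # ys) = - Lie z \<eta> (xs @ w # v # ys)"
      by (rule asymD[OF asym_Lie]) (use Cons.prems * in auto)
    ultimately show "D \<eta> ((z # xs) @ v # w # ys) = - D \<eta> ((z # xs) @ w # v # ys)" by simp
  qed
qed

lemma asym_move:
  "asym \<eta> \<Longrightarrow> set xs \<subseteq> S \<Longrightarrow> set zs \<subseteq> S \<Longrightarrow> set ys \<subseteq> S \<Longrightarrow> u \<in> S \<Longrightarrow>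
    \<eta> (xs @ u # zs @ ys) = (- 1) ^ length zs * \<eta> (xs @ zs @ u # ys)"
proof (induction zs arbitrary: xs)
  case (Cons z zs)
  have "\<eta> (xs @ u # z # zs @ ys) = - \<eta> ((xs @ [z]) @ u # zs @ ys)"
    using asymD[of \<eta> u z xs "zs @ ys"] Cons.prems by simp
  then show ?case using Cons.IH[of "xs @ [z]"] Cons.prems by simp
qed simp

text \<open>Linearity is proved in the last slot only: there the recursion ends in the derivative of
  a function along the anchor, which is linear over the functions, and everything before it is
  \<open>mlin_Lie\<close>. Alternation carries any other slot to the end, with the same sign in all
  terms.\<close>

lemma mlin_D:
  assumes "val \<eta>" "mlin \<eta>" "asym \<eta>"
  shows "mlin (D \<eta>)"
  unfolding mlin_def
proof (intro allI ballI impI)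
  fix xs ys a b f g
  assume fg: "f \<in> C" "g \<in> C" and "set xs \<subseteq> S \<and> set ys \<subseteq> S \<and> a \<in> S \<and> b \<in> S"
  then have *: "set xs \<subseteq> S" "set ys \<subseteq> S" "a \<in> S" "b \<in> S" by auto
  let ?c = "\<lambda>x. f x *\<^sub>R a x + g x *\<^sub>R b x"
  have last: "D \<eta> (xs @ [?c]) = f * D \<eta> (xs @ [a]) + g * D \<eta> (xs @ [b])"
    if "set xs \<subseteq> S" for xs
    using that assms
  proof (induction xs arbitrary: \<eta>)
    case Nil
    then show "D \<eta> ([] @ [?c]) = f * D \<eta> ([] @ [a]) + g * D \<eta> ([] @ [b])"
      using * fg by (simp add: L_lin val_def)
  next
    case (Cons w xs)
    have "D (ins w \<eta>) (xs @ [?c]) = f * D (ins w \<eta>) (xs @ [a]) + g * D (ins w \<eta>) (xs @ [b])"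
      by (rule Cons.IH; (rule val_ins asym_ins mlin_ins)?; use Cons.prems in simp)
    moreover have "Lie w \<eta> (xs @ [?c]) = f * Lie w \<eta> (xs @ [a]) + g * Lie w \<eta> (xs @ [b])"
      using mlinD[OF mlin_Lie[of \<eta> w] fg *(3,4), of xs "[]"] Cons.prems by simp
    ultimately show "D \<eta> ((w # xs) @ [?c]) = f * D \<eta> ((w # xs) @ [a]) + g * D \<eta> ((w # xs) @ [b])"
      by (simp add: algebra_simps)
  qed
  have move: "D \<eta> (xs @ u # ys) = (- 1) ^ length ys * D \<eta> ((xs @ ys) @ [u])" if "u \<in> S" for u
    using asym_move[OF asym_D[OF assms], of xs ys "[]" u] * that by simp
  have "?c \<in> S" using * fg by (auto intro: S_lin)
  then show "D \<eta> (xs @ ?c # ys) = f * D \<eta> (xs @ a # ys) + g * D \<eta> (xs @ b # ys)"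
    using * last[of "xs @ ys"] by (simp add: move distrib_left mult.left_commute del: append_assoc)
qed

lemma mlin_bar: "mlin \<eta> \<Longrightarrow> mlin (bar \<eta>)"
  by (simp add: mlin_def bar_def distrib_left mult.left_commute)

lemma asym_bar:
  assumes "asym \<eta>"
  shows "asym (bar \<eta>)"
  unfolding asym_def
proof (intro allI impI)
  fix xs ys u v
  assume "set xs \<subseteq> S \<and> set ys \<subseteq> S \<and> u \<in> S \<and> v \<in> S"
  then have "\<eta> (xs @ u # v # ys) = - \<eta> (xs @ v # u # ys)" by (intro asymD[OF assms]) auto
  then show "bar \<eta> (xs @ u # v # ys) = - bar \<eta> (xs @ v # u # ys)" by (simp add: bar_def)
qed

lemma mlin_shuffle:
  assumes "mlin \<omega>" "mlin \<eta>"
  shows "mlin (shuffle \<omega> \<eta>)"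
  unfolding mlin_def
proof (intro allI ballI impI)
  fix xs ys a b f g
  assume fg: "f \<in> C" "g \<in> C" and "set xs \<subseteq> S \<and> set ys \<subseteq> S \<and> a \<in> S \<and> b \<in> S"
  then have *: "set xs \<subseteq> S" "set ys \<subseteq> S" "a \<in> S" "b \<in> S" by auto
  let ?c = "\<lambda>x. f x *\<^sub>R a x + g x *\<^sub>R b x"
  show "shuffle \<omega> \<eta> (xs @ ?c # ys) = f * shuffle \<omega> \<eta> (xs @ a # ys) + g * shuffle \<omega> \<eta> (xs @ b # ys)"
    using *(1) assms
  proof (induction xs arbitrary: \<omega> \<eta>)
    case Nil
    have 1: "ins ?c \<zeta> us = ((\<lambda>vs. f * ins a \<zeta> vs) + (\<lambda>vs. g * ins b \<zeta> vs)) us"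
      if "mlin \<zeta>" "set us \<subseteq> set ys" for \<zeta> us
      using mlinD_first[OF that(1)] fg * that(2) by auto
    have "shuffle (ins ?c \<omega>) \<eta> ys = shuffle ((\<lambda>vs. f * ins a \<omega> vs) + (\<lambda>vs. g * ins b \<omega> vs)) \<eta> ys"
      by (rule shuffle_cong) (use 1 Nil in auto)
    moreover have "shuffle (bar \<omega>) (ins ?c \<eta>) ys = shuffle (bar \<omega>) ((\<lambda>vs. f * ins a \<eta> vs) + (\<lambda>vs. g * ins b \<eta> vs)) ys"
      by (rule shuffle_cong) (use 1 Nil in auto)
    ultimately show "shuffle \<omega> \<eta> ([] @ ?c # ys) = f * shuffle \<omega> \<eta> ([] @ a # ys) + g * shuffle \<omega> \<eta> ([] @ b # ys)"
      by (simp add: shuffle_bilinear shuffle_scale_left shuffle_scale_right algebra_simps del: ins_apply)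
  next
    case (Cons w xs)
    have "shuffle (ins w \<omega>) \<eta> (xs @ ?c # ys) = f * shuffle (ins w \<omega>) \<eta> (xs @ a # ys) + g * shuffle (ins w \<omega>) \<eta> (xs @ b # ys)"
      by (rule Cons.IH; (rule mlin_ins)?; use Cons.prems in simp)
    moreover have "shuffle (bar \<omega>) (ins w \<eta>) (xs @ ?c # ys) = f * shuffle (bar \<omega>) (ins w \<eta>) (xs @ a # ys) + g * shuffle (bar \<omega>) (ins w \<eta>) (xs @ b # ys)"
      by (rule Cons.IH; (rule mlin_ins mlin_bar)?; use Cons.prems in simp)
    ultimately show "shuffle \<omega> \<eta> ((w # xs) @ ?c # ys) = f * shuffle \<omega> \<eta> ((w # xs) @ a # ys) + g * shuffle \<omega> \<eta> ((w # xs) @ b # ys)"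
      by (simp add: algebra_simps)
  qed
qed

lemma asym_shuffle:
  assumes "asym \<omega>" "asym \<eta>"
  shows "asym (shuffle \<omega> \<eta>)"
  unfolding asym_def
proof (intro allI impI)
  fix xs ys v w
  assume "set xs \<subseteq> S \<and> set ys \<subseteq> S \<and> v \<in> S \<and> w \<in> S"
  then have *: "set xs \<subseteq> S" "set ys \<subseteq> S" "v \<in> S" "w \<in> S" by auto
  show "shuffle \<omega> \<eta> (xs @ v # w # ys) = - shuffle \<omega> \<eta> (xs @ w # v # ys)"
    using *(1) assms
  proof (induction xs arbitrary: \<omega> \<eta>)
    case Nil
    have 1: "ins w (ins v \<zeta>) us = (- ins v (ins w \<zeta>)) us" if "asym \<zeta>" "set us \<subseteq> set ys" for \<zeta> us
      by (rule asym_ins_swap) (use * that in auto)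
    have "shuffle (ins w (ins v \<omega>)) \<eta> ys = shuffle (- ins v (ins w \<omega>)) \<eta> ys"
      by (rule shuffle_cong) (use 1 Nil in auto)
    moreover have "shuffle \<omega> (ins w (ins v \<eta>)) ys = shuffle \<omega> (- ins v (ins w \<eta>)) ys"
      by (rule shuffle_cong) (use 1 Nil in auto)
    ultimately show "shuffle \<omega> \<eta> ([] @ v # w # ys) = - shuffle \<omega> \<eta> ([] @ w # v # ys)" by simp
  next
    case (Cons z xs)
    have "shuffle (ins z \<omega>) \<eta> (xs @ v # w # ys) = - shuffle (ins z \<omega>) \<eta> (xs @ w # v # ys)"
      by (rule Cons.IH; (rule asym_ins)?; use Cons.prems in simp)
    moreover have "shuffle (bar \<omega>) (ins z \<eta>) (xs @ v # w # ys) = - shuffle (bar \<omega>) (ins z \<eta>) (xs @ w # v # ys)"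
      by (rule Cons.IH; (rule asym_ins asym_bar)?; use Cons.prems in simp)
    ultimately show "shuffle \<omega> \<eta> ((z # xs) @ v # w # ys) = - shuffle \<omega> \<eta> ((z # xs) @ w # v # ys)" by simp
  qed
qed

definition tensor :: "('m, 'a) cochain \<Rightarrow> bool" where
  "tensor \<eta> \<longleftrightarrow> val \<eta> \<and> mlin \<eta> \<and> asym \<eta>"

lemma tensor_D: "tensor \<eta> \<Longrightarrow> tensor (D \<eta>)"
  by (simp add: tensor_def val_D mlin_D asym_D)

lemma tensor_shuffle: "tensor \<omega> \<Longrightarrow> tensor \<eta> \<Longrightarrow> tensor (shuffle \<omega> \<eta>)"
  by (simp add: tensor_def val_shuffle mlin_shuffle asym_shuffle)

text \<open>The recursion leaves the bracket [u, w_j] in position j. Moving it to the front takes j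
  adjacent swaps, whence the sign (-1)^j.\<close>

lemma Lie_explicit:
  assumes "asym \<eta>" "u \<in> S" "\<And>i. i < k \<Longrightarrow> w i \<in> S"
  shows "Lie u \<eta> (map w [0..<k]) = L u (\<eta> (map w [0..<k]))
    - (\<Sum>j<k. (- 1) ^ j * \<eta> (br u (w j) # map (omit j w) [0..<k - 1]))"
  using assms
proof (induction k arbitrary: \<eta> w)
  case (Suc k)
  have m: "asym \<eta>" by (rule Suc.prems(1))
  have S: "w (Suc i) \<in> S" if "i < k" for i using Suc.prems that by simp
  have w0: "w 0 \<in> S" using Suc.prems by simp
  have *: "\<eta> (br u (w (Suc j)) # map (omit (Suc j) w) [0..<k]) =
      - \<eta> (w 0 # br u (w (Suc j)) # map (omit j (w \<circ> Suc)) [0..<k - 1])" if j: "j < k" for j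
  proof -
    obtain n where k: "k = Suc n" using j by (cases k) auto
    have "set (map (omit j (w \<circ> Suc)) [0..<n]) \<subseteq> S" using S k by (auto simp: omit_def)
    then show ?thesis
      using asymD_first[OF m, of "br u (w (Suc j))" "w 0"] S[OF j] w0 Suc.prems(2)
      by (simp add: k map_omit_Suc br_S del: upt_Suc)
  qed
  have l: "map w [0..<Suc k] = w 0 # map (w \<circ> Suc) [0..<k]"
    by (simp add: map_upt_Suc comp_def del: upt_Suc)
  have "Lie u (ins (w 0) \<eta>) (map (w \<circ> Suc) [0..<k]) = L u (ins (w 0) \<eta> (map (w \<circ> Suc) [0..<k]))
    - (\<Sum>j<k. (- 1) ^ j * ins (w 0) \<eta> (br u ((w \<circ> Suc) j) # map (omit j (w \<circ> Suc)) [0..<k - 1]))"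
    by (rule Suc.IH; (rule asym_ins)?; use Suc.prems S w0 in simp)
  then have "Lie u \<eta> (map w [0..<Suc k]) = L u (\<eta> (map w [0..<Suc k]))
     - (\<Sum>j<k. (- 1) ^ j * \<eta> (w 0 # br u (w (Suc j)) # map (omit j (w \<circ> Suc)) [0..<k - 1]))
     - \<eta> (br u (w 0) # map (w \<circ> Suc) [0..<k])"
    unfolding l by simp
  also have "(\<Sum>j<k. (- 1) ^ j * \<eta> (w 0 # br u (w (Suc j)) # map (omit j (w \<circ> Suc)) [0..<k - 1]))
      = (\<Sum>j<k. (- 1) ^ Suc j * \<eta> (br u (w (Suc j)) # map (omit (Suc j) w) [0..<k]))"
    by (rule sum.cong) (auto simp: *)
  finally have l: "Lie u \<eta> (map w [0..<Suc k]) = L u (\<eta> (map w [0..<Suc k]))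
      - (\<Sum>j<k. (- 1) ^ Suc j * \<eta> (br u (w (Suc j)) # map (omit (Suc j) w) [0..<k]))
      - \<eta> (br u (w 0) # map (w \<circ> Suc) [0..<k])" .
  have s: "(\<Sum>j<Suc k. (- 1) ^ j * \<eta> (br u (w j) # map (omit j w) [0..<Suc k - 1])) =
      (\<Sum>j<k. (- 1) ^ Suc j * \<eta> (br u (w (Suc j)) # map (omit (Suc j) w) [0..<k]))
      + \<eta> (br u (w 0) # map (w \<circ> Suc) [0..<k])"
    unfolding sum.lessThan_Suc_shift by (simp add: omit_Suc_comp)
  show "Lie u \<eta> (map w [0..<Suc k]) = L u (\<eta> (map w [0..<Suc k]))
    - (\<Sum>j<Suc k. (- 1) ^ j * \<eta> (br u (w j) # map (omit j w) [0..<Suc k - 1]))"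
    unfolding l s by (rule diff_diff_eq)
qed simp

text \<open>The link from the recursive \<open>D\<close> to the formula of the statement. The Lie
  derivative along v_0 supplies the first summand and all brackets that involve v_0; the induction
  hypothesis for the contracted cochain supplies the rest.\<close>

theorem D_explicit:
  assumes "asym \<eta>" "\<And>i. i \<le> k \<Longrightarrow> v i \<in> S"
  shows "D \<eta> (map v [0..<Suc k]) =
    (\<Sum>i\<le>k. (- 1) ^ i * L (v i) (\<eta> (map (omit i v) [0..<k]))) +
    (\<Sum>j\<le>k. \<Sum>i<j. (- 1) ^ (i + j) * \<eta> (br (v i) (v j) # map (omit i (omit j v)) [0..<k - 1]))"
  using assms
proof (induction k arbitrary: \<eta> v)
  case 0
  then show ?case by simp
next
  case (Suc m)
  have as: "asym \<eta>" by (rule Suc.prems(1))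
  let ?v = "v \<circ> Suc"
  have S: "?v i \<in> S" if "i \<le> m" for i using Suc.prems that by simp
  have v0: "v 0 \<in> S" using Suc.prems by simp
  \<comment> \<open>The induction hypothesis has v_0 in front of the bracket, while the formula
    wants the bracket first. The sign of this swap makes up for the minus in Cartan's
    formula.\<close>
  have *: "\<eta> (br (?v i) (?v j) # map (omit (Suc i) (omit (Suc j) v)) [0..<m]) =
      - \<eta> (v 0 # br (?v i) (?v j) # map (omit i (omit j ?v)) [0..<m - 1])" if ij: "j \<le> m" "i < j" for i j
  proof -
    obtain n where m: "m = Suc n" using ij by (cases m) auto
    have "set (map (omit i (omit j ?v)) [0..<n]) \<subseteq> S" using S m by (auto simp: omit_def)
    then show ?thesis
      using asymD_first[OF as, of "br (?v i) (?v j)" "v 0"] S[of i] S[of j] v0 ij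
      by (simp add: m map_omit_Suc omit_Suc_comp br_S del: upt_Suc)
  qed
  have l: "map v [0..<Suc (Suc m)] = v 0 # map ?v [0..<Suc m]"
    by (simp add: map_upt_Suc comp_def del: upt_Suc)
  have 1: "Lie (v 0) \<eta> (map ?v [0..<Suc m]) = L (v 0) (\<eta> (map ?v [0..<Suc m]))
    - (\<Sum>j\<le>m. (- 1) ^ j * \<eta> (br (v 0) (?v j) # map (omit j ?v) [0..<m]))"
    using Lie_explicit[of \<eta> "v 0" "Suc m" ?v] Suc.prems S v0
    by (simp add: lessThan_Suc_atMost del: upt_Suc sum.lessThan_Suc)
  have "D (ins (v 0) \<eta>) (map ?v [0..<Suc m]) =
    (\<Sum>i\<le>m. (- 1) ^ i * L (?v i) (ins (v 0) \<eta> (map (omit i ?v) [0..<m]))) +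
    (\<Sum>j\<le>m. \<Sum>i<j. (- 1) ^ (i + j) * ins (v 0) \<eta> (br (?v i) (?v j) # map (omit i (omit j ?v)) [0..<m - 1]))"
    by (rule Suc.IH; (rule asym_ins)?; use Suc.prems S v0 in simp)
  also have "(\<Sum>j\<le>m. \<Sum>i<j. (- 1) ^ (i + j) * ins (v 0) \<eta> (br (?v i) (?v j) # map (omit i (omit j ?v)) [0..<m - 1])) =
    (\<Sum>j\<le>m. \<Sum>i<j. - ((- 1) ^ (i + j) * \<eta> (br (?v i) (?v j) # map (omit (Suc i) (omit (Suc j) v)) [0..<m])))"
    by (intro sum.cong refl) (use * in auto)
  finally have 2: "D (ins (v 0) \<eta>) (map ?v [0..<Suc m]) =
    (\<Sum>i\<le>m. (- 1) ^ i * L (?v i) (\<eta> (v 0 # map (omit i ?v) [0..<m]))) +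
    (\<Sum>j\<le>m. \<Sum>i<j. - ((- 1) ^ (i + j) * \<eta> (br (?v i) (?v j) # map (omit (Suc i) (omit (Suc j) v)) [0..<m])))"
    unfolding ins_apply .
  have "(\<Sum>i\<le>Suc m. (- 1) ^ i * L (v i) (\<eta> (map (omit i v) [0..<Suc m]))) =
      L (v 0) (\<eta> (map ?v [0..<Suc m]))
      - (\<Sum>i\<le>m. (- 1) ^ i * L (?v i) (\<eta> (v 0 # map (omit i ?v) [0..<m])))"
    by (simp add: sum.atMost_Suc_shift map_omit_Suc omit_Suc_comp sum_negf del: upt_Suc sum.atMost_Suc)
  moreover have "(\<Sum>j\<le>Suc m. \<Sum>i<j. (- 1) ^ (i + j) * \<eta> (br (v i) (v j) # map (omit i (omit j v)) [0..<m])) =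
      - (\<Sum>j\<le>m. (- 1) ^ j * \<eta> (br (v 0) (?v j) # map (omit j ?v) [0..<m]))
      + (\<Sum>j\<le>m. \<Sum>i<j. ((- 1) ^ (i + j) * \<eta> (br (?v i) (?v j) # map (omit (Suc i) (omit (Suc j) v)) [0..<m])))"
    by (simp add: sum.atMost_Suc_shift sum.lessThan_Suc_shift omit_Suc_comp sum.distrib sum_subtractf
        sum_negf del: upt_Suc sum.lessThan_Suc sum.atMost_Suc)
  ultimately show "D \<eta> (map v [0..<Suc (Suc m)]) =
    (\<Sum>i\<le>Suc m. (- 1) ^ i * L (v i) (\<eta> (map (omit i v) [0..<Suc m]))) +
    (\<Sum>j\<le>Suc m. \<Sum>i<j. (- 1) ^ (i + j) * \<eta> (br (v i) (v j) # map (omit i (omit j v)) [0..<Suc m - 1]))"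
    unfolding l D.simps 1 2 by (simp add: sum_negf del: upt_Suc sum.lessThan_Suc sum.atMost_Suc)
qed

text \<open>The space F_p at x, where P selects the sections counted as lying in B. P is left
  abstract: for P constantly true and p = 1 the condition says that the cochain vanishes at x on all
  lists of sections, which is how degree 0 contractions are handled later.\<close>

definition filt :: "(('m \<Rightarrow> 'a) \<Rightarrow> bool) \<Rightarrow> 'm \<Rightarrow> nat \<Rightarrow> ('m, 'a) cochain \<Rightarrow> bool" where
  "filt P x p \<eta> \<longleftrightarrow> (\<forall>vs. set vs \<subseteq> S \<longrightarrow> length (filter (\<lambda>s. \<not> P s) vs) < p \<longrightarrow> \<eta> vs x = 0)"

lemma filt_ins:
  assumes "filt P x p \<eta>" "u \<in> S"
  shows "P u \<Longrightarrow> filt P x p (ins u \<eta>)" "filt P x (p - 1) (ins u \<eta>)"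
proof -
  show "filt P x p (ins u \<eta>)" if "P u" using assms that unfolding filt_def by auto
  have "length (filter (\<lambda>s. \<not> P s) (u # vs)) < p" if "length (filter (\<lambda>s. \<not> P s) vs) < p - 1" for vs
    using that by auto
  then show "filt P x (p - 1) (ins u \<eta>)" using assms unfolding filt_def ins_apply
    by (metis insert_subset list.simps(15))
qed

lemma filt_arith:
  "filt P x p \<omega> \<Longrightarrow> filt P x p \<eta> \<Longrightarrow> filt P x p (\<omega> + \<eta>)"
  "filt P x p \<omega> \<Longrightarrow> filt P x p \<eta> \<Longrightarrow> filt P x p (\<omega> - \<eta>)"
  "filt P x p \<omega> \<Longrightarrow> filt P x p (- \<omega>)" "filt P x p (bar \<omega>) = filt P x p \<omega>" "filt P x p 0" "filt P x 0 \<omega>"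
proof -
  have "((- 1 :: 'm \<Rightarrow> real) ^ n) x \<noteq> 0" for n by (induction n) auto
  then show "filt P x p (bar \<omega>) = filt P x p \<omega>" by (auto simp: filt_def bar_def)
qed (auto simp: filt_def)

text \<open>With fewer than p + r arguments outside B, every way of dealing them out gives the first
  factor fewer than p or the second fewer than r.\<close>

lemma filt_shuffle:
  assumes "filt P x p \<omega>" "filt P x r \<eta>"
  shows "filt P x (p + r) (shuffle \<omega> \<eta>)"
proof -
  have "shuffle \<omega> \<eta> vs x = 0"
    if "filt P x p \<omega>" "filt P x r \<eta>" "set vs \<subseteq> S" "length (filter (\<lambda>s. \<not> P s) vs) < p + r" for vs
    using that
  proof (induction vs arbitrary: p r \<omega> \<eta>)
    case Nil
    then have "p > 0 \<or> r > 0" by auto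
    then show "shuffle \<omega> \<eta> [] x = 0" using Nil by (auto simp: filt_def)
  next
    case (Cons u vs)
    have u: "u \<in> S" "set vs \<subseteq> S" using Cons.prems by auto
    \<comment> \<open>An argument outside B is spent on the factor that is contracted, so in each
      summand only that factor's order drops.\<close>
    define p' r' where "p' = (if P u then p else p - 1)" "r' = (if P u then r else r - 1)"
    have "length (filter (\<lambda>s. \<not> P s) vs) < p' + r" "length (filter (\<lambda>s. \<not> P s) vs) < p + r'"
      using Cons.prems(4) by (auto simp: p'_r'_def split: if_splits)
    moreover have "filt P x p' (ins u \<omega>)" "filt P x r' (ins u \<eta>)" "filt P x p (bar \<omega>)"
      using Cons.prems(1,2) u filt_ins by (auto simp: p'_r'_def filt_arith)
    ultimately have "shuffle (ins u \<omega>) \<eta> vs x = 0" "shuffle (bar \<omega>) (ins u \<eta>) vs x = 0"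
      using Cons.prems(1,2) u by (blast intro: Cons.IH)+
    then show "shuffle \<omega> \<eta> (u # vs) x = 0" by simp
  qed
  then show ?thesis using assms unfolding filt_def[of P x "p + r"] by blast
qed

end

section \<open>Alternating forms\<close>

lemma alt_formD:
  assumes "alt_form k V \<omega>"
  shows alt_form_linear: "\<lbrakk>\<And>j. j < k \<Longrightarrow> v j \<in> V; i < k; x \<in> V; y \<in> V\<rbrakk> \<Longrightarrow>
      \<omega> (v(i := a *\<^sub>R x + b *\<^sub>R y)) = a * \<omega> (v(i := x)) + b * \<omega> (v(i := y))"
    and alt_form_eq_zero: "\<lbrakk>\<And>j. j < k \<Longrightarrow> v j \<in> V; i < k; j < k; i \<noteq> j; v i = v j\<rbrakk> \<Longrightarrow> \<omega> v = 0"
    and alt_form_cong: "(\<And>j. j < k \<Longrightarrow> v j = w j) \<Longrightarrow> \<omega> v = \<omega> w"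
    and alt_form_outside: "j < k \<Longrightarrow> v j \<notin> V \<Longrightarrow> \<omega> v = 0"
  using assms unfolding alt_form_def by blast+

lemma alt_form_add:
  assumes "alt_form k V \<omega>" "\<And>j. j < k \<Longrightarrow> v j \<in> V" "i < k" "x \<in> V" "y \<in> V"
  shows "\<omega> (v(i := x + y)) = \<omega> (v(i := x)) + \<omega> (v(i := y))"
  using alt_form_linear[where v=v and a=1 and b=1, OF assms] by simp

lemma alt_form_swap:
  assumes "alt_form k V \<omega>" "subspace V" "\<And>j. j < k \<Longrightarrow> v j \<in> V" "i < k" "j < k" "i \<noteq> j"
  shows "\<omega> (v \<circ> Transposition.transpose i j) = - \<omega> v"
proof -
  let ?w = "\<lambda>x y. v(i := x, j := y)"
  have V: "v i + v j \<in> V" "v i \<in> V" "v j \<in> V" using assms by (auto intro: subspace_add)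
  have w: "?w x y l \<in> V" if "l < k" "x \<in> V" "y \<in> V" for l x y using that assms(3) by auto
  have l: "\<omega> (?w (x + x') y) = \<omega> (?w x y) + \<omega> (?w x' y)" if "x \<in> V" "x' \<in> V" "y \<in> V" for x x' y
    using alt_form_add[where v="?w x y", OF assms(1) w[OF _ that(1,3)] assms(4) that(1,2)] assms(6)
    by (simp add: fun_upd_twist)
  have r: "\<omega> (?w x (y + y')) = \<omega> (?w x y) + \<omega> (?w x y')" if "x \<in> V" "y \<in> V" "y' \<in> V" for x y y'
    using alt_form_add[where v="?w x y", OF assms(1) w[OF _ that(1,2)] assms(5) that(2,3)] assms(6) by simp
  have z: "\<omega> (?w x x) = 0" if "x \<in> V" for x
    using alt_form_eq_zero[where v="?w x x", OF assms(1) w[OF _ that that] assms(4,5,6)] assms(6) by simp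
  \<comment> \<open>Polarisation: the sum v i + v j is put into both slots.\<close>
  have "0 = \<omega> (?w (v i) (v j)) + \<omega> (?w (v j) (v i))"
  proof -
    have "\<omega> (?w (v i + v j) (v i + v j)) = \<omega> (?w (v i) (v i)) + \<omega> (?w (v i) (v j))
        + (\<omega> (?w (v j) (v i)) + \<omega> (?w (v j) (v j)))"
      using l[OF V(2,3,1)] r[OF V(2,2,3)] r[OF V(3,2,3)] by linarith
    then show ?thesis using z[OF V(1)] z[OF V(2)] z[OF V(3)] by linarith
  qed
  moreover have "?w (v i) (v j) = v" by simp
  moreover have "?w (v j) (v i) = v \<circ> Transposition.transpose i j"
    using assms(6) by (auto simp: fun_eq_iff Transposition.transpose_def)
  ultimately show ?thesis by simp
qed

lemma alt_form_permute:
  assumes "alt_form k V \<omega>" "subspace V" "\<And>j. j < k \<Longrightarrow> v j \<in> V" "p permutes {..<k}"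
  shows "\<omega> (v \<circ> p) = of_int (sign p) * \<omega> v"
proof (use finite_lessThan[of k] assms(4) in \<open>induction p rule: permutes_rev_induct\<close>)
  case (swap a b p)
  have "\<omega> (v \<circ> p \<circ> Transposition.transpose a b) = - \<omega> (v \<circ> p)"
  proof (rule alt_form_swap[OF assms(1,2)])
    fix j assume "j < k"
    then have "p j < k" using permutes_in_image[OF swap.hyps(4), of j] by simp
    then show "(v \<circ> p) j \<in> V" using assms(3) by simp
  qed (use swap.hyps in auto)
  moreover have "sign (p \<circ> Transposition.transpose a b) = - sign p"
    using swap.hyps permutes_imp_permutation[OF finite_lessThan swap.hyps(4)]
    by (subst sign_compose) (auto simp: sign_swap_id permutation_swap_id)
  ultimately show ?case using swap.IH by (simp only: comp_assoc of_int_minus mult_minus_left)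
qed simp

lemma alt_form_sum:
  assumes "alt_form k V \<omega>" "subspace V" "\<And>j. j < k \<Longrightarrow> v j \<in> V" "i < k" "finite A" "\<And>l. l \<in> A \<Longrightarrow> e l \<in> V"
  shows "\<omega> (v(i := \<Sum>l\<in>A. c l *\<^sub>R e l)) = (\<Sum>l\<in>A. c l * \<omega> (v(i := e l)))"
  using assms(5,6)
proof (induction A rule: finite_induct)
  case empty
  have "\<omega> (v(i := 0 *\<^sub>R 0 + 0 *\<^sub>R 0)) = 0 * \<omega> (v(i := 0)) + 0 * \<omega> (v(i := 0))"
    by (rule alt_form_linear[where v=v, OF assms(1,3,4)]) (use assms(2) subspace_0 in auto)
  then show ?case by (simp add: fun_upd_def)
next
  case (insert a A)
  have "(\<Sum>l\<in>A. c l *\<^sub>R e l) \<in> V" using insert by (intro subspace_sum[OF assms(2)] subspace_scale[OF assms(2)]) auto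
  then have "\<omega> (v(i := c a *\<^sub>R e a + 1 *\<^sub>R (\<Sum>l\<in>A. c l *\<^sub>R e l))) = c a * \<omega> (v(i := e a)) + 1 * \<omega> (v(i := \<Sum>l\<in>A. c l *\<^sub>R e l))"
    using insert by (intro alt_form_linear[where v=v, OF assms(1,3,4)]) auto
  then show ?case using insert by (simp add: fun_upd_def)
qed

lemma is_basisD:
  assumes "is_basis V r b"
  shows is_basis_subspace: "subspace V" and is_basis_in: "i < r \<Longrightarrow> b i \<in> V"
    and is_basis_expand: "v \<in> V \<Longrightarrow> \<exists>c. v = (\<Sum>i<r. c i *\<^sub>R b i)"
proof -
  have V: "V = span (b ` {..<r})" and inj: "inj_on b {..<r}" using assms by (auto simp: is_basis_def)
  show "subspace V" unfolding V by simp
  show "i < r \<Longrightarrow> b i \<in> V" unfolding V by (simp add: span_base)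
  assume "v \<in> V"
  then obtain c where "v = (\<Sum>x\<in>b ` {..<r}. c x *\<^sub>R x)"
    unfolding V using span_finite[of "b ` {..<r}"] by auto
  then have "v = (\<Sum>i<r. c (b i) *\<^sub>R b i)" using sum.reindex[OF inj] by simp
  then show "\<exists>c. v = (\<Sum>i<r. c i *\<^sub>R b i)" by (intro exI[of _ "\<lambda>i. c (b i)"])
qed

lemma alt_form_eq_zero_basis:
  assumes "alt_form k V \<omega>" "is_basis V r b" "\<And>I. (\<And>j. j < k \<Longrightarrow> I j < r) \<Longrightarrow> \<omega> (\<lambda>j. b (I j)) = 0"
  shows "\<omega> v = 0"
proof (cases "\<forall>j<k. v j \<in> V")
  case True
  note V = is_basis_subspace[OF assms(2)] is_basis_in[OF assms(2)]
  \<comment> \<open>Mixed tuples: from slot m on all entries are basis vectors already. Each step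
    expands one more arbitrary entry.\<close>
  have "\<omega> v = 0" if "m \<le> k" "\<And>j. j < k \<Longrightarrow> v j \<in> V" "\<And>j. m \<le> j \<Longrightarrow> j < k \<Longrightarrow> v j \<in> b ` {..<r}" for m v
    using that
  proof (induction m arbitrary: v)
    case 0
    then have "\<forall>j. \<exists>i. j < k \<longrightarrow> i < r \<and> v j = b i" by (meson imageE le0 lessThan_iff)
    then obtain I where I: "\<And>j. j < k \<Longrightarrow> I j < r \<and> v j = b (I j)" by metis
    then have "\<omega> v = \<omega> (\<lambda>j. b (I j))" by (intro alt_form_cong[OF assms(1)]) simp
    then show ?case using assms(3) I by simp
  next
    case (Suc m)
    have m: "m < k" using Suc.prems by simp
    obtain c where c: "v m = (\<Sum>i<r. c i *\<^sub>R b i)" using is_basis_expand[OF assms(2)] Suc.prems(2)[OF m] by blast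
    have "\<omega> (v(m := \<Sum>i<r. c i *\<^sub>R b i)) = (\<Sum>i<r. c i * \<omega> (v(m := b i)))"
      by (rule alt_form_sum[OF assms(1) V(1) Suc.prems(2) m]) (auto intro: V)
    also have "\<dots> = 0"
    proof (rule sum.neutral, intro ballI)
      fix i assume i: "i \<in> {..<r}"
      have "\<omega> (v(m := b i)) = 0"
        by (rule Suc.IH) (use Suc.prems i V(2) in auto)
      then show "c i * \<omega> (v(m := b i)) = 0" by simp
    qed
    finally show ?case unfolding c[symmetric] by simp
  qed
  from this[of k v] show ?thesis using True by auto
qed (use alt_form_outside[OF assms(1)] in blast)

text \<open>A tuple of distinct basis vectors has at most \<open>q\<close> entries outside the first \<open>r - q\<close> ones.\<close>

lemma alt_form_eq_zero_filtration:
  assumes "alt_form k V \<omega>" "is_basis V r b" "q \<le> r"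
    and "\<And>v. (\<And>j. j < k \<Longrightarrow> v j \<in> b ` {..<r}) \<Longrightarrow> card {j. j < k \<and> v j \<notin> b ` {..<r - q}} \<le> q \<Longrightarrow> \<omega> v = 0"
  shows "\<omega> v = 0"
proof (rule alt_form_eq_zero_basis[OF assms(1,2)])
  fix I assume I: "\<And>j. j < k \<Longrightarrow> I j < r"
  show "\<omega> (\<lambda>j. b (I j)) = 0"
  proof (cases "inj_on I {..<k}")
    case False
    then obtain i j where "i < k" "j < k" "i \<noteq> j" "I i = I j" by (auto simp: inj_on_def)
    then show ?thesis
      using I is_basis_in[OF assms(2)] by (intro alt_form_eq_zero[OF assms(1), of _ i j]) auto
  next
    case True
    let ?J = "{j. j < k \<and> b (I j) \<notin> b ` {..<r - q}}"
    have "I ` ?J \<subseteq> {r - q..<r}"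
    proof
      fix i assume "i \<in> I ` ?J"
      then obtain j where j: "j < k" "b (I j) \<notin> b ` {..<r - q}" "i = I j" by blast
      then have "\<not> I j < r - q" by blast
      then show "i \<in> {r - q..<r}" using j I by simp
    qed
    then have "card (I ` ?J) \<le> q" using card_mono[of "{r - q..<r}" "I ` ?J"] assms(3) by simp
    moreover have "card (I ` ?J) = card ?J" by (rule card_image) (use True in \<open>auto simp: inj_on_def\<close>)
    ultimately show ?thesis using I by (intro assms(4)) auto
  qed
qed

text \<open>One combination covers differences, multiples (with d = 0) and the cross products in
  \<open>alt_form_proportional\<close>.\<close>

lemma alt_form_diff_scale:
  assumes "alt_form k V \<omega>" "alt_form k V \<eta>"
  shows "alt_form k V (\<lambda>v. c * \<omega> v - d * \<eta> v)"
  unfolding alt_form_def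
proof (intro conjI allI impI ballI)
  fix v i a b x y assume v: "(\<forall>j<k. v j \<in> V) \<and> i < k" and xy: "x \<in> V" "y \<in> V"
  have "\<omega> (v(i := a *\<^sub>R x + b *\<^sub>R y)) = a * \<omega> (v(i := x)) + b * \<omega> (v(i := y))"
    "\<eta> (v(i := a *\<^sub>R x + b *\<^sub>R y)) = a * \<eta> (v(i := x)) + b * \<eta> (v(i := y))"
    using v xy by (auto intro: alt_form_linear[OF assms(1)] alt_form_linear[OF assms(2)])
  then show "c * \<omega> (v(i := a *\<^sub>R x + b *\<^sub>R y)) - d * \<eta> (v(i := a *\<^sub>R x + b *\<^sub>R y)) =
      a * (c * \<omega> (v(i := x)) - d * \<eta> (v(i := x))) + b * (c * \<omega> (v(i := y)) - d * \<eta> (v(i := y)))"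
    by (simp add: algebra_simps)
next
  fix v i j assume "(\<forall>j<k. v j \<in> V) \<and> i < k \<and> j < k \<and> i \<noteq> j \<and> v i = v j"
  then show "c * \<omega> v - d * \<eta> v = 0"
    using alt_form_eq_zero[OF assms(1), of v i j] alt_form_eq_zero[OF assms(2), of v i j] by simp
next
  fix v w :: "nat \<Rightarrow> 'a" assume "\<forall>j<k. v j = w j"
  then show "c * \<omega> v - d * \<eta> v = c * \<omega> w - d * \<eta> w"
    using alt_form_cong[OF assms(1), of v w] alt_form_cong[OF assms(2), of v w] by simp
next
  fix v assume "\<exists>j<k. v j \<notin> V"
  then show "c * \<omega> v - d * \<eta> v = 0"
    using alt_form_outside[OF assms(1)] alt_form_outside[OF assms(2)] by auto
qed

text \<open>A q-form that kills the first r - q basis vectors descends to a quotient of dimension q,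
  where it is a multiple of the determinant. The factor \<kappa> is a sign or 0 and is chosen before
  \<omega>, so that two such forms can be compared through it.\<close>

lemma alt_form_top_basis:
  assumes b: "is_basis V r b" "q \<le> r"
  shows "\<exists>\<kappa>. \<forall>\<omega> I. alt_form q V \<omega> \<longrightarrow>
      (\<forall>v. \<forall>i<q. (\<forall>j<q. v j \<in> V) \<longrightarrow> v i \<in> b ` {..<r - q} \<longrightarrow> \<omega> v = 0) \<longrightarrow>
      (\<forall>j<q. I j < r) \<longrightarrow> \<omega> (\<lambda>j. b (I j)) = \<kappa> I * \<omega> (\<lambda>j. b (r - q + j))"
proof -
  let ?e = "\<lambda>j. b (r - q + j)"
  \<comment> \<open>When all indices of I lie among the last q, subtracting r - q turns I into a
    permutation of q indices; beyond q it is the identity, as \<open>permutes\<close>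
    demands.\<close>
  define p where "p I j = (if j < q then I j - (r - q) else j)" for I j
  define \<kappa> :: "(nat \<Rightarrow> nat) \<Rightarrow> real"
    where "\<kappa> I = (if (\<forall>i<q. r - q \<le> I i) \<and> inj_on I {..<q} then of_int (sign (p I)) else 0)" for I
  have eV: "?e j \<in> V" if "j < q" for j using that b(2) is_basis_in[OF b(1)] by auto
  have "\<omega> (\<lambda>j. b (I j)) = \<kappa> I * \<omega> ?e"
    if \<omega>: "alt_form q V \<omega>"
      and van: "\<forall>v. \<forall>i<q. (\<forall>j<q. v j \<in> V) \<longrightarrow> v i \<in> b ` {..<r - q} \<longrightarrow> \<omega> v = 0"
      and I: "\<forall>j<q. I j < r" for \<omega> I
  proof -
    let ?v = "\<lambda>j. b (I j)"
    have V: "?v j \<in> V" if "j < q" for j using I that is_basis_in[OF b(1)] by simp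
    consider i where "i < q" "I i < r - q" | "\<not> inj_on I {..<q}" | "\<forall>i<q. r - q \<le> I i" "inj_on I {..<q}"
      using not_le by blast
    then show ?thesis
    proof cases
      case 1
      have "\<omega> ?v = 0" using van 1 V by auto
      then show ?thesis using 1 by (auto simp: \<kappa>_def)
    next
      case 2
      then obtain i j where "i < q" "j < q" "i \<noteq> j" "I i = I j" by (auto simp: inj_on_def)
      then have "\<omega> ?v = 0" using V by (intro alt_form_eq_zero[OF \<omega>, of ?v i j]) auto
      then show ?thesis using 2 by (simp add: \<kappa>_def)
    next
      case 3
      have lt: "p I j < q" if "j < q" for j using 3(1) I that b(2) by (auto simp: p_def less_diff_conv2)
      have "inj_on (p I) {..<q}"
      proof (rule inj_onI)
        fix i j assume ij: "i \<in> {..<q}" "j \<in> {..<q}" "p I i = p I j"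
        then have "r - q \<le> I i" "r - q \<le> I j" "I i - (r - q) = I j - (r - q)" using 3(1) by (auto simp: p_def)
        then have "I i = I j" by linarith
        then show "i = j" using 3(2) ij by (auto simp: inj_on_def)
      qed
      moreover have "p I ` {..<q} = {..<q}"
        by (rule endo_inj_surj) (use lt calculation in auto)
      ultimately have "bij_betw (p I) {..<q} {..<q}" by (simp add: bij_betw_def)
      then have p: "p I permutes {..<q}" by (rule bij_imp_permutes) (simp add: p_def)
      have "\<omega> ?v = \<omega> (?e \<circ> p I)"
        by (rule alt_form_cong[OF \<omega>]) (use 3(1) in \<open>auto simp: p_def\<close>)
      also have "\<dots> = of_int (sign (p I)) * \<omega> ?e"
        by (rule alt_form_permute[OF \<omega> is_basis_subspace[OF b(1)] eV p])
      finally show ?thesis using 3 by (simp add: \<kappa>_def)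
    qed
  qed
  then show ?thesis by blast
qed

text \<open>Both forms are multiples of one determinant. The cross-multiplied shape needs no
  argument on which \<omega> is nonzero, and it also holds if \<omega> vanishes identically.\<close>

lemma alt_form_proportional:
  assumes \<omega>: "alt_form q V \<omega>" and \<eta>: "alt_form q V \<eta>" and b: "is_basis V r b" "q \<le> r"
    and van: "\<forall>v. \<forall>i<q. (\<forall>j<q. v j \<in> V) \<longrightarrow> v i \<in> b ` {..<r - q} \<longrightarrow> \<omega> v = 0"
      "\<forall>v. \<forall>i<q. (\<forall>j<q. v j \<in> V) \<longrightarrow> v i \<in> b ` {..<r - q} \<longrightarrow> \<eta> v = 0"
  shows "\<eta> v * \<omega> w = \<omega> v * \<eta> w"
proof -
  let ?e = "\<lambda>j. b (r - q + j)"
  obtain \<kappa> where "\<forall>\<omega> I. alt_form q V \<omega> \<longrightarrow>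
      (\<forall>v. \<forall>i<q. (\<forall>j<q. v j \<in> V) \<longrightarrow> v i \<in> b ` {..<r - q} \<longrightarrow> \<omega> v = 0) \<longrightarrow>
      (\<forall>j<q. I j < r) \<longrightarrow> \<omega> (\<lambda>j. b (I j)) = \<kappa> I * \<omega> ?e"
    using alt_form_top_basis[OF b] by blast
  then have \<kappa>: "\<omega> (\<lambda>j. b (I j)) = \<kappa> I * \<omega> ?e" if "alt_form q V \<omega>"
    "\<forall>v. \<forall>i<q. (\<forall>j<q. v j \<in> V) \<longrightarrow> v i \<in> b ` {..<r - q} \<longrightarrow> \<omega> v = 0" "\<forall>j<q. I j < r" for \<omega> I
    using that by blast
  have cross: "\<omega> ?e * \<eta> u - \<eta> ?e * \<omega> u = 0" for u
  proof (rule alt_form_eq_zero_basis[OF alt_form_diff_scale[OF \<eta> \<omega>] b(1)])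
    fix I assume I: "\<And>j. j < q \<Longrightarrow> I j < r"
    show "\<omega> ?e * \<eta> (\<lambda>j. b (I j)) - \<eta> ?e * \<omega> (\<lambda>j. b (I j)) = 0"
      using \<kappa>[OF \<omega> van(1), of I] \<kappa>[OF \<eta> van(2), of I] I by simp
  qed
  show ?thesis
  proof (cases "\<omega> ?e = 0")
    case False
    have "(\<eta> v * \<omega> w) * \<omega> ?e = (\<omega> ?e * \<eta> v) * \<omega> w" by simp
    also have "\<dots> = \<omega> v * (\<eta> ?e * \<omega> w)" using cross[of v] by simp
    also have "\<dots> = (\<omega> v * \<eta> w) * \<omega> ?e" using cross[of w] by (simp add: mult.commute)
    finally show ?thesis using False by simp
  next
    case True
    have "\<omega> u = 0" for u
      by (rule alt_form_eq_zero_basis[OF \<omega> b(1)]) (use \<kappa>[OF \<omega> van(1)] True in simp)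
    then show ?thesis by simp
  qed
qed

section \<open>The wedge product in a single fibre and its contraction\<close>

definition contract :: "'a \<Rightarrow> ((nat \<Rightarrow> 'a) \<Rightarrow> real) \<Rightarrow> (nat \<Rightarrow> 'a) \<Rightarrow> real" where
  "contract u \<omega> v = \<omega> (case_nat u v)"

lemma case_nat_upd: "case_nat u (v(i := x)) = (case_nat u v)(Suc i := x)"
  by (auto simp: fun_eq_iff split: nat.split)

lemma alt_form_contract:
  assumes "alt_form (Suc k) V \<omega>" "u \<in> V"
  shows "alt_form k V (contract u \<omega>)"
  unfolding alt_form_def contract_def
proof (intro conjI allI impI ballI)
  fix v i a b x y assume "(\<forall>j<k. v j \<in> V) \<and> i < k" "x \<in> V" "y \<in> V"
  then show "\<omega> (case_nat u (v(i := a *\<^sub>R x + b *\<^sub>R y)))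
      = a * \<omega> (case_nat u (v(i := x))) + b * \<omega> (case_nat u (v(i := y)))"
    unfolding case_nat_upd using assms(2)
    by (intro alt_form_linear[where v="case_nat u v", OF assms(1)]) (auto split: nat.split)
next
  fix v i j assume "(\<forall>j<k. v j \<in> V) \<and> i < k \<and> j < k \<and> i \<noteq> j \<and> v i = v j"
  then show "\<omega> (case_nat u v) = 0" using assms(2)
    by (intro alt_form_eq_zero[where v="case_nat u v" and i="Suc i" and j="Suc j", OF assms(1)]) (auto split: nat.split)
next
  fix v w :: "nat \<Rightarrow> 'a" assume "\<forall>j<k. v j = w j"
  then show "\<omega> (case_nat u v) = \<omega> (case_nat u w)"
    by (intro alt_form_cong[OF assms(1)]) (auto split: nat.split)
next
  fix v assume "\<exists>j<k. v j \<notin> V"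
  then obtain j where "j < k" "v j \<notin> V" by blast
  then show "\<omega> (case_nat u v) = 0"
    by (intro alt_form_outside[OF assms(1), of "Suc j"]) auto
qed

definition ext_wedge :: "nat \<Rightarrow> nat \<Rightarrow> ((nat \<Rightarrow> 'a) \<Rightarrow> real) \<Rightarrow> ((nat \<Rightarrow> 'a) \<Rightarrow> real) \<Rightarrow> (nat \<Rightarrow> 'a) \<Rightarrow> real" where
  "ext_wedge k l \<omega> \<eta> v = (\<Sum>\<sigma> | \<sigma> permutes {..<k + l}.
     of_int (sign \<sigma>) * \<omega> (\<lambda>i. v (\<sigma> i)) * \<eta> (\<lambda>i. v (\<sigma> (k + i)))) / (fact k * fact l)"

lemma wedge_ext_wedge: "wedge k l \<omega> \<eta> x v = ext_wedge k l (\<omega> x) (\<eta> x) v"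
  by (simp add: wedge_def ext_wedge_def)

text \<open>A permutation of n letters made to act on 1, ..., n with 0 fixed.\<close>

definition shift_perm :: "(nat \<Rightarrow> nat) \<Rightarrow> nat \<Rightarrow> nat" where
  "shift_perm \<tau> = case_nat 0 (Suc \<circ> \<tau>)"

lemma shift_perm_eq:
  assumes "\<tau> permutes {..<n}"
  shows "shift_perm \<tau> = map_permutation {..<n} Suc \<tau>"
proof
  fix i show "shift_perm \<tau> i = map_permutation {..<n} Suc \<tau> i"
  proof (cases "i \<in> Suc ` {..<n}")
    case True
    then show ?thesis by (auto simp: shift_perm_def map_permutation_apply)
  next
    case False
    then have "i = 0 \<or> (\<exists>j. i = Suc j \<and> j \<notin> {..<n})" by (cases i) auto
    then have "shift_perm \<tau> i = i" using permutes_not_in[OF assms] by (auto simp: shift_perm_def)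
    then show ?thesis using False by (auto simp: map_permutation_def restrict_id_def)
  qed
qed

lemma sign_shift_perm: "\<tau> permutes {..<n} \<Longrightarrow> sign (shift_perm \<tau>) = sign \<tau>"
  by (simp add: shift_perm_eq sign_map_permutation)

lemma shift_perm_permutes: "\<tau> permutes {..<n} \<Longrightarrow> shift_perm \<tau> permutes {..<Suc n}"
  by (rule permutes_subset[of _ "Suc ` {..<n}"])
     (auto simp: shift_perm_eq intro!: map_permutation_permutes simp: bij_betw_def)

lemma bij_betw_shift_perm: "bij_betw shift_perm {\<tau>. \<tau> permutes {..<n}} {q. q permutes {1..<Suc n}}"
proof -
  have S: "Suc ` {..<n} = {1..<Suc n}" by (auto simp: image_iff Bex_def) presburger
  have "bij_betw (\<lambda>\<pi> x. if x \<in> {1..<Suc n} then Suc (\<pi> (inv_into {..<n} Suc x)) else x)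
      {\<tau>. \<tau> permutes {..<n}} {q. q permutes {1..<Suc n}}"
    by (rule bij_betw_permutations) (simp add: bij_betw_def S)
  moreover have "shift_perm \<tau> = (\<lambda>x. if x \<in> {1..<Suc n} then Suc (\<tau> (inv_into {..<n} Suc x)) else x)"
    if "\<tau> permutes {..<n}" for \<tau>
    unfolding shift_perm_eq[OF that] map_permutation_def restrict_id_def S by (simp add: fun_eq_iff)
  ultimately show ?thesis by (subst bij_betw_cong) auto
qed

text \<open>The cycle that moves position b to the front and the positions before it up by one. It
  is a product of b adjacent transpositions, hence has sign (-1)^b.\<close>

definition cycle_to :: "nat \<Rightarrow> nat \<Rightarrow> nat" where
  "cycle_to b i = (if i < b then Suc i else if i = b then 0 else i)"

lemma cycle_to_Suc: "cycle_to (Suc b) = cycle_to b \<circ> Transposition.transpose b (Suc b)"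
  by (auto simp: fun_eq_iff cycle_to_def Transposition.transpose_def)

lemma cycle_to_permutes: "b < n \<Longrightarrow> cycle_to b permutes {..<n}"
proof (induction b)
  case 0
  have "cycle_to 0 = id" by (auto simp: cycle_to_def)
  then show ?case by (simp only: permutes_id)
next
  case (Suc b)
  then show ?case unfolding cycle_to_Suc by (intro permutes_compose permutes_swap_id) auto
qed

lemma sign_cycle_to: "sign (cycle_to b) = (- 1) ^ b"
proof (induction b)
  case 0
  have "cycle_to 0 = id" by (auto simp: cycle_to_def)
  then show ?case by simp
next
  case (Suc b)
  have "permutation (cycle_to b)"
    using cycle_to_permutes[of b "Suc b"] by (rule permutes_imp_permutation[rotated]) auto
  then show ?case unfolding cycle_to_Suc
    by (subst sign_compose) (auto simp: Suc permutation_swap_id sign_swap_id)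
qed

text \<open>A permutation \<sigma> is determined by the position b with \<sigma>(b) = 0 and by a
  permutation \<tau> of the other entries. In the wedge product b tells which slot receives the
  first vector.\<close>

lemma sum_permutes_Suc:
  fixes g :: "(nat \<Rightarrow> nat) \<Rightarrow> real"
  shows "(\<Sum>\<sigma> | \<sigma> permutes {..<Suc n}. g \<sigma>) =
    (\<Sum>b<Suc n. \<Sum>\<tau> | \<tau> permutes {..<n}. g (shift_perm \<tau> \<circ> cycle_to b))"
proof -
  let ?t = "Transposition.transpose (0::nat)"
  have S: "{..<Suc n} = insert 0 {1..<Suc n}" by auto
  \<comment> \<open>Inverses bring the transposition of \<open>sum_over_permutations_insert\<close>
    to the right, where it acts on positions.\<close>
  have "(\<Sum>\<sigma> | \<sigma> permutes {..<Suc n}. g \<sigma>) = (\<Sum>\<sigma> | \<sigma> permutes {..<Suc n}. g (inv \<sigma>))"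
    by (rule sum_permutations_inverse)
  also have "\<dots> = (\<Sum>b\<in>{..<Suc n}. \<Sum>q | q permutes {1..<Suc n}. g (inv (?t b \<circ> q)))"
    unfolding S by (rule sum_over_permutations_insert) auto
  also have "\<dots> = (\<Sum>b<Suc n. \<Sum>\<tau> | \<tau> permutes {..<n}. g (shift_perm \<tau> \<circ> cycle_to b))"
  proof (rule sum.cong[OF refl])
    fix b assume b: "b \<in> {..<Suc n}"
    let ?P = "{q. q permutes {1..<Suc n}}"
    have "(\<Sum>q\<in>?P. g (inv (?t b \<circ> q))) = (\<Sum>q\<in>?P. g (inv q \<circ> ?t b))"
    proof (rule sum.cong[OF refl])
      fix q assume "q \<in> ?P"
      then have "inv (?t b \<circ> q) = inv q \<circ> inv (?t b)"
        by (intro o_inv_distrib) (auto simp: permutes_bij)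
      then show "g (inv (?t b \<circ> q)) = g (inv q \<circ> ?t b)" by simp
    qed
    also have "\<dots> = (\<Sum>q\<in>?P. g (q \<circ> ?t b))"
      by (rule sum_permutations_inverse[symmetric])
    \<comment> \<open>The cycle and the transposition both send b to 0. They differ by a permutation
      that fixes 0, and the sum over q absorbs it.\<close>
    also have "\<dots> = (\<Sum>q\<in>?P. g (q \<circ> (cycle_to b \<circ> ?t b) \<circ> ?t b))"
    proof (rule sum_permutations_compose_right)
      have "cycle_to b \<circ> ?t b permutes {..<Suc n}"
        using b by (intro permutes_compose permutes_swap_id cycle_to_permutes) auto
      then show "cycle_to b \<circ> ?t b permutes {1..<Suc n}"
      proof (rule permutes_superset)
        fix x assume "x \<in> {..<Suc n} - {1..<Suc n}"
        then have "x = 0" by auto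
        then show "(cycle_to b \<circ> ?t b) x = x" by (simp add: cycle_to_def)
      qed
    qed
    also have "\<dots> = (\<Sum>q\<in>?P. g (q \<circ> cycle_to b))"
      by (simp add: comp_assoc)
    also have "\<dots> = (\<Sum>\<tau> | \<tau> permutes {..<n}. g (shift_perm \<tau> \<circ> cycle_to b))"
      by (rule sum.reindex_bij_betw[OF bij_betw_shift_perm, symmetric])
    finally show "(\<Sum>q\<in>?P. g (inv (?t b \<circ> q))) = \<dots>" .
  qed
  finally show ?thesis .
qed

text \<open>Contraction is an antiderivation of the wedge product, which is the defining recursion
  of \<open>shuffle\<close>. In the permutation sum u occupies a slot of \<omega> or a slot of
  \<eta>. All k slots of \<omega> contribute alike, so that k/k! becomes 1/(k-1)!, and likewise for
  \<eta>. The case distinctions guard the truncated differences k - 1 and l - 1.\<close>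

theorem ext_wedge_case_nat:
  assumes \<omega>: "alt_form k V \<omega>" and \<eta>: "alt_form l V \<eta>" and V: "subspace V"
    and n: "k + l = Suc n" and u: "u \<in> V" and v: "\<And>j. j < n \<Longrightarrow> v j \<in> V"
  shows "ext_wedge k l \<omega> \<eta> (case_nat u v) =
    (if k = 0 then 0 else ext_wedge (k - 1) l (contract u \<omega>) \<eta> v) +
    (- 1) ^ k * (if l = 0 then 0 else ext_wedge k (l - 1) \<omega> (contract u \<eta>) v)"
proof -
  let ?w = "case_nat u v"
  define t where "t \<sigma> = of_int (sign \<sigma>) * \<omega> (\<lambda>i. ?w (\<sigma> i)) * \<eta> (\<lambda>i. ?w (\<sigma> (k + i)))" for \<sigma>
  define X where "X = (\<Sum>\<tau> | \<tau> permutes {..<n}. of_int (sign \<tau>) * contract u \<omega> (\<lambda>i. v (\<tau> i)) * \<eta> (\<lambda>i. v (\<tau> (k - 1 + i))))"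
  define Y where "Y = (\<Sum>\<tau> | \<tau> permutes {..<n}. of_int (sign \<tau>) * \<omega> (\<lambda>i. v (\<tau> i)) * contract u \<eta> (\<lambda>i. v (\<tau> (k + i))))"
  have y: "case_nat u (\<lambda>i. v (\<tau> i)) j \<in> V" if "\<tau> permutes {..<n}" "j < Suc n" for \<tau> j
    using that u v permutes_in_image[OF that(1)] by (auto split: nat.split)
  have sgn: "sign (shift_perm \<tau> \<circ> cycle_to b) = sign \<tau> * (- 1) ^ b" if "\<tau> permutes {..<n}" "b < Suc n" for \<tau> b
    using permutes_imp_permutation[OF _ shift_perm_permutes[OF that(1)]]
      permutes_imp_permutation[OF _ cycle_to_permutes[OF that(2)]]
    by (subst sign_compose) (auto simp: sign_shift_perm[OF that(1)] sign_cycle_to)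
  have w: "?w ((shift_perm \<tau> \<circ> cycle_to b) i) = case_nat u (\<lambda>i. v (\<tau> i)) (cycle_to b i)" for \<tau> b i
    by (auto simp: shift_perm_def split: nat.split)
  \<comment> \<open>Here u is in slot b of \<omega>. Bringing it to the front gives (-1)^b, which
    cancels the sign of \<open>cycle_to b\<close>.\<close>
  have low: "t (shift_perm \<tau> \<circ> cycle_to b) = of_int (sign \<tau>) * contract u \<omega> (\<lambda>i. v (\<tau> i)) * \<eta> (\<lambda>i. v (\<tau> (k - 1 + i)))"
    if \<tau>: "\<tau> permutes {..<n}" and b: "b < k" for \<tau> b
  proof -
    let ?y = "case_nat u (\<lambda>i. v (\<tau> i))"
    have "\<omega> (\<lambda>i. ?y (cycle_to b i)) = of_int (sign (cycle_to b)) * \<omega> ?y"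
      by (rule alt_form_permute[OF \<omega> V _ cycle_to_permutes[OF b], unfolded comp_def]) (use y[OF \<tau>] n in auto)
    moreover have "(\<lambda>i. ?y (cycle_to b (k + i))) = (\<lambda>i. v (\<tau> (k - 1 + i)))"
      using b by (auto simp: fun_eq_iff cycle_to_def split: nat.split)
    moreover have "b < Suc n" using b n by simp
    ultimately show ?thesis
      unfolding t_def w by (simp add: sgn[OF \<tau>] sign_cycle_to contract_def)
  qed
  \<comment> \<open>Here u is in slot m of \<eta>. Only m of the k + m signs are cancelled, which
    leaves (-1)^k.\<close>
  have high: "t (shift_perm \<tau> \<circ> cycle_to (k + m)) =
      (- 1) ^ k * (of_int (sign \<tau>) * \<omega> (\<lambda>i. v (\<tau> i)) * contract u \<eta> (\<lambda>i. v (\<tau> (k + i))))"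
    if \<tau>: "\<tau> permutes {..<n}" and m: "m < l" for \<tau> m
  proof -
    let ?y = "case_nat u (\<lambda>i. v (\<tau> i))" and ?z = "case_nat u (\<lambda>i. v (\<tau> (k + i)))"
    have z: "?z j \<in> V" if "j < l" for j
      using y[OF \<tau>, of "k + j"] n that u by (auto split: nat.splits)
    have "\<eta> (?z \<circ> cycle_to m) = of_int (sign (cycle_to m)) * \<eta> ?z"
      by (rule alt_form_permute[OF \<eta> V z cycle_to_permutes[OF m]])
    moreover have "(\<lambda>i. ?y (cycle_to (k + m) (k + i))) = ?z \<circ> cycle_to m"
      by (auto simp: fun_eq_iff cycle_to_def split: nat.split)
    moreover have "\<omega> (\<lambda>i. ?y (cycle_to (k + m) i)) = \<omega> (\<lambda>i. v (\<tau> i))"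
      by (rule alt_form_cong[OF \<omega>]) (auto simp: cycle_to_def)
    moreover have "k + m < Suc n" using m n by simp
    ultimately show ?thesis
      unfolding t_def w by (simp add: sgn[OF \<tau>] sign_cycle_to contract_def power_add)
  qed
  have "{..<Suc n} = {..<k} \<union> (\<lambda>m. k + m) ` {..<l}"
  proof (intro equalityI subsetI)
    fix x assume "x \<in> {..<Suc n}"
    then have "x < k \<or> x = k + (x - k) \<and> x - k < l" using n by auto
    then show "x \<in> {..<k} \<union> (\<lambda>m. k + m) ` {..<l}" by blast
  qed (use n in auto)
  then have "(\<Sum>\<sigma> | \<sigma> permutes {..<Suc n}. t \<sigma>) =
      (\<Sum>b<k. \<Sum>\<tau> | \<tau> permutes {..<n}. t (shift_perm \<tau> \<circ> cycle_to b)) +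
      (\<Sum>b\<in>(\<lambda>m. k + m) ` {..<l}. \<Sum>\<tau> | \<tau> permutes {..<n}. t (shift_perm \<tau> \<circ> cycle_to b))"
    unfolding sum_permutes_Suc by (subst sum.union_disjoint[symmetric]) auto
  also have "(\<Sum>b\<in>(\<lambda>m. k + m) ` {..<l}. \<Sum>\<tau> | \<tau> permutes {..<n}. t (shift_perm \<tau> \<circ> cycle_to b)) =
      (\<Sum>m<l. \<Sum>\<tau> | \<tau> permutes {..<n}. t (shift_perm \<tau> \<circ> cycle_to (k + m)))"
    by (subst sum.reindex) auto
  also have "\<dots> = real l * ((- 1) ^ k * Y)"
    by (simp add: high Y_def sum_distrib_left)
  also have "(\<Sum>b<k. \<Sum>\<tau> | \<tau> permutes {..<n}. t (shift_perm \<tau> \<circ> cycle_to b)) = (\<Sum>b<k. X)"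
    unfolding X_def by (intro sum.cong refl) (use low in auto)
  finally have "(\<Sum>\<sigma> | \<sigma> permutes {..<Suc n}. t \<sigma>) = real k * X + real l * ((- 1) ^ k * Y)"
    by simp
  then have main: "ext_wedge k l \<omega> \<eta> ?w = (real k * X + real l * ((- 1) ^ k * Y)) / (fact k * fact l)"
    by (simp add: ext_wedge_def n t_def)
  have "(if k = 0 then 0 else ext_wedge (k - 1) l (contract u \<omega>) \<eta> v) = real k * X / (fact k * fact l)"
  proof (cases k)
    case (Suc j)
    then have "k - 1 + l = n" using n by simp
    then have "ext_wedge (k - 1) l (contract u \<omega>) \<eta> v = X / (fact j * fact l)"
      using Suc by (simp add: ext_wedge_def X_def)
    moreover have "(fact k :: real) * fact l = real k * (fact j * fact l)" using Suc by simp
    ultimately show ?thesis using Suc by (simp only: if_False mult_divide_mult_cancel_left of_nat_eq_0_iff nat.simps simp_thms)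
  qed simp
  moreover have "(if l = 0 then 0 else ext_wedge k (l - 1) \<omega> (contract u \<eta>) v) = real l * Y / (fact k * fact l)"
  proof (cases l)
    case (Suc j)
    then have "k + (l - 1) = n" using n by simp
    then have "ext_wedge k (l - 1) \<omega> (contract u \<eta>) v = Y / (fact k * fact j)"
      using Suc by (simp add: ext_wedge_def Y_def)
    moreover have "(fact k :: real) * fact l = real l * (fact k * fact j)" using Suc by simp
    ultimately show ?thesis using Suc by (simp only: if_False mult_divide_mult_cancel_left of_nat_eq_0_iff nat.simps simp_thms)
  qed simp
  ultimately show ?thesis unfolding main by (simp add: add_divide_distrib)
qed

lemma ext_wedge_cong:
  assumes "alt_form k V \<omega>" "alt_form l V \<eta>" "\<And>j. j < k + l \<Longrightarrow> v j = w j"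
  shows "ext_wedge k l \<omega> \<eta> v = ext_wedge k l \<omega> \<eta> w"
proof -
  have "\<omega> (\<lambda>i. v (\<sigma> i)) = \<omega> (\<lambda>i. w (\<sigma> i))" "\<eta> (\<lambda>i. v (\<sigma> (k + i))) = \<eta> (\<lambda>i. w (\<sigma> (k + i)))"
    if "\<sigma> permutes {..<k + l}" for \<sigma>
    using permutes_in_image[OF that] assms(3)
    by (auto intro!: alt_form_cong[OF assms(1)] alt_form_cong[OF assms(2)])
  then show ?thesis by (simp add: ext_wedge_def)
qed

lemma ext_wedge_outside:
  assumes "alt_form k V \<omega>" "alt_form l V \<eta>" "j < k + l" "v j \<notin> V"
  shows "ext_wedge k l \<omega> \<eta> v = 0"
proof -
  have "\<omega> (\<lambda>i. v (\<sigma> i)) * \<eta> (\<lambda>i. v (\<sigma> (k + i))) = 0" if \<sigma>: "\<sigma> permutes {..<k + l}" for \<sigma>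
  proof -
    obtain i where i: "\<sigma> i = j" "i < k + l"
      using permutes_surj[OF \<sigma>] permutes_in_image[OF \<sigma>] assms(3) by (metis lessThan_iff surjD)
    show ?thesis
    proof (cases "i < k")
      case True
      then show ?thesis using alt_form_outside[OF assms(1), of i "\<lambda>i. v (\<sigma> i)"] i assms(4) by simp
    next
      case False
      then have "i - k < l" "k + (i - k) = i" using i by auto
      then show ?thesis
        using alt_form_outside[OF assms(2), of "i - k" "\<lambda>i. v (\<sigma> (k + i))"] i assms(4) by simp
    qed
  qed
  then have "(\<Sum>\<sigma> | \<sigma> permutes {..<k + l}. of_int (sign \<sigma>) * (\<omega> (\<lambda>i. v (\<sigma> i)) * \<eta> (\<lambda>i. v (\<sigma> (k + i))))) = 0"
    by (intro sum.neutral) simp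
  then show ?thesis by (simp add: ext_wedge_def mult.assoc)
qed

lemma ext_wedge_0_0:
  assumes "alt_form 0 V \<omega>" "alt_form 0 V \<eta>"
  shows "ext_wedge 0 0 \<omega> \<eta> v = \<omega> v * \<eta> v"
  by (simp add: ext_wedge_def)

section \<open>Bump functions and sections\<close>

text \<open>Gram-Schmidt. A vector whose remainder a' is 0 lies in the span already and is dropped,
  so the spanning set may be dependent.\<close>

lemma ex_orthonormal_spanning:
  fixes b :: "'e::real_inner set"
  assumes "finite b"
  shows "\<exists>B. finite B \<and> (\<forall>x\<in>B. \<forall>y\<in>B. x \<bullet> y = (if x = y then 1 else 0)) \<and> span B = span b"
  using assms
proof (induction b rule: finite_induct)
  case empty
  show ?case by (intro exI[of _ "{}"]) auto
next
  case (insert a b)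
  then obtain B where B: "finite B" "\<And>x y. x \<in> B \<Longrightarrow> y \<in> B \<Longrightarrow> x \<bullet> y = (if x = y then 1 else 0)" "span B = span b"
    by blast
  define a' where "a' = a - (\<Sum>e\<in>B. (a \<bullet> e) *\<^sub>R e)"
  have orth: "a' \<bullet> e = 0" if "e \<in> B" for e
  proof -
    have "(\<Sum>f\<in>B. (a \<bullet> f) * (f \<bullet> e)) = (\<Sum>f\<in>B. if f = e then a \<bullet> e else 0)"
      using that B(2) by (intro sum.cong) auto
    then show ?thesis using that B(1) by (simp add: a'_def inner_diff_left inner_sum_left)
  qed
  have sB: "(\<Sum>e\<in>B. (a \<bullet> e) *\<^sub>R e) \<in> span B" by (intro span_sum span_scale span_base)
  have a: "a = a' + (\<Sum>e\<in>B. (a \<bullet> e) *\<^sub>R e)" by (simp add: a'_def)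
  show ?case
  proof (cases "a' = 0")
    case True
    then have "(\<Sum>e\<in>B. (a \<bullet> e) *\<^sub>R e) = a" by (simp add: a'_def)
    then have "a \<in> span b" using sB unfolding B(3) by (rule subst)
    from span_redundant[OF this] have "span (insert a b) = span B" using B(3) by simp
    then show ?thesis using B by (intro exI[of _ B]) auto
  next
    case False
    define e where "e = a' /\<^sub>R norm a'"
    have "norm e = 1" using False by (simp add: e_def)
    then have ee: "e \<bullet> e = 1" by (simp add: dot_square_norm)
    have eB: "e \<bullet> x = 0" "x \<bullet> e = 0" if "x \<in> B" for x
      using orth[OF that] by (simp_all add: e_def inner_commute)
    have "span (insert e B) = span (insert a b)"
    proof (subst span_eq, intro conjI subsetI)
      have sb: "x \<in> span (insert a b)" if "x \<in> span B" for x
        using that B(3) span_mono[of b "insert a b"] by auto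
      fix x assume "x \<in> insert e B"
      then show "x \<in> span (insert a b)"
      proof
        have "a' \<in> span (insert a b)" unfolding a'_def
          by (rule span_diff[OF span_base[OF insertI1] sb[OF sB]])
        then show "x = e \<Longrightarrow> x \<in> span (insert a b)" by (simp add: e_def span_scale)
      qed (use sb span_base in blast)
    next
      have sb: "x \<in> span (insert e B)" if "x \<in> span b" for x
        using that B(3) span_mono[of B "insert e B"] by auto
      fix x assume "x \<in> insert a b"
      then show "x \<in> span (insert e B)"
      proof
        have "a' = norm a' *\<^sub>R e" using False by (simp add: e_def)
        then have "a' \<in> span (insert e B)" by (metis insertI1 span_base span_scale)
        then show "x = a \<Longrightarrow> x \<in> span (insert e B)"
          using a sb[of "\<Sum>e\<in>B. (a \<bullet> e) *\<^sub>R e"] sB B(3) by (metis span_add)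
      qed (use sb span_base in blast)
    qed
    moreover have "e \<notin> B" using ee eB(1)[of e] by auto
    then have "x \<bullet> y = (if x = y then 1 else 0)" if "x \<in> insert e B" "y \<in> insert e B" for x y
      using that B(2) ee eB by auto
    ultimately show ?thesis using B(1) by blast
  qed
qed

text \<open>Adding a vector to B adds one coefficient from a compact interval, and the new set is a
  continuous image of a product of compact sets.\<close>

lemma compact_span_box:
  fixes B :: "'e::real_inner set"
  assumes "finite B"
  shows "compact {\<Sum>e\<in>B. c e *\<^sub>R e | c. \<forall>e\<in>B. \<bar>c e\<bar> \<le> (R::real)}"
  using assms
proof (induction B rule: finite_induct)
  case (insert a B)
  let ?K = "{\<Sum>e\<in>B. c e *\<^sub>R e | c. \<forall>e\<in>B. \<bar>c e\<bar> \<le> R}"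
  have "compact ((\<lambda>(t, z). t *\<^sub>R a + z) ` ({-R..R} \<times> ?K))"
    using insert by (intro compact_continuous_image compact_Times)
      (auto simp: case_prod_unfold intro!: continuous_intros)
  also have "(\<lambda>(t, z). t *\<^sub>R a + z) ` ({-R..R} \<times> ?K) = {\<Sum>e\<in>insert a B. c e *\<^sub>R e | c. \<forall>e\<in>insert a B. \<bar>c e\<bar> \<le> R}"
  proof (intro equalityI subsetI)
    fix y assume "y \<in> (\<lambda>(t, z). t *\<^sub>R a + z) ` ({-R..R} \<times> ?K)"
    then obtain t c where tc: "y = t *\<^sub>R a + (\<Sum>e\<in>B. c e *\<^sub>R e)" "\<bar>t\<bar> \<le> R" "\<forall>e\<in>B. \<bar>c e\<bar> \<le> R" by auto
    have "(\<Sum>e\<in>B. (c(a := t)) e *\<^sub>R e) = (\<Sum>e\<in>B. c e *\<^sub>R e)"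
      using insert(2) by (intro sum.cong) auto
    then have "y = (\<Sum>e\<in>insert a B. (c(a := t)) e *\<^sub>R e)" using insert tc(1) by simp
    moreover have "\<forall>e\<in>insert a B. \<bar>(c(a := t)) e\<bar> \<le> R" using tc by simp
    ultimately show "y \<in> {\<Sum>e\<in>insert a B. c e *\<^sub>R e | c. \<forall>e\<in>insert a B. \<bar>c e\<bar> \<le> R}" by blast
  next
    fix y assume "y \<in> {\<Sum>e\<in>insert a B. c e *\<^sub>R e | c. \<forall>e\<in>insert a B. \<bar>c e\<bar> \<le> R}"
    then obtain c where c: "y = (\<Sum>e\<in>insert a B. c e *\<^sub>R e)" "\<forall>e\<in>insert a B. \<bar>c e\<bar> \<le> R" by blast
    then have "y = (\<lambda>(t, z). t *\<^sub>R a + z) (c a, \<Sum>e\<in>B. c e *\<^sub>R e)" using insert by simp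
    moreover have "(c a, \<Sum>e\<in>B. c e *\<^sub>R e) \<in> {-R..R} \<times> ?K" using c by (auto simp: abs_le_iff)
    ultimately show "y \<in> (\<lambda>(t, z). t *\<^sub>R a + z) ` ({-R..R} \<times> ?K)" by blast
  qed
  finally show ?case .
qed simp

text \<open>The library proves this for \<open>euclidean_space\<close>, which excludes dimension 0.\<close>

lemma compact_cball_finite_span:
  fixes p :: "'e::real_inner"
  assumes "finite (b :: 'e set)" "span b = UNIV"
  shows "compact (cball p r)"
proof -
  obtain B where B: "finite B" "\<And>x y. x \<in> B \<Longrightarrow> y \<in> B \<Longrightarrow> x \<bullet> y = (if x = y then 1 else 0)" "span B = (UNIV :: 'e set)"
    using ex_orthonormal_spanning[OF assms(1)] assms(2) by metis
  \<comment> \<open>The remainder is orthogonal to B, hence to everything that B spans, hence to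
    itself.\<close>
  have expand: "y = (\<Sum>e\<in>B. (y \<bullet> e) *\<^sub>R e)" for y
  proof -
    let ?z = "y - (\<Sum>e\<in>B. (y \<bullet> e) *\<^sub>R e)"
    have "orthogonal ?z ?z"
    proof (rule orthogonal_to_span)
      show "?z \<in> span B" using B(3) by simp
      fix e assume e: "e \<in> B"
      have "(\<Sum>f\<in>B. (y \<bullet> f) * (f \<bullet> e)) = (\<Sum>f\<in>B. if f = e then y \<bullet> e else 0)"
        using e B(2) by (intro sum.cong) auto
      then show "orthogonal ?z e" using e B(1)
        by (simp add: orthogonal_def inner_diff_left inner_sum_left)
    qed
    then show ?thesis by (simp add: orthogonal_def)
  qed
  let ?K = "{\<Sum>e\<in>B. c e *\<^sub>R e | c. \<forall>e\<in>B. \<bar>c e\<bar> \<le> norm p + r}"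
  have "cball p r \<subseteq> ?K"
  proof
    fix y assume "y \<in> cball p r"
    then have "norm (y - p) \<le> r" by (simp add: dist_norm norm_minus_commute)
    then have "norm y \<le> norm p + r" using norm_triangle_sub[of y p] by linarith
    moreover have "\<bar>y \<bullet> e\<bar> \<le> norm y" if "e \<in> B" for e
      using Cauchy_Schwarz_ineq2[of y e] B(2)[OF that that] by (simp add: norm_eq_sqrt_inner)
    ultimately have "\<forall>e\<in>B. \<bar>y \<bullet> e\<bar> \<le> norm p + r" by fastforce
    then show "y \<in> ?K" using expand[of y] by blast
  qed
  then have eq: "cball p r = ?K \<inter> cball p r" by blast
  show ?thesis by (subst eq) (rule compact_Int_closed[OF compact_span_box[OF B(1)] closed_cball])
qed

section \<open>Charts, smooth functions on the manifold, and bump functions\<close>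

lemma
  assumes "smooth_manifold \<U>" "(V, \<phi>) \<in> \<U>"
  shows chart_open: "open V" and chart_inj: "inj_on \<phi> V" and chart_continuous: "continuous_on V \<phi>"
    and chart_inv_continuous: "continuous_on (\<phi> ` V) (inv_into V \<phi>)"
    and chart_open_image: "open U \<Longrightarrow> open (\<phi> ` (U \<inter> V))"
    and chart_transition: "(W, \<psi>) \<in> \<U> \<Longrightarrow> smooth_on (\<phi> ` (V \<inter> W)) (\<psi> \<circ> inv_into V \<phi>)"
proof -
  have "\<forall>(U, \<phi>)\<in>\<U>. open U \<and> open (\<phi> ` U) \<and> (\<exists>\<psi>. homeomorphism U (\<phi> ` U) \<phi> \<psi>)"
    and tr: "\<forall>(U, \<phi>)\<in>\<U>. \<forall>(V, \<psi>)\<in>\<U>. smooth_on (\<phi> ` (U \<inter> V)) (\<psi> \<circ> inv_into U \<phi>)"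
    by (insert assms(1), unfold smooth_manifold_def, (elim conjE, assumption)+)
  from bspec[OF this(1) assms(2)]
  obtain \<psi> where h: "homeomorphism V (\<phi> ` V) \<phi> \<psi>" and o: "open V" "open (\<phi> ` V)" by auto
  show "open V" by (rule o)
  show inj: "inj_on \<phi> V" using h by (auto simp: homeomorphism_def inj_on_def) metis
  show "continuous_on V \<phi>" using h by (simp add: homeomorphism_def)
  have "inv_into V \<phi> y = \<psi> y" if "y \<in> \<phi> ` V" for y
    using h that inj by (auto simp: homeomorphism_def)
  then show "continuous_on (\<phi> ` V) (inv_into V \<phi>)"
    using h continuous_on_cong[of "\<phi> ` V" "\<phi> ` V" "inv_into V \<phi>" \<psi>] by (auto simp: homeomorphism_def)
  show "open (\<phi> ` (U \<inter> V))" if "open U"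
  proof -
    have "openin (top_of_set V) (U \<inter> V)" using that by (auto simp: openin_open)
    from homeomorphism_imp_open_map[OF h this] o(2) show ?thesis
      using openin_open_trans by blast
  qed
  show "smooth_on (\<phi> ` (V \<inter> W)) (\<psi> \<circ> inv_into V \<phi>)" if "(W, \<psi>) \<in> \<U>" for W \<psi>
    using bspec[OF tr assms(2)] that by auto
qed

lemma smooth_funI:
  assumes "\<And>V \<phi> k. (V, \<phi>) \<in> \<U> \<Longrightarrow> Ck_on k (\<phi> ` (U \<inter> V)) (f \<circ> inv_into V \<phi>)"
  shows "smooth_fun \<U> U f"
  using assms by (auto simp: smooth_fun_def smooth_on_def)

lemma smooth_funD: "smooth_fun \<U> U f \<Longrightarrow> (V, \<phi>) \<in> \<U> \<Longrightarrow> Ck_on k (\<phi> ` (U \<inter> V)) (f \<circ> inv_into V \<phi>)"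
  by (auto simp: smooth_fun_def smooth_on_def)

lemma inv_into_chart: "y \<in> \<phi> ` (U \<inter> V) \<Longrightarrow> inj_on \<phi> V \<Longrightarrow> inv_into V \<phi> y \<in> U \<inter> V"
  by (auto simp: inv_into_f_f)

lemma smooth_fun_mono: "smooth_fun \<U> U f \<Longrightarrow> W \<subseteq> U \<Longrightarrow> smooth_fun \<U> W f"
  by (rule smooth_funI, rule Ck_on_subset[OF _ smooth_funD]) auto

context
  fixes \<U> :: "('m::{t2_space,second_countable_topology} set \<times> ('m \<Rightarrow> 'e::real_inner)) set"
  assumes man: "smooth_manifold \<U>"
begin

lemma smooth_fun_cong:
  assumes "open U" "smooth_fun \<U> U f" "\<And>x. x \<in> U \<Longrightarrow> f x = g x"
  shows "smooth_fun \<U> U g"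
proof (rule smooth_funI)
  fix V \<phi> k assume V: "(V, \<phi>) \<in> \<U>"
  show "Ck_on k (\<phi> ` (U \<inter> V)) (g \<circ> inv_into V \<phi>)"
    by (rule Ck_on_cong[OF chart_open_image[OF man V assms(1)] _ smooth_funD[OF assms(2) V]])
       (use inv_into_chart[OF _ chart_inj[OF man V]] assms(3) in auto)
qed

lemma smooth_fun_locally:
  assumes "\<And>x. x \<in> U \<Longrightarrow> \<exists>N. open N \<and> x \<in> N \<and> smooth_fun \<U> N f"
  shows "smooth_fun \<U> U f"
proof (rule smooth_funI, rule Ck_on_locally)
  fix V \<phi> k y assume V: "(V, \<phi>) \<in> \<U>" and "y \<in> \<phi> ` (U \<inter> V)"
  then obtain x N where x: "y = \<phi> x" "x \<in> U \<inter> V" "open N" "x \<in> N" "smooth_fun \<U> N f" using assms by blast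
  then show "\<exists>T. open T \<and> y \<in> T \<and> Ck_on k T (f \<circ> inv_into V \<phi>)"
    using chart_open_image[OF man V] smooth_funD[OF _ V] by (intro exI[of _ "\<phi> ` (N \<inter> V)"]) auto
qed

lemma smooth_fun_const: "open U \<Longrightarrow> smooth_fun \<U> U (\<lambda>x. c)"
  by (rule smooth_funI) (auto simp: comp_def intro: Ck_on_const chart_open_image[OF man])

lemma smooth_fun_add:
  assumes "open U" "smooth_fun \<U> U f" "smooth_fun \<U> U g"
  shows "smooth_fun \<U> U (\<lambda>x. f x + g x)"
proof (rule smooth_funI)
  fix V \<phi> k assume V: "(V, \<phi>) \<in> \<U>"
  from Ck_on_add[OF chart_open_image[OF man V assms(1)] smooth_funD[OF assms(2) V] smooth_funD[OF assms(3) V]]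
  show "Ck_on k (\<phi> ` (U \<inter> V)) ((\<lambda>x. f x + g x) \<circ> inv_into V \<phi>)" by (simp add: comp_def)
qed

lemma smooth_fun_mult:
  assumes "open U" "smooth_fun \<U> U f" "smooth_fun \<U> U g"
  shows "smooth_fun \<U> U (\<lambda>x. f x * g x)"
proof (rule smooth_funI)
  fix V \<phi> k assume V: "(V, \<phi>) \<in> \<U>"
  from Ck_on_mult[OF chart_open_image[OF man V assms(1)] smooth_funD[OF assms(2) V] smooth_funD[OF assms(3) V]]
  show "Ck_on k (\<phi> ` (U \<inter> V)) ((\<lambda>x. f x * g x) \<circ> inv_into V \<phi>)" by (simp add: comp_def)
qed

lemma smooth_fun_sum:
  assumes "open U" "finite A" "\<And>i. i \<in> A \<Longrightarrow> smooth_fun \<U> U (f i)"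
  shows "smooth_fun \<U> U (\<lambda>x. \<Sum>i\<in>A. f i x)"
  using assms(2,3) by (induction A rule: finite_induct) (auto intro: smooth_fun_const smooth_fun_add assms(1))

lemma smooth_fun_compose_real:
  fixes g :: "real \<Rightarrow> real"
  assumes "open U" "smooth_fun \<U> U f" "smooth_on T g" "open T" "\<And>x. x \<in> U \<Longrightarrow> f x \<in> T"
  shows "smooth_fun \<U> U (\<lambda>x. g (f x))"
proof (rule smooth_funI)
  fix V \<phi> k assume V: "(V, \<phi>) \<in> \<U>"
  have "(f \<circ> inv_into V \<phi>) ` (\<phi> ` (U \<inter> V)) \<subseteq> T"
    using inv_into_chart[OF _ chart_inj[OF man V]] assms(5) by fastforce
  from Ck_on_compose_real[OF chart_open_image[OF man V assms(1)] smooth_funD[OF assms(2) V] _ this assms(4)]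
  show "Ck_on k (\<phi> ` (U \<inter> V)) ((\<lambda>x. g (f x)) \<circ> inv_into V \<phi>)"
    using assms(3) by (simp add: comp_def smooth_on_def)
qed

lemma smooth_fun_inverse:
  assumes "open U" "smooth_fun \<U> U f" "\<And>x. x \<in> U \<Longrightarrow> f x \<noteq> 0"
  shows "smooth_fun \<U> U (\<lambda>x. inverse (f x))"
  by (rule smooth_fun_compose_real[OF assms(1,2) smooth_on_inverse])
     (auto simp: assms(3) open_Collect_neq)

lemma ex_chart: "\<exists>V \<phi>. (V, \<phi>) \<in> \<U> \<and> x \<in> V"
proof -
  have "(\<Union>(U, \<phi>)\<in>\<U>. U) = UNIV" using man by (simp add: smooth_manifold_def)
  then have "x \<in> (\<Union>(U, \<phi>)\<in>\<U>. U)" by simp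
  then show ?thesis by auto
qed

lemma smooth_fun_continuous:
  assumes "open U" "smooth_fun \<U> U f"
  shows "continuous_on U f"
proof (rule continuous_at_imp_continuous_on, intro ballI)
  fix x assume x: "x \<in> U"
  obtain V \<phi> where V: "(V, \<phi>) \<in> \<U>" "x \<in> V" using ex_chart by blast
  have "continuous_on (\<phi> ` (U \<inter> V)) (f \<circ> inv_into V \<phi>)"
    using smooth_funD[OF assms(2) V(1), of 0] by simp
  then have "continuous_on (U \<inter> V) ((f \<circ> inv_into V \<phi>) \<circ> \<phi>)"
    by (rule continuous_on_compose[OF continuous_on_subset[OF chart_continuous[OF man V(1)]], rotated]) auto
  then have "continuous_on (U \<inter> V) f"
    using chart_inj[OF man V(1)] by (subst (asm) continuous_on_cong[OF refl, of _ _ f]) auto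
  moreover have "open (U \<inter> V)" using assms(1) chart_open[OF man V(1)] by auto
  ultimately show "isCont f x" using x V(2) by (simp add: continuous_on_eq_continuous_at)
qed

text \<open>Read in another chart, this is the squared norm of a transition map shifted by
  p.\<close>

lemma smooth_chart_norm:
  assumes "(V, \<phi>) \<in> \<U>"
  shows "smooth_fun \<U> V (\<lambda>x. (\<phi> x - p) \<bullet> (\<phi> x - p))"
proof (rule smooth_funI)
  fix W \<psi> k assume W: "(W, \<psi>) \<in> \<U>"
  have o: "open (\<psi> ` (V \<inter> W))" by (rule chart_open_image[OF man W chart_open[OF man assms]])
  have "Ck_on k (\<psi> ` (V \<inter> W)) (\<phi> \<circ> inv_into W \<psi>)"
    using chart_transition[OF man W assms] by (simp add: smooth_on_def Int_commute)
  then have c: "Ck_on k (\<psi> ` (V \<inter> W)) (\<lambda>y. (\<phi> \<circ> inv_into W \<psi>) y + (- p))"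
    by (intro Ck_on_add Ck_on_const o)
  show "Ck_on k (\<psi> ` (V \<inter> W)) ((\<lambda>x. (\<phi> x - p) \<bullet> (\<phi> x - p)) \<circ> inv_into W \<psi>)"
    using Ck_on_inner[OF o c c] by (simp add: comp_def)
qed

text \<open>The closed set K keeps the support away from the boundary of N. As N and the complement
  of K form an open cover, multiplication by \<theta> followed by extension by 0 stays
  smooth.\<close>

definition bump :: "'m set \<Rightarrow> ('m \<Rightarrow> real) \<Rightarrow> bool" where
  "bump N \<theta> \<longleftrightarrow> smooth_fun \<U> UNIV \<theta> \<and> (\<exists>K. closed K \<and> K \<subseteq> N \<and> (\<forall>x. x \<notin> K \<longrightarrow> \<theta> x = 0))"

text \<open>The flat function of r^2 - |\<phi>(x) - p|^2 vanishes outside a ball of the chart. The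
  part K of M that corresponds to the closed ball is compact, hence closed since M is Hausdorff, so
  that the extension by 0 beyond V is smooth.\<close>

lemma ex_bump:
  assumes "open N" "x0 \<in> N"
  obtains \<theta> where "bump N \<theta>" "\<theta> x0 = 1"
proof -
  obtain V \<phi> where V: "(V, \<phi>) \<in> \<U>" "x0 \<in> V" using ex_chart by blast
  obtain b :: "'e set" where b: "finite b" "span b = UNIV" using man by (auto simp: smooth_manifold_def)
  have o: "open V" "inj_on \<phi> V" by (rule chart_open[OF man V(1)], rule chart_inj[OF man V(1)])
  define p where "p = \<phi> x0"
  have "p \<in> \<phi> ` (N \<inter> V)" using V(2) assms(2) by (simp add: p_def)
  then obtain r where r: "r > 0" "cball p r \<subseteq> \<phi> ` (N \<inter> V)"
    using chart_open_image[OF man V(1) assms(1)] open_contains_cball by blast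
  define K where "K = inv_into V \<phi> ` cball p r"
  have "compact K" unfolding K_def
    using r(2) by (intro compact_continuous_image compact_cball_finite_span[OF b])
      (auto intro: continuous_on_subset[OF chart_inv_continuous[OF man V(1)]])
  then have K: "closed K" by (rule compact_imp_closed)
  have KN: "K \<subseteq> N \<inter> V" unfolding K_def using r(2) inv_into_chart[OF _ o(2)] by blast
  have Kmem: "x \<in> K" if "x \<in> V" "norm (\<phi> x - p) \<le> r" for x
    unfolding K_def using that o(2)
    by (intro image_eqI[of _ _ "\<phi> x"]) (auto simp: dist_norm norm_minus_commute)
  define h where "h x = flat_exp 0 (r\<^sup>2 + (-1) * ((\<phi> x - p) \<bullet> (\<phi> x - p)))" for x
  \<comment> \<open>Normalisation: at the centre of the ball the flat function has the argument
    r^2.\<close>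
  define c where "c = inverse (flat_exp 0 (r\<^sup>2))"
  define \<theta> where "\<theta> x = (if x \<in> V then h x * c else 0)" for x
  have h0: "\<theta> x = 0" if "x \<notin> K" for x
  proof (cases "x \<in> V")
    case True
    then have "r < norm (\<phi> x - p)" using Kmem that by force
    then have "r\<^sup>2 \<le> (norm (\<phi> x - p))\<^sup>2" using r(1) by (intro power_mono) auto
    then show ?thesis by (simp add: \<theta>_def h_def flat_exp_def dot_square_norm)
  qed (simp add: \<theta>_def)
  have "smooth_fun \<U> UNIV \<theta>"
  proof (rule smooth_fun_locally)
    fix x
    show "\<exists>N. open N \<and> x \<in> N \<and> smooth_fun \<U> N \<theta>"
    proof (cases "x \<in> V")
      case True
      have "smooth_fun \<U> V h" unfolding h_def
        by (rule smooth_fun_compose_real[OF o(1) _ smooth_flat_exp open_UNIV])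
           (intro smooth_fun_add smooth_fun_mult smooth_fun_const smooth_chart_norm V(1) o(1), simp)
      then have "smooth_fun \<U> V (\<lambda>x. h x * c)"
        by (intro smooth_fun_mult smooth_fun_const o(1))
      then have "smooth_fun \<U> V \<theta>" by (rule smooth_fun_cong[OF o(1)]) (simp add: \<theta>_def)
      then show ?thesis using True o(1) by blast
    next
      case False
      have "smooth_fun \<U> (- K) \<theta>"
        by (rule smooth_fun_cong[OF _ smooth_fun_const[of "- K" 0]]) (use K h0 in auto)
      then show ?thesis using False KN K by (intro exI[of _ "- K"]) auto
    qed
  qed
  moreover have "\<theta> x0 = 1" using r(1) V(2) by (simp add: \<theta>_def h_def c_def p_def flat_exp_def)
  ultimately show ?thesis using K KN h0 that unfolding bump_def by blast
qed

lemma bump_outside: "bump N \<theta> \<Longrightarrow> x \<notin> N \<Longrightarrow> \<theta> x = 0"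
  by (auto simp: bump_def)

lemma bump_smooth: "bump N \<theta> \<Longrightarrow> smooth_fun \<U> UNIV \<theta>"
  by (auto simp: bump_def)

lemma smooth_fun_bump:
  assumes "bump N \<theta>" "open N" "open W" "smooth_fun \<U> (N \<inter> W) f"
  shows "smooth_fun \<U> W (\<lambda>x. if x \<in> N then \<theta> x * f x else 0)"
proof (rule smooth_fun_locally)
  obtain K where K: "closed K" "K \<subseteq> N" "\<And>x. x \<notin> K \<Longrightarrow> \<theta> x = 0" using assms(1) by (auto simp: bump_def)
  fix x assume x: "x \<in> W"
  show "\<exists>M. open M \<and> x \<in> M \<and> smooth_fun \<U> M (\<lambda>x. if x \<in> N then \<theta> x * f x else 0)"
  proof (cases "x \<in> N")
    case True
    have o: "open (N \<inter> W)" using assms by auto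
    have "smooth_fun \<U> (N \<inter> W) (\<lambda>x. \<theta> x * f x)"
      by (intro smooth_fun_mult o assms(4) smooth_fun_mono[OF bump_smooth[OF assms(1)]]) auto
    then have "smooth_fun \<U> (N \<inter> W) (\<lambda>x. if x \<in> N then \<theta> x * f x else 0)"
      by (rule smooth_fun_cong[OF o]) simp
    then show ?thesis using True x o by blast
  next
    case False
    have "smooth_fun \<U> (- K) (\<lambda>x. if x \<in> N then \<theta> x * f x else 0)"
      by (rule smooth_fun_cong[OF _ smooth_fun_const[of "- K" 0]]) (use K in auto)
    then show ?thesis using False K by (intro exI[of _ "- K"]) auto
  qed
qed

end

section \<open>Sections and forms of a vector bundle\<close>

lemma is_basis_zero:
  assumes "is_basis V r b" "(\<Sum>i<r. c i *\<^sub>R b i) = 0" "i < r"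
  shows "c i = 0"
proof -
  have inj: "inj_on b {..<r}" and ind: "independent (b ` {..<r})" using assms(1) by (auto simp: is_basis_def)
  define d where "d x = c (the_inv_into {..<r} b x)" for x
  have d: "d (b i) = c i" if "i < r" for i using the_inv_into_f_f[OF inj] that by (simp add: d_def)
  have "(\<Sum>x\<in>b ` {..<r}. d x *\<^sub>R x) = (\<Sum>i<r. c i *\<^sub>R b i)"
    using inj by (subst sum.reindex) (auto simp: d)
  then have "d (b i) = 0"
    using assms(2,3) independentD[OF ind, of "b ` {..<r}" d "b i"] by auto
  then show ?thesis using d[OF assms(3)] by simp
qed

locale vbundle =
  fixes E :: "('m::{t2_space,second_countable_topology}, 'e::real_inner, 'a::real_vector, 'z) vbundle_scheme"
  assumes vector_bundle: "vector_bundle E"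
begin

lemma man: "smooth_manifold (charts E)"
  using vector_bundle by (simp add: vector_bundle_def)

lemma ex_frame: "\<exists>V e. (V, e) \<in> frames E \<and> x \<in> V"
proof -
  have "x \<in> (\<Union>(V, e)\<in>frames E. V)" using vector_bundle by (simp add: vector_bundle_def)
  then show ?thesis by auto
qed

lemma frameD:
  assumes "(V, e) \<in> frames E"
  shows frame_open: "open V"
    and frame_basis: "x \<in> V \<Longrightarrow> is_basis (fib E x) (rk E) (\<lambda>i. e i x)"
    and frame_section: "i < rk E \<Longrightarrow> local_section E V (e i)"
proof -
  have "\<forall>(V, e)\<in>frames E. open V \<and> (\<forall>x\<in>V. is_basis (fib E x) (rk E) (\<lambda>i. e i x)) \<and>
      (\<forall>i<rk E. local_section E V (e i))"
    using vector_bundle by (simp add: vector_bundle_def)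
  from bspec[OF this assms]
  show "open V" "x \<in> V \<Longrightarrow> is_basis (fib E x) (rk E) (\<lambda>i. e i x)" "i < rk E \<Longrightarrow> local_section E V (e i)"
    by auto
qed

lemma fib_subspace: "subspace (fib E x)"
proof -
  obtain V e where "(V, e) \<in> frames E" "x \<in> V" using ex_frame by blast
  then show ?thesis by (rule is_basis_subspace[OF frame_basis])
qed

lemma local_section_in: "local_section E U s \<Longrightarrow> x \<in> U \<Longrightarrow> s x \<in> fib E x"
  by (simp add: local_section_def)

lemma local_section_coeff:
  assumes "local_section E U s" "(V, e) \<in> frames E"
  shows "\<exists>c. (\<forall>i<rk E. smooth_fun (charts E) (U \<inter> V) (c i)) \<and>
    (\<forall>x\<in>U \<inter> V. s x = (\<Sum>i<rk E. c i x *\<^sub>R e i x))"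
proof -
  have "\<forall>(V, e)\<in>frames E. \<exists>c. (\<forall>i<rk E. smooth_fun (charts E) (U \<inter> V) (c i)) \<and>
      (\<forall>x\<in>U \<inter> V. s x = (\<Sum>i<rk E. c i x *\<^sub>R e i x))"
    using assms(1) by (simp add: local_section_def)
  from bspec[OF this assms(2)] show ?thesis by simp
qed

lemma local_sectionI:
  assumes "\<And>x. x \<in> U \<Longrightarrow> s x \<in> fib E x"
    "\<And>V e. (V, e) \<in> frames E \<Longrightarrow> \<exists>c. (\<forall>i<rk E. smooth_fun (charts E) (U \<inter> V) (c i)) \<and>
      (\<forall>x\<in>U \<inter> V. s x = (\<Sum>i<rk E. c i x *\<^sub>R e i x))"
  shows "local_section E U s"
  using assms unfolding local_section_def by blast

lemma local_section_lin:
  assumes "open U" "local_section E U s" "local_section E U t"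
    "smooth_fun (charts E) U f" "smooth_fun (charts E) U g"
  shows "local_section E U (\<lambda>x. f x *\<^sub>R s x + g x *\<^sub>R t x)"
proof (rule local_sectionI)
  fix x assume "x \<in> U"
  then show "f x *\<^sub>R s x + g x *\<^sub>R t x \<in> fib E x"
    using assms(2,3) by (intro subspace_add subspace_scale fib_subspace local_section_in)
next
  fix V e assume V: "(V, e) \<in> frames E"
  obtain c where c: "\<forall>i<rk E. smooth_fun (charts E) (U \<inter> V) (c i)" "\<forall>x\<in>U \<inter> V. s x = (\<Sum>i<rk E. c i x *\<^sub>R e i x)"
    using local_section_coeff[OF assms(2) V] by blast
  obtain d where d: "\<forall>i<rk E. smooth_fun (charts E) (U \<inter> V) (d i)" "\<forall>x\<in>U \<inter> V. t x = (\<Sum>i<rk E. d i x *\<^sub>R e i x)"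
    using local_section_coeff[OF assms(3) V] by blast
  have o: "open (U \<inter> V)" using assms(1) frame_open[OF V] by auto
  have "\<forall>i<rk E. smooth_fun (charts E) (U \<inter> V) (\<lambda>x. f x * c i x + g x * d i x)"
    using c(1) d(1) by (auto intro!: smooth_fun_add[OF man o] smooth_fun_mult[OF man o]
        intro: smooth_fun_mono[OF assms(4)] smooth_fun_mono[OF assms(5)])
  moreover have "\<forall>x\<in>U \<inter> V. f x *\<^sub>R s x + g x *\<^sub>R t x = (\<Sum>i<rk E. (f x * c i x + g x * d i x) *\<^sub>R e i x)"
    using c(2) d(2) by (simp add: scaleR_sum_right sum.distrib scaleR_add_left)
  ultimately show "\<exists>c. (\<forall>i<rk E. smooth_fun (charts E) (U \<inter> V) (c i)) \<and>
      (\<forall>x\<in>U \<inter> V. f x *\<^sub>R s x + g x *\<^sub>R t x = (\<Sum>i<rk E. c i x *\<^sub>R e i x))"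
    by (intro exI[of _ "\<lambda>i x. f x * c i x + g x * d i x"] conjI)
qed

lemma local_section_bump:
  assumes "bump (charts E) N \<theta>" "open N" "local_section E N s"
  shows "(\<lambda>x. if x \<in> N then \<theta> x *\<^sub>R s x else 0) \<in> \<Gamma> E"
proof (rule CollectI, rule local_sectionI)
  fix x show "(if x \<in> N then \<theta> x *\<^sub>R s x else 0) \<in> fib E x"
    using assms(3) by (auto intro: subspace_scale subspace_0 fib_subspace local_section_in)
next
  fix V e assume V: "(V, e) \<in> frames E"
  obtain c where c: "\<forall>i<rk E. smooth_fun (charts E) (N \<inter> V) (c i)" "\<forall>x\<in>N \<inter> V. s x = (\<Sum>i<rk E. c i x *\<^sub>R e i x)"
    using local_section_coeff[OF assms(3) V] by blast
  have "\<forall>i<rk E. smooth_fun (charts E) (UNIV \<inter> V) (\<lambda>x. if x \<in> N then \<theta> x * c i x else 0)"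
    using c(1) by (auto intro!: smooth_fun_bump[OF man assms(1,2) frame_open[OF V]])
  moreover have "\<forall>x\<in>UNIV \<inter> V. (if x \<in> N then \<theta> x *\<^sub>R s x else 0) =
      (\<Sum>i<rk E. (if x \<in> N then \<theta> x * c i x else 0) *\<^sub>R e i x)"
    using c(2) by (auto simp: scaleR_sum_right)
  ultimately show "\<exists>c. (\<forall>i<rk E. smooth_fun (charts E) (UNIV \<inter> V) (c i)) \<and>
      (\<forall>x\<in>UNIV \<inter> V. (if x \<in> N then \<theta> x *\<^sub>R s x else 0) = (\<Sum>i<rk E. c i x *\<^sub>R e i x))"
    by (intro exI[of _ "\<lambda>i x. if x \<in> N then \<theta> x * c i x else 0"] conjI)
qed

lemma section_lin:
  "s \<in> \<Gamma> E \<Longrightarrow> t \<in> \<Gamma> E \<Longrightarrow> f \<in> C\<infinity> (charts E) \<Longrightarrow> g \<in> C\<infinity> (charts E) \<Longrightarrow>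
    (\<lambda>x. f x *\<^sub>R s x + g x *\<^sub>R t x) \<in> \<Gamma> E"
  using local_section_lin[of UNIV s t f g] by simp

lemma section_in: "s \<in> \<Gamma> E \<Longrightarrow> s x \<in> fib E x"
  using local_section_in[of UNIV s x] by simp

lemma section_zero: "(\<lambda>x. 0) \<in> \<Gamma> E"
  by (rule CollectI, rule local_sectionI)
     (auto intro!: subspace_0 fib_subspace exI[of _ "\<lambda>i x. 0"] smooth_fun_const[OF man] simp: frame_open)

lemma section_sum:
  assumes "finite I" "\<And>i. i \<in> I \<Longrightarrow> s i \<in> \<Gamma> E"
  shows "(\<lambda>x. \<Sum>i\<in>I. c i *\<^sub>R s i x) \<in> \<Gamma> E"
  using assms
proof (induction I rule: finite_induct)
  case empty
  then show ?case using section_zero by simp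
next
  case (insert i I)
  have "(\<lambda>x. c i *\<^sub>R s i x + 1 *\<^sub>R (\<Sum>i\<in>I. c i *\<^sub>R s i x)) \<in> \<Gamma> E"
    by (rule section_lin) (use insert smooth_fun_const[OF man] in auto)
  then show ?case using insert by simp
qed

text \<open>Constant coefficients in a local frame, cut off by a bump function. F stands for the
  fibres of the bundle or for those of a subbundle; outside U it only has to contain 0.\<close>

lemma section_through_frame:
  assumes "open U" "x \<in> U" "\<And>i. i < n \<Longrightarrow> local_section E U (f i)"
    "\<And>y. y \<in> U \<Longrightarrow> is_basis (F y) n (\<lambda>i. f i y)" "\<And>y. 0 \<in> F y" "v \<in> F x"
  shows "\<exists>s\<in>\<Gamma> E. s x = v \<and> (\<forall>y. s y \<in> F y)"
proof -
  obtain \<theta> where \<theta>: "bump (charts E) U \<theta>" "\<theta> x = 1" using ex_bump[OF man assms(1,2)] .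
  obtain c where c: "v = (\<Sum>i<n. c i *\<^sub>R f i x)"
    using is_basis_expand[OF assms(4)[OF assms(2)] assms(6)] by blast
  define s where "s y = (\<Sum>i<n. c i *\<^sub>R (if y \<in> U then \<theta> y *\<^sub>R f i y else 0))" for y
  have "s \<in> \<Gamma> E" unfolding s_def
    by (rule section_sum) (use assms(3) local_section_bump[OF \<theta>(1) assms(1)] in auto)
  moreover have "s x = v" using \<theta>(2) assms(2) c by (simp add: s_def)
  moreover have "s y \<in> F y" for y
  proof (cases "y \<in> U")
    case True
    then show ?thesis unfolding s_def
      by (auto intro!: subspace_sum subspace_scale is_basis_subspace[OF assms(4)] is_basis_in[OF assms(4)])
  qed (simp add: s_def assms(5))
  ultimately show ?thesis by blast
qed

lemma section_through:
  assumes "v \<in> fib E x"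
  shows "\<exists>s\<in>\<Gamma> E. s x = v"
proof -
  obtain V e where V: "(V, e) \<in> frames E" "x \<in> V" using ex_frame by blast
  show ?thesis
    using section_through_frame[OF frame_open[OF V(1)] V(2) frame_section[OF V(1)] frame_basis[OF V(1)]
        subspace_0[OF fib_subspace] assms] by blast
qed

text \<open>Operators on sections that are linear over the smooth functions therefore act pointwise.\<close>

lemma section_vanish_decompose:
  assumes "s \<in> \<Gamma> E" "s x = 0"
  shows "\<exists>\<theta> f w. \<theta> \<in> C\<infinity> (charts E) \<and> \<theta> x = 1 \<and>
    (\<forall>i<rk E. f i \<in> C\<infinity> (charts E) \<and> f i x = 0 \<and> w i \<in> \<Gamma> E) \<and>
    (\<forall>y. (\<theta> y * \<theta> y) *\<^sub>R s y = (\<Sum>i<rk E. f i y *\<^sub>R w i y))"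
proof -
  obtain V e where V: "(V, e) \<in> frames E" "x \<in> V" using ex_frame by blast
  have o: "open V" by (rule frame_open[OF V(1)])
  obtain c where c: "\<forall>i<rk E. smooth_fun (charts E) (UNIV \<inter> V) (c i)"
    "\<forall>x\<in>UNIV \<inter> V. s x = (\<Sum>i<rk E. c i x *\<^sub>R e i x)"
    using local_section_coeff[OF _ V(1)] assms(1) by blast
  obtain \<theta> where \<theta>: "bump (charts E) V \<theta>" "\<theta> x = 1" using ex_bump[OF man o V(2)] .
  \<comment> \<open>One factor \<theta> makes the coefficients global and a second one the frame,
    which explains the square of \<theta> in the claim.\<close>
  define f where "f i y = (if y \<in> V then \<theta> y * c i y else 0)" for i y
  define w where "w i y = (if y \<in> V then \<theta> y *\<^sub>R e i y else 0)" for i y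
  show ?thesis
  proof (intro exI conjI allI impI)
    show "\<theta> \<in> C\<infinity> (charts E)" "\<theta> x = 1" using bump_smooth[OF man \<theta>(1)] \<theta>(2) by auto
    fix i assume i: "i < rk E"
    show "f i \<in> C\<infinity> (charts E)" unfolding f_def
      using c(1) i by (auto intro!: smooth_fun_bump[OF man \<theta>(1) o] simp: Int_commute)
    show "f i x = 0"
      using is_basis_zero[OF frame_basis[OF V] _ i, of "\<lambda>i. c i x"] c(2) assms(2) V(2) by (auto simp: f_def)
    show "w i \<in> \<Gamma> E" unfolding w_def
      by (rule local_section_bump[OF \<theta>(1) o frame_section[OF V(1) i]])
  next
    fix y show "(\<theta> y * \<theta> y) *\<^sub>R s y = (\<Sum>i<rk E. f i y *\<^sub>R w i y)"
      using c(2) bump_outside[OF man \<theta>(1), of y]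
      by (cases "y \<in> V") (simp_all add: f_def w_def scaleR_sum_right mult_ac)
  qed
qed

lemma formsD:
  assumes "\<omega> \<in> forms E U k"
  shows forms_alt: "x \<in> U \<Longrightarrow> alt_form k (fib E x) (\<omega> x)"
    and forms_smooth: "(V, e) \<in> frames E \<Longrightarrow> (\<And>j. j < k \<Longrightarrow> I j < rk E) \<Longrightarrow>
      smooth_fun (charts E) (U \<inter> V) (\<lambda>x. \<omega> x (\<lambda>j. e (I j) x))"
proof -
  have *: "\<forall>x\<in>U. alt_form k (fib E x) (\<omega> x)"
    "\<forall>(V, e)\<in>frames E. \<forall>I. (\<forall>j<k. I j < rk E) \<longrightarrow>
        smooth_fun (charts E) (U \<inter> V) (\<lambda>x. \<omega> x (\<lambda>j. e (I j) x))"
    using assms by (simp_all add: forms_def)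
  show "x \<in> U \<Longrightarrow> alt_form k (fib E x) (\<omega> x)" using *(1) by simp
  assume "(V, e) \<in> frames E" "\<And>j. j < k \<Longrightarrow> I j < rk E"
  then show "smooth_fun (charts E) (U \<inter> V) (\<lambda>x. \<omega> x (\<lambda>j. e (I j) x))"
    using bspec[OF *(2), of "(V, e)"] by simp
qed

text \<open>The definition of \<open>forms\<close> tests smoothness on frame tuples only. The frame
  entries are replaced by sections one slot at a time, each section being expanded with smooth
  coefficients.\<close>

lemma form_section_smooth:
  assumes \<omega>: "\<omega> \<in> \<Omega> E k" and s: "\<And>j. j < k \<Longrightarrow> s j \<in> \<Gamma> E"
  shows "(\<lambda>x. \<omega> x (\<lambda>j. s j x)) \<in> C\<infinity> (charts E)"
proof (rule CollectI, rule smooth_fun_locally[OF man])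
  fix x
  obtain V e where V: "(V, e) \<in> frames E" "x \<in> V" using ex_frame by blast
  have o: "open V" by (rule frame_open[OF V(1)])
  have "smooth_fun (charts E) V (\<lambda>x. \<omega> x (\<lambda>j. if j < m then s j x else e (I j) x))"
    if "m \<le> k" "\<And>j. j < k \<Longrightarrow> I j < rk E" for m I
    using that
  proof (induction m arbitrary: I)
    case 0
    then show ?case using forms_smooth[OF \<omega> V(1), of I] by simp
  next
    case (Suc m)
    have m: "m < k" using Suc.prems by simp
    obtain c where c: "\<forall>i<rk E. smooth_fun (charts E) (UNIV \<inter> V) (c i)"
      "\<forall>x\<in>UNIV \<inter> V. s m x = (\<Sum>i<rk E. c i x *\<^sub>R e i x)"
      using local_section_coeff[OF _ V(1), of UNIV "s m"] s[OF m] by blast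
    have "smooth_fun (charts E) V (\<lambda>x. \<Sum>i<rk E. c i x * \<omega> x (\<lambda>j. if j < m then s j x else e ((I(m := i)) j) x))"
    proof (intro smooth_fun_sum[OF man o] smooth_fun_mult[OF man o] finite_lessThan)
      fix i assume i: "i \<in> {..<rk E}"
      show "smooth_fun (charts E) V (c i)" using c(1) i by simp
      show "smooth_fun (charts E) V (\<lambda>x. \<omega> x (\<lambda>j. if j < m then s j x else e ((I(m := i)) j) x))"
        by (rule Suc.IH) (use Suc.prems i in auto)
    qed
    then show ?case
    proof (rule smooth_fun_cong[OF man o])
      fix x assume x: "x \<in> V"
      let ?v = "\<lambda>j. if j < m then s j x else e (I j) x"
      have b: "is_basis (fib E x) (rk E) (\<lambda>i. e i x)" by (rule frame_basis[OF V(1) x])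
      have v: "?v j \<in> fib E x" if "j < k" for j
        using section_in[OF s[OF that]] is_basis_in[OF b] Suc.prems(2)[OF that] by simp
      have "\<omega> x (?v(m := \<Sum>i<rk E. c i x *\<^sub>R e i x)) = (\<Sum>i<rk E. c i x * \<omega> x (?v(m := e i x)))"
        by (rule alt_form_sum[OF forms_alt[OF \<omega>] fib_subspace v m])
           (use is_basis_in[OF b] in auto)
      moreover have "?v(m := \<Sum>i<rk E. c i x *\<^sub>R e i x) = (\<lambda>j. if j < Suc m then s j x else e (I j) x)"
        using c(2) x by (auto simp: fun_eq_iff less_Suc_eq)
      moreover have "?v(m := e i x) = (\<lambda>j. if j < m then s j x else e ((I(m := i)) j) x)" for i
        by (auto simp: fun_eq_iff)
      ultimately show "(\<Sum>i<rk E. c i x * \<omega> x (\<lambda>j. if j < m then s j x else e ((I(m := i)) j) x)) =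
          \<omega> x (\<lambda>j. if j < Suc m then s j x else e (I j) x)" by simp
    qed
  qed
  note all = this[OF le_refl]
  have sm: "smooth_fun (charts E) V (\<lambda>x. \<omega> x (\<lambda>j. s j x))"
  \<comment> \<open>The expansion needs a tuple of frame indices to start from. In rank 0 there is
    none for k > 0, but then the form is 0.\<close>
  proof (cases "k = 0 \<or> rk E > 0")
    case True
    then have "smooth_fun (charts E) V (\<lambda>x. \<omega> x (\<lambda>j. if j < k then s j x else e ((\<lambda>_. 0) j) x))"
      by (intro all) auto
    then show ?thesis
      by (rule smooth_fun_cong[OF man o]) (intro alt_form_cong[OF forms_alt[OF \<omega>]], auto)
  next
    case False
    have "\<omega> x (\<lambda>j. s j x) = 0" if "x \<in> V" for x
      by (rule alt_form_eq_zero_basis[OF forms_alt[OF \<omega>] frame_basis[OF V(1) that]]) (use False in auto)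
    then show ?thesis
      by (intro smooth_fun_cong[OF man o smooth_fun_const[OF man o, of 0]]) auto
  qed
  then show "\<exists>N. open N \<and> x \<in> N \<and> smooth_fun (charts E) N (\<lambda>x. \<omega> x (\<lambda>j. s j x))"
    using o V(2) by blast
qed

text \<open>Every vector of a fibre is the value of a global section, and on vectors outside the
  fibre both forms are 0 by convention.\<close>

lemma forms_eqI:
  assumes "\<omega> \<in> \<Omega> E k" "\<eta> \<in> \<Omega> E k"
    "\<And>s x. (\<And>j. s j \<in> \<Gamma> E) \<Longrightarrow> \<omega> x (\<lambda>j. s j x) = \<eta> x (\<lambda>j. s j x)"
  shows "\<omega> = \<eta>"
proof (intro ext)
  fix x v
  have \<omega>: "alt_form k (fib E x) (\<omega> x)" and \<eta>: "alt_form k (fib E x) (\<eta> x)"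
    using forms_alt assms(1,2) by auto
  show "\<omega> x v = \<eta> x v"
  proof (cases "\<forall>j<k. v j \<in> fib E x")
    case True
    then have "\<forall>j. \<exists>s\<in>\<Gamma> E. j < k \<longrightarrow> s x = v j" using section_through section_zero by metis
    then obtain s where s: "\<And>j. s j \<in> \<Gamma> E" "\<And>j. j < k \<Longrightarrow> s j x = v j" by metis
    show ?thesis
      using assms(3)[of s x, OF s(1)] alt_form_cong[OF \<omega>, of "\<lambda>j. s j x" v] alt_form_cong[OF \<eta>, of "\<lambda>j. s j x" v] s(2)
      by simp
  next
    case False
    then show ?thesis using alt_form_outside[OF \<omega>] alt_form_outside[OF \<eta>] by metis
  qed
qed

end

section \<open>Forms as cochains\<close>

lemma sum_fun_apply: "(\<Sum>i\<in>I. f i) x = (\<Sum>i\<in>I. f i x)" for f :: "'i \<Rightarrow> 'x \<Rightarrow> 'r::comm_ring_1"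
  by (induction I rule: infinite_finite_induct) auto

lemma minus_one_power_apply: "((- 1) ^ n) x = ((- 1) ^ n :: 'r::comm_ring_1)" for x :: 'x
  by (induction n) auto

context lie_rinehart
begin

lemma Lie_degree:
  "(\<And>us. set us \<subseteq> S \<Longrightarrow> length us \<noteq> k \<Longrightarrow> \<eta> us = 0) \<Longrightarrow> u \<in> S \<Longrightarrow> set vs \<subseteq> S \<Longrightarrow>
    length vs \<noteq> k \<Longrightarrow> Lie u \<eta> vs = 0"
proof (induction vs arbitrary: k \<eta>)
  case Nil
  have "\<eta> [] = 0" by (rule Nil(1)) (use Nil in auto)
  then show "Lie u \<eta> [] = 0" using Nil by simp
next
  case (Cons v vs)
  have "\<eta> (br u v # vs) = 0" by (rule Cons.prems(1)) (use Cons.prems br_S in auto)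
  moreover have "Lie u (ins v \<eta>) vs = 0"
  \<comment> \<open>For k = 0 the contraction vanishes on lists of sections, but nothing is known
    elsewhere. \<open>Lie_cong\<close> bridges the difference to the zero cochain.\<close>
  proof (cases k)
    case 0
    have "Lie u (ins v \<eta>) vs = Lie u 0 vs"
    proof (rule Lie_cong)
      fix us assume "set us \<subseteq> S"
      then have "\<eta> (v # us) = 0" by (intro Cons.prems(1)) (use Cons.prems 0 in auto)
      then show "ins v \<eta> us = 0 us" by simp
    qed (use Cons.prems in auto)
    then show ?thesis using Cons.prems by (simp add: Lie_zero)
  next
    case (Suc k')
    show ?thesis
    proof (rule Cons.IH)
      fix us assume "set us \<subseteq> S" "length us \<noteq> k'"
      then show "ins v \<eta> us = 0" unfolding ins_apply by (intro Cons.prems(1)) (use Cons.prems Suc in auto)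
    qed (use Cons.prems Suc in auto)
  qed
  ultimately show "Lie u \<eta> (v # vs) = 0" by simp
qed

lemma D_degree:
  "(\<And>us. set us \<subseteq> S \<Longrightarrow> length us \<noteq> k \<Longrightarrow> \<eta> us = 0) \<Longrightarrow> set vs \<subseteq> S \<Longrightarrow>
    length vs \<noteq> Suc k \<Longrightarrow> D \<eta> vs = 0"
proof (induction vs arbitrary: k \<eta>)
  case (Cons v vs)
  have "Lie v \<eta> vs = 0" by (rule Lie_degree[OF Cons.prems(1)]) (use Cons.prems in auto)
  moreover have "D (ins v \<eta>) vs = 0"
  proof (cases k)
    case 0
    have "D (ins v \<eta>) vs = D 0 vs"
    proof (rule D_cong)
      fix us assume "set us \<subseteq> S"
      then have "\<eta> (v # us) = 0" by (intro Cons.prems(1)) (use Cons.prems 0 in auto)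
      then show "ins v \<eta> us = 0 us" by simp
    qed (use Cons.prems in auto)
    then show ?thesis using Cons.prems by (simp add: D_zero)
  next
    case (Suc k')
    show ?thesis
    proof (rule Cons.IH)
      fix us assume "set us \<subseteq> S" "length us \<noteq> k'"
      then show "ins v \<eta> us = 0" unfolding ins_apply by (intro Cons.prems(1)) (use Cons.prems Suc in auto)
    qed (use Cons.prems Suc in auto)
  qed
  ultimately show "D \<eta> (v # vs) = 0" by simp
qed simp

lemma shuffle_outside:
  "(\<And>us. \<not> set us \<subseteq> S \<Longrightarrow> \<omega> us = 0) \<Longrightarrow> (\<And>us. \<not> set us \<subseteq> S \<Longrightarrow> \<eta> us = 0) \<Longrightarrow>
    \<not> set vs \<subseteq> S \<Longrightarrow> shuffle \<omega> \<eta> vs = 0"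
proof (induction vs arbitrary: \<omega> \<eta>)
  case (Cons u vs)
  have \<omega>: "\<not> set us \<subseteq> S \<Longrightarrow> \<omega> us = 0" and \<eta>: "\<not> set us \<subseteq> S \<Longrightarrow> \<eta> us = 0" for us
    using Cons.prems(1,2) by blast+
  show "shuffle \<omega> \<eta> (u # vs) = 0"
  proof (cases "u \<in> S")
    case True
    have "shuffle (ins u \<omega>) \<eta> vs = 0"
      by (rule Cons.IH) (use \<omega> \<eta> Cons.prems(3) True in auto)
    moreover have "shuffle (bar \<omega>) (ins u \<eta>) vs = 0"
      by (rule Cons.IH) (use \<omega> \<eta> Cons.prems(3) True in \<open>auto simp: bar_def\<close>)
    ultimately show ?thesis by simp
  next
    case False
    then have "ins u \<omega> = 0" "ins u \<eta> = 0" using \<omega> \<eta> by (auto simp: ins_def fun_eq_iff)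
    then show ?thesis by simp
  qed
qed simp

text \<open>The axioms on derivation and bracket speak of sections only. Setting cochains to 0 on
  all other lists turns the identities of the calculus into equations of functions, with which one
  can rewrite; \<open>dd\<close> is \<open>D\<close> cut off in the same way.\<close>

definition supported :: "('m, 'a) cochain \<Rightarrow> bool" where
  "supported \<eta> \<longleftrightarrow> tensor \<eta> \<and> (\<forall>vs. \<not> set vs \<subseteq> S \<longrightarrow> \<eta> vs = 0)"

definition dd :: "('m, 'a) cochain \<Rightarrow> ('m, 'a) cochain" where
  "dd \<eta> = (\<lambda>vs. if set vs \<subseteq> S then D \<eta> vs else 0)"

lemma tensor_cong:
  assumes "tensor \<omega>" "\<And>vs. set vs \<subseteq> S \<Longrightarrow> \<omega> vs = \<eta> vs"
  shows "tensor \<eta>"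
  unfolding tensor_def
proof (intro conjI)
  show "val \<eta>" using assms by (simp add: tensor_def val_def)
  show "mlin \<eta>" unfolding mlin_def
  proof (intro allI ballI impI)
    fix xs ys u v f g
    assume *: "f \<in> C" "g \<in> C" "set xs \<subseteq> S \<and> set ys \<subseteq> S \<and> u \<in> S \<and> v \<in> S"
    then have "(\<lambda>x. f x *\<^sub>R u x + g x *\<^sub>R v x) \<in> S" by (intro S_lin) auto
    then show "\<eta> (xs @ (\<lambda>x. f x *\<^sub>R u x + g x *\<^sub>R v x) # ys) = f * \<eta> (xs @ u # ys) + g * \<eta> (xs @ v # ys)"
      using * mlinD[of \<omega> f g u v xs ys] assms(1) by (simp add: tensor_def flip: assms(2))
  qed
  show "asym \<eta>" unfolding asym_def
  proof (intro allI ballI impI)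
    fix xs ys u v
    assume *: "set xs \<subseteq> S \<and> set ys \<subseteq> S \<and> u \<in> S \<and> v \<in> S"
    then show "\<eta> (xs @ u # v # ys) = - \<eta> (xs @ v # u # ys)"
      using asymD[of \<omega> u v xs ys] assms(1) by (simp add: tensor_def flip: assms(2))
  qed
qed

lemma supportedD: "supported \<eta> \<Longrightarrow> tensor \<eta>" "supported \<eta> \<Longrightarrow> \<not> set vs \<subseteq> S \<Longrightarrow> \<eta> vs = 0"
  "supported \<eta> \<Longrightarrow> val \<eta>" "supported \<eta> \<Longrightarrow> mlin \<eta>"
  by (auto simp: supported_def tensor_def)

lemma supported_dd: "supported \<eta> \<Longrightarrow> supported (dd \<eta>)"
  using tensor_cong[OF tensor_D, of \<eta> "dd \<eta>"] by (simp add: supported_def dd_def)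

lemma supported_shuffle: "supported \<omega> \<Longrightarrow> supported \<eta> \<Longrightarrow> supported (shuffle \<omega> \<eta>)"
  using tensor_shuffle shuffle_outside unfolding supported_def by blast

lemma supported_bar: "supported \<omega> \<Longrightarrow> supported (bar \<omega>)"
  by (simp add: supported_def tensor_def val_bar mlin_bar asym_bar) (simp add: bar_def)

lemma mlin_arith: "mlin \<omega> \<Longrightarrow> mlin \<eta> \<Longrightarrow> mlin (\<omega> + \<eta>)" "mlin \<omega> \<Longrightarrow> mlin \<eta> \<Longrightarrow> mlin (\<omega> - \<eta>)"
  unfolding mlin_def by (simp_all add: algebra_simps)

lemma asym_arith:
  assumes "asym \<omega>" "asym \<eta>"
  shows "asym (\<omega> + \<eta>)" "asym (\<omega> - \<eta>)"
proof -
  have "(\<omega> + \<eta>) (xs @ u # v # ys) = - (\<omega> + \<eta>) (xs @ v # u # ys) \<and>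
      (\<omega> - \<eta>) (xs @ u # v # ys) = - (\<omega> - \<eta>) (xs @ v # u # ys)"
    if "set xs \<subseteq> S \<and> set ys \<subseteq> S \<and> u \<in> S \<and> v \<in> S" for xs ys u v
    using asymD[OF assms(1), of u v xs ys] asymD[OF assms(2), of u v xs ys] that by (simp add: fun_eq_iff)
  then show "asym (\<omega> + \<eta>)" "asym (\<omega> - \<eta>)" unfolding asym_def by blast+
qed

lemma supported_arith:
  "supported \<omega> \<Longrightarrow> supported \<eta> \<Longrightarrow> supported (\<omega> + \<eta>)"
  "supported \<omega> \<Longrightarrow> supported \<eta> \<Longrightarrow> supported (\<omega> - \<eta>)"
  by (simp_all add: supported_def tensor_def val_arith mlin_arith asym_arith)

lemma dd_add: "supported \<omega> \<Longrightarrow> supported \<eta> \<Longrightarrow> dd (\<omega> + \<eta>) = dd \<omega> + dd \<eta>"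
  by (rule ext) (simp add: dd_def D_add supportedD)

lemma dd_diff: "supported \<omega> \<Longrightarrow> supported \<eta> \<Longrightarrow> dd (\<omega> - \<eta>) = dd \<omega> - dd \<eta>"
  by (rule ext) (simp add: dd_def D_diff supportedD)

lemma dd_shuffle:
  assumes "supported \<omega>" "supported \<eta>"
  shows "dd (shuffle \<omega> \<eta>) = shuffle (dd \<omega>) \<eta> + shuffle (bar \<omega>) (dd \<eta>)"
proof
  fix vs
  note s = assms supported_dd[OF assms(1)] supported_dd[OF assms(2)] supported_bar[OF assms(1)]
  show "dd (shuffle \<omega> \<eta>) vs = (shuffle (dd \<omega>) \<eta> + shuffle (bar \<omega>) (dd \<eta>)) vs"
  proof (cases "set vs \<subseteq> S")
    case True
    have "shuffle (dd \<omega>) \<eta> vs = shuffle (D \<omega>) \<eta> vs" "shuffle (bar \<omega>) (dd \<eta>) vs = shuffle (bar \<omega>) (D \<eta>) vs"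
      by (rule shuffle_cong; use True in \<open>simp add: dd_def\<close>)+
    then show ?thesis using D_shuffle[of \<omega> \<eta> vs] True s by (simp add: dd_def supportedD)
  next
    case False
    then show ?thesis
      using supportedD(2)[OF supported_shuffle[OF s(3,2)]] supportedD(2)[OF supported_shuffle[OF s(5,4)]]
      by (simp add: dd_def)
  qed
qed

lemma dd_dd:
  assumes "supported \<eta>"
  shows "dd (dd \<eta>) = 0"
proof
  fix vs
  have "D (dd \<eta>) vs = D (D \<eta>) vs" if "set vs \<subseteq> S"
    by (rule D_cong) (use that in \<open>simp_all add: dd_def\<close>)
  then show "dd (dd \<eta>) vs = 0 vs" using D_D[of \<eta> vs] supportedD[OF assms] by (simp add: dd_def)
qed

end

section \<open>A Lie algebroid as a model of the abstract calculus\<close>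

locale algebroid_loc =
  fixes A :: "('m::{t2_space,second_countable_topology}, 'e::real_inner, 'a::real_vector, 'z) algebroid_scheme"
  assumes algebroid: "lie_algebroid A"

sublocale algebroid_loc \<subseteq> vbundle A
  by unfold_locales (use algebroid in \<open>simp add: lie_algebroid_def\<close>)

context algebroid_loc
begin

abbreviation "CC \<equiv> C\<infinity> (charts A)"

lemma anchor_facts: "anchor_map A" "lie_bracket A"
  using algebroid by (simp_all add: lie_algebroid_def)

lemma CC_const: "(\<lambda>x. c) \<in> CC" by (simp add: smooth_fun_const[OF man])

lemma CC_arith: "f \<in> CC \<Longrightarrow> g \<in> CC \<Longrightarrow> (\<lambda>x. f x + g x) \<in> CC" "f \<in> CC \<Longrightarrow> g \<in> CC \<Longrightarrow> (\<lambda>x. f x * g x) \<in> CC"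
  by (simp_all add: smooth_fun_add[OF man] smooth_fun_mult[OF man])

lemma anchor_tangent: "v \<in> fib A x \<Longrightarrow> tangent_vector (charts A) x (anchor A x v)"
  using anchor_facts(1) by (simp add: anchor_map_def)

lemma anchor_linear:
  "v \<in> fib A x \<Longrightarrow> w \<in> fib A x \<Longrightarrow> f \<in> CC \<Longrightarrow>
    anchor A x (a *\<^sub>R v + b *\<^sub>R w) f = a * anchor A x v f + b * anchor A x w f"
  using anchor_facts(1) by (simp add: anchor_map_def)

lemma tangent_lin: "tangent_vector (charts A) x X \<Longrightarrow> f \<in> CC \<Longrightarrow> g \<in> CC \<Longrightarrow>
    X (\<lambda>y. a * f y + b * g y) = a * X f + b * X g"
  by (simp add: tangent_vector_def)

lemma tangent_mult: "tangent_vector (charts A) x X \<Longrightarrow> f \<in> CC \<Longrightarrow> g \<in> CC \<Longrightarrow>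
    X (\<lambda>y. f y * g y) = f x * X g + g x * X f"
  by (simp add: tangent_vector_def)

lemma tangent_const:
  assumes "tangent_vector (charts A) x X"
  shows "X (\<lambda>y. c) = 0"
proof -
  have "X (\<lambda>y. 1) = 0" using tangent_mult[OF assms CC_const[of 1] CC_const[of 1]] by simp
  then show ?thesis using tangent_lin[OF assms CC_const[of 1] CC_const[of 1], of c 0] by simp
qed

lemma lie_derivative_smooth: "v \<in> \<Gamma> A \<Longrightarrow> f \<in> CC \<Longrightarrow> lie_derivative A v f \<in> CC"
  using anchor_facts(1) unfolding anchor_map_def by blast

lemma bracket_section: "u \<in> \<Gamma> A \<Longrightarrow> v \<in> \<Gamma> A \<Longrightarrow> bracket A u v \<in> \<Gamma> A"
  using anchor_facts(2) unfolding lie_bracket_def by blast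

lemma bracket_lin_left: "u \<in> \<Gamma> A \<Longrightarrow> v \<in> \<Gamma> A \<Longrightarrow> w \<in> \<Gamma> A \<Longrightarrow>
    bracket A (\<lambda>x. a *\<^sub>R u x + b *\<^sub>R v x) w = (\<lambda>x. a *\<^sub>R bracket A u w x + b *\<^sub>R bracket A v w x)"
  using anchor_facts(2) unfolding lie_bracket_def by blast

lemma bracket_lin_right: "u \<in> \<Gamma> A \<Longrightarrow> v \<in> \<Gamma> A \<Longrightarrow> w \<in> \<Gamma> A \<Longrightarrow>
    bracket A w (\<lambda>x. a *\<^sub>R u x + b *\<^sub>R v x) = (\<lambda>x. a *\<^sub>R bracket A w u x + b *\<^sub>R bracket A w v x)"
  using anchor_facts(2) unfolding lie_bracket_def by blast

lemma bracket_self: "u \<in> \<Gamma> A \<Longrightarrow> bracket A u u = (\<lambda>x. 0)"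
  using anchor_facts(2) unfolding lie_bracket_def by blast

lemma jacobi: "u \<in> \<Gamma> A \<Longrightarrow> v \<in> \<Gamma> A \<Longrightarrow> w \<in> \<Gamma> A \<Longrightarrow>
    bracket A u (bracket A v w) x + bracket A v (bracket A w u) x + bracket A w (bracket A u v) x = 0"
  using anchor_facts(2) unfolding lie_bracket_def by blast

lemma bracket_leibniz: "v \<in> \<Gamma> A \<Longrightarrow> w \<in> \<Gamma> A \<Longrightarrow> f \<in> CC \<Longrightarrow>
    bracket A v (\<lambda>x. f x *\<^sub>R w x) = (\<lambda>x. f x *\<^sub>R bracket A v w x + lie_derivative A v f x *\<^sub>R w x)"
  using algebroid unfolding lie_algebroid_def by blast

lemma bracket_antisym:
  assumes "u \<in> \<Gamma> A" "v \<in> \<Gamma> A"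
  shows "bracket A v u = (\<lambda>x. - bracket A u v x)"
proof -
  let ?s = "\<lambda>x. 1 *\<^sub>R u x + 1 *\<^sub>R v x"
  have s: "?s \<in> \<Gamma> A" by (rule section_lin[OF assms CC_const CC_const])
  have "bracket A ?s ?s = (\<lambda>x. 1 *\<^sub>R bracket A u ?s x + 1 *\<^sub>R bracket A v ?s x)"
    by (rule bracket_lin_left[OF assms s])
  also have "\<dots> = (\<lambda>x. bracket A u v x + bracket A v u x)"
    unfolding bracket_lin_right[OF assms assms(1)] bracket_lin_right[OF assms assms(2)]
      bracket_self[OF assms(1)] bracket_self[OF assms(2)] by simp
  finally have "(\<lambda>x. bracket A u v x + bracket A v u x) = (\<lambda>x. 0)" using bracket_self[OF s] by simp
  then have "bracket A u v x + bracket A v u x = 0" for x by (rule fun_cong)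
  then show ?thesis by (intro ext) (simp add: eq_neg_iff_add_eq_0 add.commute)
qed

lemma section_scale: "f \<in> CC \<Longrightarrow> w \<in> \<Gamma> A \<Longrightarrow> (\<lambda>x. f x *\<^sub>R w x) \<in> \<Gamma> A"
  using section_lin[of w w f "\<lambda>x. 0"] CC_const[of 0] by simp

lemma bracket_minus_right: "u \<in> \<Gamma> A \<Longrightarrow> v \<in> \<Gamma> A \<Longrightarrow> bracket A v (\<lambda>x. - u x) = (\<lambda>x. - bracket A v u x)"
  using bracket_lin_right[of u u v "- 1" 0] by simp

lemma bracket_jacobi:
  assumes "u \<in> \<Gamma> A" "v \<in> \<Gamma> A" "w \<in> \<Gamma> A"
  shows "bracket A u (bracket A v w) = (\<lambda>x. bracket A (bracket A u v) w x + bracket A v (bracket A u w) x)"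
proof
  fix x
  note b = bracket_section
  have "bracket A v (bracket A w u) = (\<lambda>x. - bracket A v (bracket A u w) x)"
    unfolding bracket_antisym[OF assms(1,3)] by (rule bracket_minus_right) (use assms b in auto)
  moreover have "bracket A w (bracket A u v) = (\<lambda>x. - bracket A (bracket A u v) w x)"
    by (rule bracket_antisym) (use assms b in auto)
  ultimately show "bracket A u (bracket A v w) x = bracket A (bracket A u v) w x + bracket A v (bracket A u w) x"
    using jacobi[OF assms, of x] by (simp add: algebra_simps)
qed

lemma bracket_lin:
  assumes "f \<in> CC" "g \<in> CC" "u \<in> \<Gamma> A" "v \<in> \<Gamma> A" "w \<in> \<Gamma> A"
  shows "bracket A w (\<lambda>x. f x *\<^sub>R u x + g x *\<^sub>R v x) =
    (\<lambda>x. (f x *\<^sub>R bracket A w u x + lie_derivative A w f x *\<^sub>R u x)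
       + (g x *\<^sub>R bracket A w v x + lie_derivative A w g x *\<^sub>R v x))"
  using bracket_lin_right[OF section_scale[OF assms(1,3)] section_scale[OF assms(2,4)] assms(5), of 1 1]
  unfolding bracket_leibniz[OF assms(5,3,1)] bracket_leibniz[OF assms(5,4,2)] by simp

text \<open>The anchor respects brackets as a consequence of the other axioms: expand the Jacobi
  identity for u, v and f w by the Leibniz rule and compare the coefficients of w at x. This
  requires some section w with w x nonzero. If there is none, all sections vanish at x, and with
  them all derivatives along the anchor at x.\<close>

lemma lie_derivative_bracket:
  assumes "u \<in> \<Gamma> A" "v \<in> \<Gamma> A" "f \<in> CC"
  shows "lie_derivative A (bracket A u v) f x =
    lie_derivative A u (lie_derivative A v f) x - lie_derivative A v (lie_derivative A u f) x"
proof (cases "\<exists>w\<in>\<Gamma> A. w x \<noteq> 0")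
  case True
  then obtain w where w: "w \<in> \<Gamma> A" "w x \<noteq> 0" by blast
  let ?L = "lie_derivative A" and ?b = "bracket A"
  note b = bracket_section and L = lie_derivative_smooth
  have 1: "?b a (?b c (\<lambda>x. f x *\<^sub>R w x)) x = f x *\<^sub>R ?b a (?b c w) x + ?L a f x *\<^sub>R ?b c w x
      + ?L c f x *\<^sub>R ?b a w x + ?L a (?L c f) x *\<^sub>R w x" if "a \<in> \<Gamma> A" "c \<in> \<Gamma> A" for a c
    unfolding bracket_leibniz[OF that(2) w(1) assms(3)]
      bracket_lin[OF assms(3) L[OF that(2) assms(3)] b[OF that(2) w(1)] w(1) that(1)]
    by (simp add: algebra_simps)
  have fw: "(\<lambda>x. f x *\<^sub>R w x) \<in> \<Gamma> A" by (rule section_scale[OF assms(3) w(1)])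
  have "?b (?b u v) (\<lambda>x. f x *\<^sub>R w x) x = f x *\<^sub>R ?b (?b u v) w x + ?L (?b u v) f x *\<^sub>R w x"
    unfolding bracket_leibniz[OF b[OF assms(1,2)] w(1) assms(3)] by simp
  moreover have "?b u (?b v (\<lambda>x. f x *\<^sub>R w x)) x = ?b (?b u v) (\<lambda>x. f x *\<^sub>R w x) x + ?b v (?b u (\<lambda>x. f x *\<^sub>R w x)) x"
    using bracket_jacobi[OF assms(1,2) fw] by simp
  moreover have "?b u (?b v w) x = ?b (?b u v) w x + ?b v (?b u w) x"
    using bracket_jacobi[OF assms(1,2) w(1)] by simp
  ultimately have "(?L u (?L v f) x - ?L v (?L u f) x - ?L (?b u v) f x) *\<^sub>R w x = 0"
    using 1[OF assms(1,2)] 1[OF assms(2,1)] by (simp add: algebra_simps)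
  then show ?thesis using w(2) by simp
next
  case False
  have "lie_derivative A w g x = 0" if "w \<in> \<Gamma> A" "g \<in> CC" for w g
  proof -
    have "w x = 0" using False that by blast
    then show ?thesis
      using anchor_linear[OF subspace_0[OF fib_subspace] subspace_0[OF fib_subspace] that(2), of x 0 0]
      by (simp add: lie_derivative_def)
  qed
  from this[OF bracket_section[OF assms(1,2)] assms(3)]
    this[OF assms(1) lie_derivative_smooth[OF assms(2,3)]]
    this[OF assms(2) lie_derivative_smooth[OF assms(1,3)]]
  show ?thesis by simp
qed

end

sublocale algebroid_loc \<subseteq> lie_rinehart "C\<infinity> (charts A)" "\<Gamma> A" "lie_derivative A" "bracket A"
proof unfold_locales
  fix u v w :: "'m \<Rightarrow> 'a" and f g h :: "'m \<Rightarrow> real" and c :: real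
  show "(\<lambda>x. c) \<in> CC" by (rule CC_const)
  show "f + g \<in> CC" "f * g \<in> CC" if "f \<in> CC" "g \<in> CC"
    using CC_arith[OF that] by (simp_all add: plus_fun_def times_fun_def)
  show "\<Gamma> A \<noteq> {}" using section_zero by blast
  show "(\<lambda>x. f x *\<^sub>R u x + g x *\<^sub>R v x) \<in> \<Gamma> A" if "f \<in> CC" "g \<in> CC" "u \<in> \<Gamma> A" "v \<in> \<Gamma> A"
    using section_lin that by blast
  show "lie_derivative A u f \<in> CC" if "u \<in> \<Gamma> A" "f \<in> CC" using lie_derivative_smooth that .
  show "lie_derivative A u (f + g) = lie_derivative A u f + lie_derivative A u g"
    if "u \<in> \<Gamma> A" "f \<in> CC" "g \<in> CC"
    using tangent_lin[OF anchor_tangent[OF section_in[OF that(1)]] that(2,3), of _ 1 1]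
    by (simp add: lie_derivative_def plus_fun_def)
  show "lie_derivative A u (f * g) = f * lie_derivative A u g + g * lie_derivative A u f"
    if "u \<in> \<Gamma> A" "f \<in> CC" "g \<in> CC"
    using tangent_mult[OF anchor_tangent[OF section_in[OF that(1)]] that(2,3)]
    by (simp add: lie_derivative_def plus_fun_def times_fun_def)
  show "lie_derivative A u (\<lambda>x. c) = 0" if "u \<in> \<Gamma> A"
    using tangent_const[OF anchor_tangent[OF section_in[OF that]]]
    by (simp add: lie_derivative_def zero_fun_def)
  show "lie_derivative A (\<lambda>x. f x *\<^sub>R u x + g x *\<^sub>R v x) h = f * lie_derivative A u h + g * lie_derivative A v h"
    if "f \<in> CC" "g \<in> CC" "u \<in> \<Gamma> A" "v \<in> \<Gamma> A" "h \<in> CC"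
    using anchor_linear[OF section_in[OF that(3)] section_in[OF that(4)] that(5)]
    by (simp add: lie_derivative_def plus_fun_def times_fun_def)
  show "bracket A u v \<in> \<Gamma> A" if "u \<in> \<Gamma> A" "v \<in> \<Gamma> A" using bracket_section that .
  show "bracket A v u = (\<lambda>x. - bracket A u v x)" if "u \<in> \<Gamma> A" "v \<in> \<Gamma> A" using bracket_antisym that .
  show "bracket A w (\<lambda>x. f x *\<^sub>R u x + g x *\<^sub>R v x) =
    (\<lambda>x. (f x *\<^sub>R bracket A w u x + lie_derivative A w f x *\<^sub>R u x)
       + (g x *\<^sub>R bracket A w v x + lie_derivative A w g x *\<^sub>R v x))"
    if "f \<in> CC" "g \<in> CC" "u \<in> \<Gamma> A" "v \<in> \<Gamma> A" "w \<in> \<Gamma> A" using bracket_lin that .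
  show "bracket A u (bracket A v w) = (\<lambda>x. bracket A (bracket A u v) w x + bracket A v (bracket A u w) x)"
    if "u \<in> \<Gamma> A" "v \<in> \<Gamma> A" "w \<in> \<Gamma> A" using bracket_jacobi that .
  show "lie_derivative A (bracket A u v) f = lie_derivative A u (lie_derivative A v f) - lie_derivative A v (lie_derivative A u f)"
    if "u \<in> \<Gamma> A" "v \<in> \<Gamma> A" "f \<in> CC"
    using lie_derivative_bracket[OF that] by (simp add: fun_eq_iff)
qed

text \<open>Serves to divide out the bump factor: replacing a local frame by its cut-off version
  multiplies each argument at x by the same number.\<close>

lemma alt_form_scale_all:
  assumes "alt_form k V \<omega>" "subspace V" "\<And>j. j < k \<Longrightarrow> v j \<in> V"
  shows "\<omega> (\<lambda>j. c *\<^sub>R v j) = c ^ k * \<omega> v"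
proof -
  have "\<omega> (\<lambda>j. if j < m then c *\<^sub>R v j else v j) = c ^ m * \<omega> v" if "m \<le> k" for m
    using that
  proof (induction m)
    case (Suc m)
    let ?w = "\<lambda>j. if j < m then c *\<^sub>R v j else v j"
    have w: "?w j \<in> V" if "j < k" for j using assms(2,3) that by (simp add: subspace_scale)
    have m: "m < k" using Suc by simp
    have "\<omega> (?w(m := c *\<^sub>R v m + 0 *\<^sub>R v m)) = c * \<omega> (?w(m := v m)) + 0 * \<omega> (?w(m := v m))"
      by (rule alt_form_linear[where v="?w", OF assms(1) w m]) (use assms(3) m in auto)
    moreover have "?w(m := c *\<^sub>R v m + 0 *\<^sub>R v m) = (\<lambda>j. if j < Suc m then c *\<^sub>R v j else v j)"
      by (auto simp: fun_eq_iff less_Suc_eq)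
    moreover have "?w(m := v m) = ?w" by (auto simp: fun_eq_iff)
    ultimately show ?case using Suc by simp
  qed simp
  from this[of k] have "\<omega> (\<lambda>j. if j < k then c *\<^sub>R v j else v j) = c ^ k * \<omega> v" by simp
  moreover have "\<omega> (\<lambda>j. c *\<^sub>R v j) = \<omega> (\<lambda>j. if j < k then c *\<^sub>R v j else v j)"
    by (rule alt_form_cong[OF assms(1)]) simp
  ultimately show ?thesis by simp
qed

context lie_rinehart
begin

lemma mlin_sum:
  fixes n :: nat
  assumes "mlin \<eta>" "\<And>i. i < n \<Longrightarrow> f i \<in> C" "\<And>i. i < n \<Longrightarrow> w i \<in> S" "set xs \<subseteq> S" "set ys \<subseteq> S"
  shows "(\<lambda>x. \<Sum>i<n. f i x *\<^sub>R w i x) \<in> S \<and>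
    \<eta> (xs @ (\<lambda>x. \<Sum>i<n. f i x *\<^sub>R w i x) # ys) = (\<Sum>i<n. f i * \<eta> (xs @ w i # ys))"
  using assms(2,3)
proof (induction n)
  case 0
  have "\<eta> (xs @ (\<lambda>x. 0 x *\<^sub>R 0 + 0 x *\<^sub>R 0) # ys) = 0 * \<eta> (xs @ (\<lambda>x. 0) # ys) + 0 * \<eta> (xs @ (\<lambda>x. 0) # ys)"
    using mlinD[OF assms(1) C_zero C_zero S_zero S_zero assms(4,5)] .
  then show ?case using S_zero by simp
next
  case (Suc n)
  let ?s = "\<lambda>x. \<Sum>i<n. f i x *\<^sub>R w i x"
  have "?s \<in> S \<and> \<eta> (xs @ ?s # ys) = (\<Sum>i<n. f i * \<eta> (xs @ w i # ys))"
    by (rule Suc.IH) (use Suc.prems in simp_all)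
  then have IH: "?s \<in> S" "\<eta> (xs @ ?s # ys) = (\<Sum>i<n. f i * \<eta> (xs @ w i # ys))"
    by (rule conjunct1, rule conjunct2)
  have n: "f n \<in> C" "w n \<in> S" using Suc.prems by auto
  have eq: "(\<lambda>x. 1 x *\<^sub>R ?s x + f n x *\<^sub>R w n x) = (\<lambda>x. \<Sum>i<Suc n. f i x *\<^sub>R w i x)" by simp
  have "\<eta> (xs @ (\<lambda>x. \<Sum>i<Suc n. f i x *\<^sub>R w i x) # ys) = 1 * \<eta> (xs @ ?s # ys) + f n * \<eta> (xs @ w n # ys)"
    using mlinD[OF assms(1) C_one n(1) IH(1) n(2) assms(4,5)] unfolding eq .
  also have "\<dots> = (\<Sum>i<Suc n. f i * \<eta> (xs @ w i # ys))"
    by (simp only: IH(2) mult_1 sum.lessThan_Suc)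
  finally show ?case using S_lin[OF C_one n(1) IH(1) n(2)] unfolding eq by (intro conjI)
qed

lemma asym_eq_zero:
  assumes "asym \<eta>" "set vs \<subseteq> S" "i < j" "j < length vs" "vs ! i = vs ! j"
  shows "\<eta> vs = 0"
proof -
  define xs where "xs = take i vs"
  define zs where "zs = take (j - Suc i) (drop (Suc i) vs)"
  define ys where "ys = drop (Suc j) vs"
  have "drop (Suc i) vs = zs @ drop (Suc i) vs ! (j - Suc i) # drop (Suc (j - Suc i)) (drop (Suc i) vs)"
    unfolding zs_def by (rule id_take_nth_drop) (use assms in auto)
  then have "drop (Suc i) vs = zs @ vs ! j # ys" using assms by (simp add: ys_def)
  then have vs: "vs = xs @ vs ! i # zs @ vs ! j # ys"
    using id_take_nth_drop[of i vs] assms by (simp add: xs_def)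
  have "set (xs @ vs ! i # zs @ vs ! j # ys) \<subseteq> S" using assms(2) vs by simp
  then have S: "set xs \<subseteq> S" "set zs \<subseteq> S" "set ys \<subseteq> S" "vs ! i \<in> S" by auto
  have "\<eta> vs = \<eta> (xs @ vs ! i # zs @ (vs ! i # ys))" by (subst vs) (simp add: assms(5))
  also have "\<dots> = (- 1) ^ length zs * \<eta> (xs @ zs @ vs ! i # vs ! i # ys)"
    by (rule asym_move[OF assms(1)]) (use S in auto)
  also have "\<eta> (xs @ zs @ vs ! i # vs ! i # ys) = 0"
  proof
    fix x
    have "\<eta> ((xs @ zs) @ vs ! i # vs ! i # ys) = - \<eta> ((xs @ zs) @ vs ! i # vs ! i # ys)"
      by (rule asymD[OF assms(1)]) (use S in auto)
    from fun_cong[OF this, of x] show "\<eta> (xs @ zs @ vs ! i # vs ! i # ys) x = 0 x" by simp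
  qed
  finally show ?thesis by (simp only: mult_zero_right)
qed

end

section \<open>From tensorial cochains to forms and back\<close>

context algebroid_loc
begin

text \<open>Multiplying s by \<theta>^2 does not change the value at x and gives a global
  combination of sections whose coefficients vanish at x.\<close>

lemma tensor_pointwise_zero:
  assumes "tensor \<eta>" "set xs \<subseteq> \<Gamma> A" "set ys \<subseteq> \<Gamma> A" "s \<in> \<Gamma> A" "s x = 0"
  shows "\<eta> (xs @ s # ys) x = 0"
proof -
  have ml: "mlin \<eta>" using assms(1) by (simp add: tensor_def)
  obtain \<theta> f w where *: "\<theta> \<in> CC" "\<theta> x = 1" "\<forall>i<rk A. f i \<in> CC \<and> f i x = 0 \<and> w i \<in> \<Gamma> A"
    "\<forall>y. (\<theta> y * \<theta> y) *\<^sub>R s y = (\<Sum>i<rk A. f i y *\<^sub>R w i y)"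
    using section_vanish_decompose[OF assms(4,5)] by blast
  then have d: "\<theta> \<in> CC" "\<theta> x = 1" "\<And>i. i < rk A \<Longrightarrow> f i \<in> CC" "\<And>i. i < rk A \<Longrightarrow> f i x = 0"
    "\<And>i. i < rk A \<Longrightarrow> w i \<in> \<Gamma> A" "\<And>y. (\<theta> y * \<theta> y) *\<^sub>R s y = (\<Sum>i<rk A. f i y *\<^sub>R w i y)" by blast+
  have \<theta>: "(\<lambda>y. \<theta> y * \<theta> y) \<in> CC" by (rule CC_arith(2)[OF d(1,1)])
  have "\<eta> (xs @ (\<lambda>y. (\<theta> y * \<theta> y) *\<^sub>R s y + 0 y *\<^sub>R s y) # ys) =
      (\<lambda>y. \<theta> y * \<theta> y) * \<eta> (xs @ s # ys) + 0 * \<eta> (xs @ s # ys)"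
    by (rule mlinD[OF ml \<theta> C_zero assms(4,4,2,3)])
  moreover have "(\<lambda>y. (\<theta> y * \<theta> y) *\<^sub>R s y + 0 y *\<^sub>R s y) = (\<lambda>y. \<Sum>i<rk A. f i y *\<^sub>R w i y)"
    using d(6) by simp
  moreover have "\<eta> (xs @ (\<lambda>y. \<Sum>i<rk A. f i y *\<^sub>R w i y) # ys) = (\<Sum>i<rk A. f i * \<eta> (xs @ w i # ys))"
    using mlin_sum[where f=f and w=w and n="rk A", OF ml d(3) d(5) assms(2,3)] by blast
  ultimately have "((\<lambda>y. \<theta> y * \<theta> y) * \<eta> (xs @ s # ys) + 0 * \<eta> (xs @ s # ys)) x
      = (\<Sum>i<rk A. f i * \<eta> (xs @ w i # ys)) x" by simp
  then show ?thesis using d(2,4) by (simp add: sum_fun_apply)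
qed

text \<open>The arguments are exchanged one after the other, since the difference of two sections
  with the same value at x vanishes there. The list xs collects those already exchanged.\<close>

lemma tensor_pointwise:
  assumes "tensor \<eta>"
  shows "set xs \<subseteq> \<Gamma> A \<Longrightarrow> set us \<subseteq> \<Gamma> A \<Longrightarrow> set vs \<subseteq> \<Gamma> A \<Longrightarrow>
    map (\<lambda>s. s x) us = map (\<lambda>s. s x) vs \<Longrightarrow> \<eta> (xs @ us) x = \<eta> (xs @ vs) x"
proof (induction us arbitrary: xs vs)
  case (Cons u us)
  then obtain v vs' where vs: "vs = v # vs'" "u x = v x" "map (\<lambda>s. s x) us = map (\<lambda>s. s x) vs'" by auto
  have S: "u \<in> \<Gamma> A" "v \<in> \<Gamma> A" "set us \<subseteq> \<Gamma> A" "set vs' \<subseteq> \<Gamma> A" using Cons.prems vs by auto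
  have ml: "mlin \<eta>" using assms by (simp add: tensor_def)
  let ?w = "\<lambda>y. 1 y *\<^sub>R u y + (- 1) y *\<^sub>R v y"
  have m1: "(- 1 :: 'm \<Rightarrow> real) \<in> CC" by (rule C_minus[OF C_one])
  have "\<eta> (xs @ ?w # us) = 1 * \<eta> (xs @ u # us) + (- 1) * \<eta> (xs @ v # us)"
    by (rule mlinD[OF ml C_one m1 S(1,2) Cons.prems(1) S(3)])
  moreover have "\<eta> (xs @ ?w # us) x = 0"
    by (rule tensor_pointwise_zero[OF assms Cons.prems(1) S(3)])
       (use S_lin[OF C_one m1 S(1,2)] vs(2) in auto)
  ultimately have "\<eta> (xs @ u # us) x = \<eta> (xs @ v # us) x" by simp
  also have "\<dots> = \<eta> ((xs @ [v]) @ vs') x"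
    using Cons.IH[of "xs @ [v]" vs'] Cons.prems(1) S vs(3) by simp
  finally show ?case using vs(1) by simp
qed simp

text \<open>Vectors are extended to global sections in order to evaluate \<eta>, and tensoriality
  makes the result independent of the extensions. Smoothness on a local frame is seen from cut-off
  frames, for which the values of \<eta> are smooth.\<close>

theorem ex_form:
  assumes "tensor \<eta>"
  shows "\<exists>\<omega>\<in>\<Omega> A n. \<forall>s x. (\<forall>i<n. s i \<in> \<Gamma> A) \<longrightarrow> \<omega> x (\<lambda>i. s i x) = \<eta> (map s [0..<n]) x"
proof -
  define ext where "ext x a = (SOME s. s \<in> \<Gamma> A \<and> s x = a)" for x a
  have ext: "ext x a \<in> \<Gamma> A" "ext x a x = a" if "a \<in> fib A x" for x a
  proof -
    have "\<exists>s. s \<in> \<Gamma> A \<and> s x = a" using section_through[OF that] by blast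
    from someI_ex[OF this] show "ext x a \<in> \<Gamma> A" "ext x a x = a" by (simp_all add: ext_def)
  qed
  define \<omega> where "\<omega> x v = (if \<forall>i<n. v i \<in> fib A x then \<eta> (map (\<lambda>i. ext x (v i)) [0..<n]) x else 0)" for x v
  \<comment> \<open>Any sections with the right values at x may stand in for the chosen
    extensions.\<close>
  have key: "\<omega> x v = \<eta> vs x" if "set vs \<subseteq> \<Gamma> A" "length vs = n" "\<And>i. i < n \<Longrightarrow> (vs ! i) x = v i" for x v vs
  proof -
    have fib: "v i \<in> fib A x" if "i < n" for i
      using section_in[of "vs ! i" x] that \<open>set vs \<subseteq> \<Gamma> A\<close> \<open>length vs = n\<close> \<open>\<And>i. i < n \<Longrightarrow> (vs ! i) x = v i\<close>
      by (metis nth_mem subsetD)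
    have "\<eta> ([] @ map (\<lambda>i. ext x (v i)) [0..<n]) x = \<eta> ([] @ vs) x"
    proof (rule tensor_pointwise[OF assms])
      show "set (map (\<lambda>i. ext x (v i)) [0..<n]) \<subseteq> \<Gamma> A" using ext(1) fib by auto
      show "map (\<lambda>s. s x) (map (\<lambda>i. ext x (v i)) [0..<n]) = map (\<lambda>s. s x) vs"
        using that(2,3) ext(2) fib by (intro nth_equalityI) auto
    qed (use that in auto)
    then show ?thesis using fib by (simp add: \<omega>_def)
  qed
  have val: "\<omega> x (\<lambda>i. s i x) = \<eta> (map s [0..<n]) x" if "\<And>i. i < n \<Longrightarrow> s i \<in> \<Gamma> A" for s x
    by (rule key) (use that in auto)
  have alt: "alt_form n (fib A x) (\<omega> x)" for x
    unfolding alt_form_def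
  proof (intro conjI allI impI ballI)
    fix v i a b p q
    assume v: "(\<forall>j<n. v j \<in> fib A x) \<and> i < n" and pq: "p \<in> fib A x" "q \<in> fib A x"
    define L where "L = map (\<lambda>i. ext x (v i)) [0..<n]"
    have L: "set L \<subseteq> \<Gamma> A" "length L = n" "\<And>j. j < n \<Longrightarrow> (L ! j) x = v j"
      using ext v by (auto simp: L_def)
    have upd: "\<omega> x (v(i := c x)) = \<eta> (take i L @ c # drop (Suc i) L) x" if "c \<in> \<Gamma> A" for c
    proof -
      have "\<omega> x (v(i := c x)) = \<eta> (L[i := c]) x"
      proof (rule key)
        show "set (L[i := c]) \<subseteq> \<Gamma> A" using set_update_subset_insert[of L i c] L(1) that by blast
      qed (use L v in \<open>auto simp: nth_list_update\<close>)
      then show ?thesis using v L(2) by (simp add: upd_conv_take_nth_drop)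
    qed
    let ?c = "\<lambda>y. (\<lambda>_. a) y *\<^sub>R ext x p y + (\<lambda>_. b) y *\<^sub>R ext x q y"
    have c: "?c \<in> \<Gamma> A" by (rule S_lin[OF C_const C_const ext(1)[OF pq(1)] ext(1)[OF pq(2)]])
    have "\<eta> (take i L @ ?c # drop (Suc i) L) =
        (\<lambda>_. a) * \<eta> (take i L @ ext x p # drop (Suc i) L) + (\<lambda>_. b) * \<eta> (take i L @ ext x q # drop (Suc i) L)"
      by (rule mlinD[OF _ C_const C_const ext(1)[OF pq(1)] ext(1)[OF pq(2)]])
         (use assms L(1) set_take_subset[of i L] set_drop_subset[of "Suc i" L] in \<open>auto simp: tensor_def\<close>)
    from fun_cong[OF this, of x]
    show "\<omega> x (v(i := a *\<^sub>R p + b *\<^sub>R q)) = a * \<omega> x (v(i := p)) + b * \<omega> x (v(i := q))"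
      using upd[OF c] upd[OF ext(1)[OF pq(1)]] upd[OF ext(1)[OF pq(2)]] ext(2)[OF pq(1)] ext(2)[OF pq(2)]
      by simp
  next
    fix v i j
    assume v: "(\<forall>j<n. v j \<in> fib A x) \<and> i < n \<and> j < n \<and> i \<noteq> j \<and> v i = v j"
    define L where "L = map (\<lambda>i. ext x (v i)) [0..<n]"
    have L: "set L \<subseteq> \<Gamma> A" using ext v by (auto simp: L_def)
    have as: "asym \<eta>" using assms by (simp add: tensor_def)
    have "\<eta> L = 0"
    proof (cases "i < j")
      case True
      then show ?thesis using v by (intro asym_eq_zero[OF as L, of i j]) (auto simp: L_def)
    next
      case False
      then show ?thesis using v by (intro asym_eq_zero[OF as L, of j i]) (auto simp: L_def)
    qed
    then show "\<omega> x v = 0" using v by (simp add: \<omega>_def L_def)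
  next
    fix v w :: "nat \<Rightarrow> 'a" assume "\<forall>j<n. v j = w j"
    then have m: "map (\<lambda>i. ext x (v i)) [0..<n] = map (\<lambda>i. ext x (w i)) [0..<n]"
      and c: "(\<forall>i<n. v i \<in> fib A x) \<longleftrightarrow> (\<forall>i<n. w i \<in> fib A x)" by auto
    show "\<omega> x v = \<omega> x w" unfolding \<omega>_def m c ..
  next
    fix v assume "\<exists>j<n. v j \<notin> fib A x"
    then show "\<omega> x v = 0" by (auto simp: \<omega>_def)
  qed
  have smooth: "smooth_fun (charts A) (UNIV \<inter> V) (\<lambda>x. \<omega> x (\<lambda>j. e (I j) x))"
    if V: "(V, e) \<in> frames A" and I: "\<And>j. j < n \<Longrightarrow> I j < rk A" for V e I
  proof (rule smooth_fun_locally[OF man])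
    fix x0 assume "x0 \<in> UNIV \<inter> V"
    then have x0: "x0 \<in> V" by simp
    have o: "open V" by (rule frame_open[OF V])
    obtain \<theta> where \<theta>: "bump (charts A) V \<theta>" "\<theta> x0 = 1" using ex_bump[OF man o x0] .
    define s where "s j = (\<lambda>x. if x \<in> V then \<theta> x *\<^sub>R e (I j) x else 0)" for j
    have s: "s j \<in> \<Gamma> A" if "j < n" for j
      unfolding s_def by (rule local_section_bump[OF \<theta>(1) o frame_section[OF V I[OF that]]])
    \<comment> \<open>On N the n factors \<theta>(x) that the cut-off frame brings in can be divided
      out again.\<close>
    define N where "N = V \<inter> {x. \<theta> x \<noteq> 0}"
    have \<theta>s: "smooth_fun (charts A) UNIV \<theta>" by (rule bump_smooth[OF man \<theta>(1)])
    have "continuous_on UNIV \<theta>" by (rule smooth_fun_continuous[OF man open_UNIV \<theta>s])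
    then have N: "open N" unfolding N_def using o by (intro open_Int open_Collect_neq) auto
    have "set (map s [0..<n]) \<subseteq> \<Gamma> A" using s by auto
    then have "\<eta> (map s [0..<n]) \<in> CC" using assms unfolding tensor_def val_def by blast
    then have "smooth_fun (charts A) N (\<eta> (map s [0..<n]))" by (auto intro: smooth_fun_mono)
    moreover have "smooth_fun (charts A) N (\<lambda>x. inverse (\<theta> x) ^ m)" for m
    proof (induction m)
      case (Suc m)
      have "smooth_fun (charts A) N (\<lambda>x. inverse (\<theta> x))"
        by (rule smooth_fun_inverse[OF man N smooth_fun_mono[OF \<theta>s]]) (auto simp: N_def)
      then show ?case using smooth_fun_mult[OF man N _ Suc] by simp
    qed (simp add: smooth_fun_const[OF man N])
    ultimately have "smooth_fun (charts A) N (\<lambda>x. \<eta> (map s [0..<n]) x * inverse (\<theta> x) ^ n)"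
      by (rule smooth_fun_mult[OF man N])
    then have "smooth_fun (charts A) N (\<lambda>x. \<omega> x (\<lambda>j. e (I j) x))"
    proof (rule smooth_fun_cong[OF man N])
      fix x assume x: "x \<in> N"
      have e: "e (I j) x \<in> fib A x" if "j < n" for j
        using is_basis_in[OF frame_basis[OF V]] x I[OF that] by (simp add: N_def)
      have "\<eta> (map s [0..<n]) x = \<omega> x (\<lambda>j. s j x)" using val[OF s] by simp
      also have "\<dots> = \<omega> x (\<lambda>j. \<theta> x *\<^sub>R e (I j) x)" using x by (simp add: s_def N_def)
      also have "\<dots> = \<theta> x ^ n * \<omega> x (\<lambda>j. e (I j) x)"
        by (rule alt_form_scale_all[OF alt fib_subspace e])
      finally show "\<eta> (map s [0..<n]) x * inverse (\<theta> x) ^ n = \<omega> x (\<lambda>j. e (I j) x)"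
        using x by (simp add: N_def power_inverse)
    qed
    then show "\<exists>N. open N \<and> x0 \<in> N \<and> smooth_fun (charts A) N (\<lambda>x. \<omega> x (\<lambda>j. e (I j) x))"
      using N x0 \<theta>(2) by (intro exI[of _ N]) (auto simp: N_def)
  qed
  have "\<omega> \<in> \<Omega> A n" unfolding forms_def using alt smooth by auto
  then show ?thesis using val by blast
qed

text \<open>Cochains are normalised to be \<open>0\<close> on lists of the wrong length and on lists with a member that
  is not a section, so that equations between forms are equations between functions.\<close>

definition hat :: "nat \<Rightarrow> ('m, 'a) form \<Rightarrow> ('m, 'a) cochain" where
  "hat k \<omega> = (\<lambda>vs x. if set vs \<subseteq> \<Gamma> A \<and> length vs = k then \<omega> x (\<lambda>i. (vs ! i) x) else 0)"

lemma hat_map: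
  assumes "\<omega> \<in> \<Omega> A k" "\<And>i. i < k \<Longrightarrow> s i \<in> \<Gamma> A"
  shows "hat k \<omega> (map s [0..<k]) x = \<omega> x (\<lambda>i. s i x)"
proof -
  have "\<omega> x (\<lambda>i. (map s [0..<k] ! i) x) = \<omega> x (\<lambda>i. s i x)"
    by (rule alt_form_cong[OF forms_alt[OF assms(1)]]) auto
  then show ?thesis using assms(2) by (auto simp: hat_def)
qed

lemma supported_hat:
  assumes \<omega>: "\<omega> \<in> \<Omega> A k"
  shows "supported (hat k \<omega>)"
  unfolding supported_def tensor_def
proof (intro conjI allI impI)
  have alt: "alt_form k (fib A x) (\<omega> x)" for x using forms_alt[OF \<omega>] by simp
  show "val (hat k \<omega>)" unfolding val_def
  proof (intro allI impI)
    fix vs assume vs: "set vs \<subseteq> \<Gamma> A"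
    show "hat k \<omega> vs \<in> CC"
    proof (cases "length vs = k")
      case True
      then have "(\<lambda>x. \<omega> x (\<lambda>j. (vs ! j) x)) \<in> CC"
        using vs by (intro form_section_smooth[OF \<omega>]) (auto dest: nth_mem)
      then show ?thesis using vs True by (simp add: hat_def)
    next
      case False
      then show ?thesis using C_const[of 0] by (simp add: hat_def)
    qed
  qed
  show "mlin (hat k \<omega>)" unfolding mlin_def
  proof (intro allI ballI impI ext)
    fix xs ys u v f g x
    assume fg: "f \<in> CC" "g \<in> CC" and S: "set xs \<subseteq> \<Gamma> A \<and> set ys \<subseteq> \<Gamma> A \<and> u \<in> \<Gamma> A \<and> v \<in> \<Gamma> A"
    let ?c = "\<lambda>x. f x *\<^sub>R u x + g x *\<^sub>R v x"
    have c: "?c \<in> \<Gamma> A" using S_lin[OF fg] S by blast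
    show "hat k \<omega> (xs @ ?c # ys) x = (f * hat k \<omega> (xs @ u # ys) + g * hat k \<omega> (xs @ v # ys)) x"
    proof (cases "length (xs @ u # ys) = k")
      case True
      let ?w = "\<lambda>i. ((xs @ u # ys) ! i) x"
      have w: "?w j \<in> fib A x" if "j < k" for j
      proof -
        have "(xs @ u # ys) ! j \<in> set (xs @ u # ys)" using that True by (intro nth_mem) simp
        then show ?thesis using S by (intro section_in) auto
      qed
      have upd: "?w(length xs := z x) = (\<lambda>i. ((xs @ z # ys) ! i) x)" for z
        by (auto simp: fun_eq_iff nth_append nth_Cons split: nat.split)
      have "\<omega> x (?w(length xs := f x *\<^sub>R u x + g x *\<^sub>R v x)) =
          f x * \<omega> x (?w(length xs := u x)) + g x * \<omega> x (?w(length xs := v x))"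
        by (rule alt_form_linear[where v="?w", OF alt w]) (use True S section_in in auto)
      then have "\<omega> x (\<lambda>i. ((xs @ ?c # ys) ! i) x) =
          f x * \<omega> x (\<lambda>i. ((xs @ u # ys) ! i) x) + g x * \<omega> x (\<lambda>i. ((xs @ v # ys) ! i) x)"
        unfolding upd[of ?c] upd[of u] upd[of v] .
      then show ?thesis using True S c by (simp add: hat_def)
    qed (auto simp: hat_def)
  qed
  show "asym (hat k \<omega>)" unfolding asym_def
  proof (intro allI impI ext)
    fix xs ys u v x
    assume S: "set xs \<subseteq> \<Gamma> A \<and> set ys \<subseteq> \<Gamma> A \<and> u \<in> \<Gamma> A \<and> v \<in> \<Gamma> A"
    show "hat k \<omega> (xs @ u # v # ys) x = (- hat k \<omega> (xs @ v # u # ys)) x"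
    proof (cases "length (xs @ u # v # ys) = k")
      case True
      let ?w = "\<lambda>i. ((xs @ v # u # ys) ! i) x"
      have w: "?w j \<in> fib A x" if "j < k" for j
      proof -
        have "(xs @ v # u # ys) ! j \<in> set (xs @ v # u # ys)" using that True by (intro nth_mem) simp
        then show ?thesis using S by (intro section_in) auto
      qed
      have "\<omega> x (?w \<circ> Transposition.transpose (length xs) (Suc (length xs))) = - \<omega> x ?w"
        by (rule alt_form_swap[OF alt fib_subspace w]) (use True in auto)
      moreover have "?w \<circ> Transposition.transpose (length xs) (Suc (length xs)) = (\<lambda>i. ((xs @ u # v # ys) ! i) x)"
      proof
        fix i
        consider "i < length xs" | "i = length xs" | "i = Suc (length xs)" | "Suc (length xs) < i" by linarith
        then show "(?w \<circ> Transposition.transpose (length xs) (Suc (length xs))) i = ((xs @ u # v # ys) ! i) x"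
        proof cases
          case 4
          then obtain m where "i = length xs + Suc (Suc m)"
            by (metis add_Suc_right less_iff_Suc_add add_Suc)
          then show ?thesis by (simp add: nth_append Transposition.transpose_def)
        qed (auto simp: nth_append Transposition.transpose_def)
      qed
      ultimately show ?thesis using True S by (simp add: hat_def)
    qed (auto simp: hat_def)
  qed
  fix vs assume "\<not> set vs \<subseteq> \<Gamma> A"
  then show "hat k \<omega> vs = 0" by (auto simp: hat_def fun_eq_iff)
qed

lemma hat_inject:
  assumes "\<omega> \<in> \<Omega> A k" "\<eta> \<in> \<Omega> A k" "hat k \<omega> = hat k \<eta>"
  shows "\<omega> = \<eta>"
proof (rule forms_eqI[OF assms(1,2)])
  fix s :: "nat \<Rightarrow> 'm \<Rightarrow> 'a" and x assume "\<And>j. s j \<in> \<Gamma> A"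
  then show "\<omega> x (\<lambda>j. s j x) = \<eta> x (\<lambda>j. s j x)"
    using hat_map[OF assms(1), of s x] hat_map[OF assms(2), of s x] assms(3) by simp
qed

lemma d_formula_eq:
  assumes \<omega>: "\<omega> \<in> \<Omega> A k" and s: "\<And>i. i \<le> k \<Longrightarrow> s i \<in> \<Gamma> A"
  shows "D (hat k \<omega>) (map s [0..<Suc k]) x = d_formula A k \<omega> s x"
proof -
  have as: "asym (hat k \<omega>)" using supported_hat[OF \<omega>] by (simp add: supported_def tensor_def)
  have 1: "hat k \<omega> (map (omit i s) [0..<k]) = (\<lambda>y. \<omega> y (\<lambda>m. omit i s m y))" if "i \<le> k" for i
    using s by (intro ext hat_map[OF \<omega>]) (auto simp: omit_def)
  have 2: "hat k \<omega> (bracket A (s i) (s j) # map (omit i (omit j s)) [0..<k - 1]) x =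
      \<omega> x (case_nat (bracket A (s i) (s j) x) (\<lambda>m. omit i (omit j s) m x))" if ij: "i < j" "j \<le> k" for i j
  proof -
    have "k \<noteq> 0" using ij by simp
    then obtain n where k: "k = Suc n" using not0_implies_Suc by blast
    have o: "omit i (omit j s) m \<in> \<Gamma> A" if "m < n" for m using that s k by (simp add: omit_def)
    have b: "bracket A (s i) (s j) \<in> \<Gamma> A" using s ij by (intro bracket_section) auto
    have "\<omega> x (\<lambda>m. ((bracket A (s i) (s j) # map (omit i (omit j s)) [0..<n]) ! m) x) =
      \<omega> x (case_nat (bracket A (s i) (s j) x) (\<lambda>m. omit i (omit j s) m x))"
      by (rule alt_form_cong[OF forms_alt[OF \<omega>]]) (auto simp: k nth_Cons split: nat.split)
    then show ?thesis using o b k by (auto simp: hat_def)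
  qed
  have "D (hat k \<omega>) (map s [0..<Suc k]) x =
    (\<Sum>i\<le>k. (- 1) ^ i * lie_derivative A (s i) (hat k \<omega> (map (omit i s) [0..<k])) x) +
    (\<Sum>j\<le>k. \<Sum>i<j. (- 1) ^ (i + j) * hat k \<omega> (bracket A (s i) (s j) # map (omit i (omit j s)) [0..<k - 1]) x)"
    using fun_cong[OF D_explicit[where k=k and v=s, OF as s], of x]
    by (simp only: plus_fun_apply sum_fun_apply times_fun_apply minus_one_power_apply)
  also have "\<dots> = d_formula A k \<omega> s x"
    unfolding d_formula_def using 1 2 by (intro arg_cong2[of _ _ _ _ "(+)"] sum.cong refl) auto
  finally show ?thesis .
qed

text \<open>The description in \<open>dA\<close> is justified here. Existence: \<open>D\<close> of a
  form is tensorial, so \<open>ex_form\<close> realises it, and its values are those of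
  \<open>d_formula\<close>. Uniqueness: forms that agree on global sections are equal.\<close>

lemma dA_spec:
  assumes \<omega>: "\<omega> \<in> \<Omega> A k"
  shows "dA A k \<omega> \<in> \<Omega> A (Suc k)" "hat (Suc k) (dA A k \<omega>) = dd (hat k \<omega>)"
proof -
  let ?P = "\<lambda>\<eta>. \<eta> \<in> \<Omega> A (Suc k) \<and>
     (\<forall>v. (\<forall>i\<le>k. v i \<in> \<Gamma> A) \<longrightarrow> (\<forall>x. \<eta> x (\<lambda>i. v i x) = d_formula A k \<omega> v x))"
  have t: "tensor (D (hat k \<omega>))" by (rule tensor_D[OF supportedD(1)[OF supported_hat[OF \<omega>]]])
  obtain \<eta> where \<eta>: "\<eta> \<in> \<Omega> A (Suc k)"
    "\<forall>s x. (\<forall>i<Suc k. s i \<in> \<Gamma> A) \<longrightarrow> \<eta> x (\<lambda>i. s i x) = D (hat k \<omega>) (map s [0..<Suc k]) x"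
    using ex_form[OF t, of "Suc k"] by blast
  have P: "?P \<eta>" using \<eta> d_formula_eq[OF \<omega>] by (simp add: less_Suc_eq_le del: upt_Suc)
  have uniq: "\<zeta> = \<eta>" if "?P \<zeta>" for \<zeta>
    by (rule forms_eqI[of _ "Suc k"]) (use that P in auto)
  have dA: "dA A k \<omega> = \<eta>" unfolding dA_def by (rule the_equality[where P="?P"], rule P, rule uniq)
  show "dA A k \<omega> \<in> \<Omega> A (Suc k)" using dA \<eta>(1) by simp
  show "hat (Suc k) (dA A k \<omega>) = dd (hat k \<omega>)"
  proof (intro ext)
    fix vs x
    show "hat (Suc k) (dA A k \<omega>) vs x = dd (hat k \<omega>) vs x"
    proof (cases "set vs \<subseteq> \<Gamma> A")
      case True
      show ?thesis
      proof (cases "length vs = Suc k")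
        \<comment> \<open>The form \<eta> is specified on sequences of sections, so the list is
          rewritten as an initial segment of one.\<close>
        case l: True
        have vs: "vs = map ((!) vs) [0..<Suc k]" using l by (metis map_nth)
        have S: "vs ! i \<in> \<Gamma> A" if "i < Suc k" for i by (rule subsetD[OF True nth_mem]) (use l that in simp)
        have "hat (Suc k) \<eta> vs x = D (hat k \<omega>) vs x"
          using \<eta>(2)[rule_format, of "(!) vs" x] S l True vs by (simp add: hat_def del: upt_Suc)
        then show ?thesis using dA True by (simp add: dd_def)
      next
        case False
        have "D (hat k \<omega>) vs = 0"
          by (rule D_degree[OF _ True False]) (simp add: hat_def fun_eq_iff)
        then show ?thesis using False by (simp add: dd_def hat_def)
      qed
    qed (auto simp: hat_def dd_def)
  qed
qed

text \<open>Both products satisfy the same recursion under contraction, one by definition and the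
  other by \<open>ext_wedge_case_nat\<close>. The statement is about one point x and arbitrary
  alternating a and b, because contraction with u x gives an alternating map on this one fibre
  only.\<close>

lemma shuffle_ext_wedge:
  assumes "alt_form k (fib A x) a" "alt_form l (fib A x) b"
    "\<And>us. set us \<subseteq> \<Gamma> A \<Longrightarrow> \<omega> us x = (if length us = k then a (\<lambda>i. (us ! i) x) else 0)"
    "\<And>us. set us \<subseteq> \<Gamma> A \<Longrightarrow> \<eta> us x = (if length us = l then b (\<lambda>i. (us ! i) x) else 0)"
    "set vs \<subseteq> \<Gamma> A"
  shows "shuffle \<omega> \<eta> vs x = (if length vs = k + l then ext_wedge k l a b (\<lambda>i. (vs ! i) x) else 0)"
  using assms
proof (induction vs arbitrary: \<omega> \<eta> k l a b)
  case Nil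
  show ?case
  proof (cases "k = 0 \<and> l = 0")
    case True
    then have "alt_form 0 (fib A x) a" "alt_form 0 (fib A x) b" using Nil(1,2) by auto
    from ext_wedge_0_0[OF this] show "shuffle \<omega> \<eta> [] x = (if length [] = k + l then ext_wedge k l a b (\<lambda>i. ([] ! i) x) else 0)"
      using True Nil(3)[of "[]"] Nil(4)[of "[]"] by simp
  next
    case False
    then show "shuffle \<omega> \<eta> [] x = (if length [] = k + l then ext_wedge k l a b (\<lambda>i. ([] ! i) x) else 0)"
      using Nil(3)[of "[]"] Nil(4)[of "[]"] by auto
  qed
next
  case (Cons u vs)
  have S: "u \<in> \<Gamma> A" "set vs \<subseteq> \<Gamma> A" using Cons.prems(5) by auto
  have u: "u x \<in> fib A x" by (rule section_in[OF S(1)])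
  have \<omega>: "\<omega> us x = (if length us = k then a (\<lambda>i. (us ! i) x) else 0)"
    and \<eta>: "\<eta> us x = (if length us = l then b (\<lambda>i. (us ! i) x) else 0)" if "set us \<subseteq> \<Gamma> A" for us
    using Cons.prems(3,4) that by blast+
  have nth: "(\<lambda>i. ((u # us) ! i) x) = case_nat (u x) (\<lambda>i. (us ! i) x)" for us
    by (auto simp: fun_eq_iff split: nat.split)
  let ?v = "\<lambda>i. (vs ! i) x"
  have 1: "shuffle (ins u \<omega>) \<eta> vs x =
      (if k = 0 then 0 else if length vs = (k - 1) + l then ext_wedge (k - 1) l (contract (u x) a) b ?v else 0)"
  proof (cases k)
    case 0
    \<comment> \<open>Contracting a cochain of degree 0 gives one that vanishes at x, stated through
      the filtration so that \<open>filt_shuffle\<close> applies.\<close>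
    have "filt (\<lambda>_. True) x 1 (ins u \<omega>)" using \<omega> S 0 unfolding filt_def by auto
    then have "filt (\<lambda>_. True) x (1 + 0) (shuffle (ins u \<omega>) \<eta>)" by (rule filt_shuffle) (rule filt_arith)
    then have "shuffle (ins u \<omega>) \<eta> vs x = 0" using S(2) by (simp add: filt_def)
    then show ?thesis using 0 by simp
  next
    case (Suc k')
    have a: "alt_form (Suc k') (fib A x) a" using Cons.prems(1) Suc by simp
    have "shuffle (ins u \<omega>) \<eta> vs x =
        (if length vs = k' + l then ext_wedge k' l (contract (u x) a) b ?v else 0)"
    proof (rule Cons.IH[OF alt_form_contract[OF a u] Cons.prems(2)])
      fix us assume "set us \<subseteq> \<Gamma> A"
      then show "ins u \<omega> us x = (if length us = k' then contract (u x) a (\<lambda>i. (us ! i) x) else 0)"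
        using \<omega>[of "u # us"] S(1) by (simp only: ins_apply nth contract_def) (simp add: Suc)
    qed (use \<eta> S(2) in auto)
    then show ?thesis using Suc by simp
  qed
  have 2: "shuffle (bar \<omega>) (ins u \<eta>) vs x =
      (- 1) ^ k * (if l = 0 then 0 else if length vs = k + (l - 1) then ext_wedge k (l - 1) a (contract (u x) b) ?v else 0)"
  proof (cases l)
    case 0
    have "filt (\<lambda>_. True) x 1 (ins u \<eta>)" using \<eta> S 0 unfolding filt_def by auto
    then have "filt (\<lambda>_. True) x (0 + 1) (shuffle (bar \<omega>) (ins u \<eta>))" by (intro filt_shuffle filt_arith)
    then have "shuffle (bar \<omega>) (ins u \<eta>) vs x = 0" using S(2) by (simp add: filt_def)
    then show ?thesis using 0 by simp
  next
    case (Suc l')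
    have b: "alt_form (Suc l') (fib A x) b" using Cons.prems(2) Suc by simp
    \<comment> \<open>The fibrewise counterpart of \<open>bar \<omega>\<close>, written as a
      difference to match \<open>alt_form_diff_scale\<close>.\<close>
    let ?a = "\<lambda>v. (- 1) ^ k * a v - 0 * a v"
    have "shuffle (bar \<omega>) (ins u \<eta>) vs x =
        (if length vs = k + l' then ext_wedge k l' ?a (contract (u x) b) ?v else 0)"
    proof (rule Cons.IH[OF alt_form_diff_scale[OF Cons.prems(1,1)] alt_form_contract[OF b u]])
      fix us assume us: "set us \<subseteq> \<Gamma> A"
      then show "ins u \<eta> us x = (if length us = l' then contract (u x) b (\<lambda>i. (us ! i) x) else 0)"
        using \<eta>[of "u # us"] S(1) by (simp only: ins_apply nth contract_def) (simp add: Suc)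
      show "bar \<omega> us x = (if length us = k then ?a (\<lambda>i. (us ! i) x) else 0)"
        using \<omega>[OF us] by (simp add: bar_def minus_one_power_apply)
    qed (use S(2) in auto)
    moreover have "ext_wedge k l' ?a (contract (u x) b) ?v = (- 1) ^ k * ext_wedge k l' a (contract (u x) b) ?v"
      by (simp add: ext_wedge_def sum_distrib_left mult_ac)
    ultimately show ?thesis using Suc by simp
  qed
  have "shuffle \<omega> \<eta> (u # vs) x = (if k = 0 then 0 else if length vs = (k - 1) + l then ext_wedge (k - 1) l (contract (u x) a) b ?v else 0) +
      (- 1) ^ k * (if l = 0 then 0 else if length vs = k + (l - 1) then ext_wedge k (l - 1) a (contract (u x) b) ?v else 0)"
    using 1 2 by simp
  also have "\<dots> = (if length (u # vs) = k + l then ext_wedge k l a b (\<lambda>i. ((u # vs) ! i) x) else 0)"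
  proof (cases "k + l = Suc (length vs)")
    case True
    have "ext_wedge k l a b (case_nat (u x) ?v) =
      (if k = 0 then 0 else ext_wedge (k - 1) l (contract (u x) a) b ?v) +
      (- 1) ^ k * (if l = 0 then 0 else ext_wedge k (l - 1) a (contract (u x) b) ?v)"
      by (rule ext_wedge_case_nat[OF Cons.prems(1,2) fib_subspace True u])
         (use S(2) in \<open>auto intro!: section_in dest: nth_mem\<close>)
    moreover have "k \<noteq> 0 \<Longrightarrow> length vs = (k - 1) + l" "l \<noteq> 0 \<Longrightarrow> length vs = k + (l - 1)" using True by auto
    ultimately show ?thesis unfolding nth using True by auto
  next
    case False
    then have "k \<noteq> 0 \<Longrightarrow> length vs \<noteq> (k - 1) + l" "l \<noteq> 0 \<Longrightarrow> length vs \<noteq> k + (l - 1)" by auto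
    then show ?thesis using False by auto
  qed
  finally show "shuffle \<omega> \<eta> (u # vs) x = (if length (u # vs) = k + l then ext_wedge k l a b (\<lambda>i. ((u # vs) ! i) x) else 0)" .
qed

text \<open>Instead of checking that the permutation sum is alternating and smooth, one takes the
  form that \<open>ex_form\<close> provides for the shuffle product. It agrees with the wedge
  product in each fibre, and both are 0 on vectors outside the fibre.\<close>

theorem
  assumes \<omega>: "\<omega> \<in> \<Omega> A k" and \<eta>: "\<eta> \<in> \<Omega> A l"
  shows wedge_form: "wedge k l \<omega> \<eta> \<in> \<Omega> A (k + l)"
    and hat_wedge: "hat (k + l) (wedge k l \<omega> \<eta>) = shuffle (hat k \<omega>) (hat l \<eta>)"
proof -
  have alt: "alt_form k (fib A x) (\<omega> x)" "alt_form l (fib A x) (\<eta> x)" for x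
    using forms_alt[OF \<omega>] forms_alt[OF \<eta>] by auto
  note s = supported_shuffle[OF supported_hat[OF \<omega>] supported_hat[OF \<eta>]]
  have sh: "shuffle (hat k \<omega>) (hat l \<eta>) vs x = (if length vs = k + l then ext_wedge k l (\<omega> x) (\<eta> x) (\<lambda>i. (vs ! i) x) else 0)"
    if "set vs \<subseteq> \<Gamma> A" for vs x
    by (rule shuffle_ext_wedge[OF alt _ _ that]) (simp_all add: hat_def)
  show hw: "hat (k + l) (wedge k l \<omega> \<eta>) = shuffle (hat k \<omega>) (hat l \<eta>)"
  proof (intro ext)
    fix vs x
    show "hat (k + l) (wedge k l \<omega> \<eta>) vs x = shuffle (hat k \<omega>) (hat l \<eta>) vs x"
    proof (cases "set vs \<subseteq> \<Gamma> A")
      case True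
      then show ?thesis using sh[OF True] by (simp add: hat_def wedge_ext_wedge)
    next
      case False
      then show ?thesis using supportedD(2)[OF s False] by (auto simp: hat_def)
    qed
  qed
  obtain \<rho> where \<rho>: "\<rho> \<in> \<Omega> A (k + l)"
    "\<forall>s x. (\<forall>i<k + l. s i \<in> \<Gamma> A) \<longrightarrow> \<rho> x (\<lambda>i. s i x) = shuffle (hat k \<omega>) (hat l \<eta>) (map s [0..<k + l]) x"
    using ex_form[OF supportedD(1)[OF s], of "k + l"] by blast
  have "wedge k l \<omega> \<eta> = \<rho>"
  proof (intro ext)
    fix x v
    have \<rho>alt: "alt_form (k + l) (fib A x) (\<rho> x)" using forms_alt[OF \<rho>(1)] by simp
    show "wedge k l \<omega> \<eta> x v = \<rho> x v"
    proof (cases "\<forall>j<k + l. v j \<in> fib A x")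
      case True
      then have "\<forall>j. \<exists>t\<in>\<Gamma> A. j < k + l \<longrightarrow> t x = v j" using section_through section_zero by metis
      then obtain t where t: "\<And>j. t j \<in> \<Gamma> A" "\<And>j. j < k + l \<Longrightarrow> t j x = v j" by metis
      have "\<rho> x v = \<rho> x (\<lambda>j. t j x)" by (rule alt_form_cong[OF \<rho>alt]) (simp add: t(2))
      also have "\<dots> = shuffle (hat k \<omega>) (hat l \<eta>) (map t [0..<k + l]) x" using \<rho>(2) t(1) by blast
      also have "\<dots> = ext_wedge k l (\<omega> x) (\<eta> x) (\<lambda>i. (map t [0..<k + l] ! i) x)"
      proof -
        have "set (map t [0..<k + l]) \<subseteq> \<Gamma> A" using t(1) by auto
        from sh[OF this, of x] show ?thesis by simp
      qed
      also have "\<dots> = ext_wedge k l (\<omega> x) (\<eta> x) v"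
        by (rule ext_wedge_cong[OF alt]) (use t(2) in auto)
      finally show ?thesis by (simp add: wedge_ext_wedge)
    next
      case False
      then obtain j where j: "j < k + l" "v j \<notin> fib A x" by blast
      show ?thesis
        using ext_wedge_outside[where v=v and j=j, OF alt j] alt_form_outside[where v=v and j=j, OF \<rho>alt j] by (simp add: wedge_ext_wedge)
    qed
  qed
  then show "wedge k l \<omega> \<eta> \<in> \<Omega> A (k + l)" using \<rho>(1) by simp
qed

end

section \<open>Transgression\<close>

primrec shuffle_power :: "('s list \<Rightarrow> 'r::comm_ring_1) \<Rightarrow> nat \<Rightarrow> 's list \<Rightarrow> 'r" where
  "shuffle_power \<omega> 0 = (\<lambda>vs. if vs = [] then 1 else 0)"
| "shuffle_power \<omega> (Suc n) = shuffle \<omega> (shuffle_power \<omega> n)"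

text \<open>A cochain concentrated in degree 0 acts by multiplication. With c = \<beta>(u) this
  evaluates the contraction of \<beta> \<and> \<alpha>.\<close>

lemma shuffle_unit:
  fixes \<eta> :: "'s list \<Rightarrow> 'r::comm_ring_1"
  shows "shuffle (\<lambda>vs. if vs = [] then c else 0) \<eta> vs = c * \<eta> vs"
proof (induction vs arbitrary: \<eta>)
  case (Cons u vs)
  have "ins u (\<lambda>vs. if vs = [] then c else 0) = 0" by (simp add: fun_eq_iff)
  moreover have "bar (\<lambda>vs :: 's list. if vs = [] then c else 0) = (\<lambda>vs. if vs = [] then c else 0)"
    by (simp add: fun_eq_iff bar_def)
  moreover have "shuffle (\<lambda>vs. if vs = [] then c else 0) (ins u \<eta>) vs = c * ins u \<eta> vs" by (rule Cons.IH)
  ultimately show "shuffle (\<lambda>vs. if vs = [] then c else 0) \<eta> (u # vs) = c * \<eta> (u # vs)" by simp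
qed simp

context lie_rinehart
begin

lemma supported_unit: "supported (\<lambda>vs. if vs = [] then 1 else 0)"
  by (simp add: supported_def tensor_def val_def mlin_def asym_def)

lemma dd_unit: "dd (\<lambda>vs. if vs = [] then 1 else 0) = 0"
proof
  fix vs
  let ?\<eta> = "(\<lambda>vs. if vs = [] then 1 else 0) :: ('m, 'a) cochain"
  show "dd ?\<eta> vs = 0 vs"
  proof (cases "set vs \<subseteq> S \<and> length vs = Suc 0")
    case True
    then obtain u where "vs = [u]" "u \<in> S" by (cases vs) auto
    then show ?thesis using L_const[of u 1] by (simp add: dd_def one_fun_def)
  next
    case False
    have "D ?\<eta> vs = 0" if "set vs \<subseteq> S"
      by (rule D_degree[of 0 ?\<eta>]) (use that False in auto)
    then show ?thesis by (simp add: dd_def)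
  qed
qed

lemma supported_shuffle_power: "supported \<omega> \<Longrightarrow> supported (shuffle_power \<omega> n)"
  by (induction n) (simp_all add: supported_unit supported_shuffle)

lemma dd_shuffle_power:
  assumes "supported \<omega>" "dd \<omega> = 0"
  shows "dd (shuffle_power \<omega> n) = 0"
proof (induction n)
  case 0
  show ?case unfolding shuffle_power.simps by (rule dd_unit)
next
  case (Suc n)
  show ?case
    unfolding shuffle_power.simps dd_shuffle[OF assms(1) supported_shuffle_power[OF assms(1)]] Suc assms(2)
      shuffle_zero by (rule add_0_left)
qed

lemma filt_shuffle_power: "filt P x 1 \<omega> \<Longrightarrow> filt P x n (shuffle_power \<omega> n)"
proof (induction n)
  case 0
  show ?case by (rule filt_arith)
next
  case (Suc n)
  from filt_shuffle[OF Suc.prems Suc.IH[OF Suc.prems]] show ?case by simp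
qed

text \<open>Unrolled, this is the sum of w'^i b c w^j over i + j = n - 1. It imitates the
  telescoping factorisation of w'^n - w^n, with the factor w' - w = dc replaced by its primitive c
  and with b multiplied in.\<close>

primrec transgression :: "('m, 'a) cochain \<Rightarrow> ('m, 'a) cochain \<Rightarrow> ('m, 'a) cochain \<Rightarrow> ('m, 'a) cochain \<Rightarrow> nat \<Rightarrow> ('m, 'a) cochain" where
  "transgression b c w w' 0 = 0"
| "transgression b c w w' (Suc n) =
     shuffle w' (transgression b c w w' n) + shuffle b (shuffle c (shuffle_power w n))"

lemma supported_zero: "supported 0"
  by (simp add: supported_def tensor_def val_def mlin_def asym_def)

text \<open>In the step, w'^(n+1) - w^(n+1) = w' (w'^n - w^n) + dc w^n adds the term b dc w^n. It is
  cancelled by d(b c w^n) = w c w^n - b dc w^n, and the leftover w c w^n has n + 2 factors in F_1.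
  Since w' is even, it passes b, and the rest is w' times the induction hypothesis.\<close>

lemma
  assumes s: "supported b" "supported c" "supported w" "supported w'"
    and d: "dd b = w" "w' = w + dd c" "dd w = 0" "dd w' = 0"
    and bar: "bar b = - b" "bar c = - c" "bar w = w" "bar w' = w'"
  shows supported_transgression: "supported (transgression b c w w' n)"
    and transgression_filt: "filt P x 1 c \<Longrightarrow> filt P x 1 w \<Longrightarrow> filt P x 1 w' \<Longrightarrow>
      filt P x (Suc n) (dd (transgression b c w w' n)
        + shuffle b (shuffle_power w' n - shuffle_power w n))"
proof -
  let ?E = "transgression b c w w'"
  note sp = supported_shuffle_power[OF s(3)] supported_shuffle_power[OF s(4)]
  have cs: "supported (shuffle c (shuffle_power w n))" for n by (intro supported_shuffle s sp)
  show sE: "supported (?E n)" for n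
  proof (induction n)
    case 0
    show ?case unfolding transgression.simps by (rule supported_zero)
  next
    case (Suc n)
    show ?case unfolding transgression.simps by (intro supported_arith(1) supported_shuffle s cs Suc)
  qed
  assume f: "filt P x 1 c" "filt P x 1 w" "filt P x 1 w'"
  show "filt P x (Suc n) (dd (?E n) + shuffle b (shuffle_power w' n - shuffle_power w n))"
  proof (induction n)
    case 0
    have "dd 0 = 0" by (rule ext) (simp add: dd_def D_zero)
    then have "dd (?E 0) + shuffle b (shuffle_power w' 0 - shuffle_power w 0) = 0" by simp
    then show ?case by (simp only: filt_arith)
  next
    case (Suc n)
    let ?p = "shuffle_power w n" and ?p' = "shuffle_power w' n"
    have dc: "dd (shuffle c ?p) = shuffle (dd c) ?p"
      using dd_shuffle[OF s(2) sp(1), of n] dd_shuffle_power[OF s(3) d(3), of n] by simp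
    have "dd (?E (Suc n)) = dd (shuffle w' (?E n)) + dd (shuffle b (shuffle c ?p))"
      unfolding transgression.simps by (intro dd_add supported_shuffle s sE cs)
    also have "dd (shuffle w' (?E n)) = shuffle w' (dd (?E n))"
      using dd_shuffle[OF s(4) sE, of n] bar(4) d(4) by simp
    also have "dd (shuffle b (shuffle c ?p)) = shuffle w (shuffle c ?p) - shuffle b (shuffle (dd c) ?p)"
      using dd_shuffle[OF s(1) cs, of n] bar(1) d(1) dc by simp
    finally have 1: "dd (?E (Suc n)) = shuffle w' (dd (?E n)) + (shuffle w (shuffle c ?p) - shuffle b (shuffle (dd c) ?p))" .
    have "shuffle w' ?p' - shuffle w ?p = shuffle w' (?p' - ?p) + shuffle (dd c) ?p"
      unfolding d(2) by (simp add: shuffle_bilinear)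
    then have 2: "shuffle b (shuffle_power w' (Suc n) - shuffle_power w (Suc n)) =
        shuffle w' (shuffle b (?p' - ?p)) + shuffle b (shuffle (dd c) ?p)"
      using shuffle_even_left_commute[OF bar(4), of b "?p' - ?p"] by (simp add: shuffle_add_right)
    have "dd (?E (Suc n)) + shuffle b (shuffle_power w' (Suc n) - shuffle_power w (Suc n)) =
        shuffle w' (dd (?E n) + shuffle b (?p' - ?p)) + shuffle w (shuffle c ?p)"
      unfolding 1 2 shuffle_add_right by (simp only: algebra_simps)
    moreover have "filt P x (1 + Suc n) (shuffle w' (dd (?E n) + shuffle b (?p' - ?p)))"
      by (rule filt_shuffle[OF f(3) Suc.IH])
    moreover have "filt P x (1 + (1 + n)) (shuffle w (shuffle c ?p))"
      by (intro filt_shuffle f filt_shuffle_power)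
    ultimately show ?case by (simp only: filt_arith plus_1_eq_Suc)
  qed
qed

text \<open>Split b' into b + c + dh. As w' is closed, d(h w'^q) equals dh w'^q and removes that
  part; the part with b is covered by the transgression; c w'^q has q + 1 factors in F_1.\<close>

lemma godbillon_vey_difference_filt:
  assumes s: "supported b" "supported b'" "supported c" "supported h"
    and b': "b' = b + c + dd h"
    and bar: "bar b = - b" "bar b' = - b'" "bar c = - c" "bar h = h"
      "bar (dd b) = dd b" "bar (dd b') = dd b'"
    and f: "filt P x 1 c" "filt P x 1 (dd b)" "filt P x 1 (dd b')"
  shows "filt P x (Suc q) (shuffle b' (shuffle_power (dd b') q) - shuffle b (shuffle_power (dd b) q)
    - dd (shuffle h (shuffle_power (dd b') q) - transgression b c (dd b) (dd b') q))"
proof -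
  let ?w = "dd b" and ?w' = "dd b'"
  let ?p = "shuffle_power ?w q" and ?p' = "shuffle_power ?w' q" and ?E = "transgression b c ?w ?w' q"
  have sw: "supported ?w" "supported ?w'" by (intro supported_dd s)+
  note sp = supported_shuffle_power[OF sw(1)] supported_shuffle_power[OF sw(2)]
  have dw: "dd ?w = 0" "dd ?w' = 0" by (rule dd_dd[OF s(1)], rule dd_dd[OF s(2)])
  have w': "?w' = ?w + dd c"
    unfolding b' using dd_add[OF supported_arith(1)[OF s(1,3)] supported_dd[OF s(4)]] dd_add[OF s(1,3)] dd_dd[OF s(4)]
    by simp
  have sE: "supported ?E" by (rule supported_transgression[OF s(1,3) sw refl w' dw bar(1,3,5,6)])
  have tf: "filt P x (Suc q) (dd ?E + shuffle b (?p' - ?p))"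
    by (rule transgression_filt[OF s(1,3) sw refl w' dw bar(1,3,5,6) f])
  have "dd (shuffle h ?p' - ?E) = dd (shuffle h ?p') - dd ?E"
    by (intro dd_diff supported_shuffle s sp sE)
  also have "dd (shuffle h ?p') = shuffle (dd h) ?p'"
    using dd_shuffle[OF s(4) sp(2)] dd_shuffle_power[OF sw(2) dw(2)] by simp
  finally have dh: "dd (shuffle h ?p' - ?E) = shuffle (dd h) ?p' - dd ?E" .
  have "shuffle b' ?p' = shuffle b ?p' + shuffle c ?p' + shuffle (dd h) ?p'"
    by (subst b') (simp only: shuffle_add_left)
  then have "shuffle b' ?p' - shuffle b ?p - dd (shuffle h ?p' - ?E) =
      (dd ?E + shuffle b (?p' - ?p)) + shuffle c ?p'"
    unfolding dh shuffle_diff by (simp only: algebra_simps)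
  moreover have "filt P x (1 + q) (shuffle c ?p')" by (intro filt_shuffle f filt_shuffle_power)
  ultimately show ?thesis using tf by (simp only: filt_arith plus_1_eq_Suc)
qed

end

section \<open>Cohomology classes of forms, and the logarithmic derivative\<close>

context algebroid_loc
begin

lemma form_lin:
  assumes "\<omega> \<in> \<Omega> A k" "\<eta> \<in> \<Omega> A k"
  shows "(\<lambda>x v. a * \<omega> x v - b * \<eta> x v) \<in> \<Omega> A k"
  unfolding forms_def
proof (intro CollectI conjI ballI)
  fix x show "alt_form k (fib A x) (\<lambda>v. a * \<omega> x v - b * \<eta> x v)"
    by (intro alt_form_diff_scale forms_alt[OF assms(1)] forms_alt[OF assms(2)]) auto
next
  fix Ve assume "Ve \<in> frames A"
  moreover obtain V e where Ve: "Ve = (V, e)" by (cases Ve)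
  ultimately have V: "(V, e) \<in> frames A" by simp
  have o: "open (UNIV \<inter> V)" using frame_open[OF V] by simp
  have "smooth_fun (charts A) (UNIV \<inter> V) (\<lambda>x. a * \<omega> x (\<lambda>j. e (I j) x) + (- b) * \<eta> x (\<lambda>j. e (I j) x))"
    if "\<forall>j<k. I j < rk A" for I
    by (intro smooth_fun_add[OF man o] smooth_fun_mult[OF man o] smooth_fun_const[OF man o]
        forms_smooth[OF assms(1) V] forms_smooth[OF assms(2) V]) (use that in auto)
  then show "case Ve of (V, e) \<Rightarrow> \<forall>I. (\<forall>j<k. I j < rk A) \<longrightarrow>
      smooth_fun (charts A) (UNIV \<inter> V) (\<lambda>x. a * \<omega> x (\<lambda>j. e (I j) x) - b * \<eta> x (\<lambda>j. e (I j) x))"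
    by (simp add: Ve)
qed

lemma hat_lin:
  "hat k (\<lambda>x v. \<omega> x v - \<eta> x v) = hat k \<omega> - hat k \<eta>"
  "hat k (\<lambda>x v. \<omega> x v + \<eta> x v) = hat k \<omega> + hat k \<eta>"
  "hat k (\<lambda>x v. 0) = 0"
  by (intro ext; simp add: hat_def)+

lemma form_arith:
  assumes "\<omega> \<in> \<Omega> A k" "\<eta> \<in> \<Omega> A k"
  shows "(\<lambda>x v. \<omega> x v - \<eta> x v) \<in> \<Omega> A k" "(\<lambda>x v. \<omega> x v + \<eta> x v) \<in> \<Omega> A k"
  using form_lin[OF assms, of 1 1] form_lin[OF assms, of 1 "- 1"] by simp_all

lemma form_zero: "(\<lambda>x v. 0) \<in> \<Omega> A k"
  by (auto simp: forms_def alt_form_def frame_open intro!: smooth_fun_const[OF man])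

lemma form_function: "h \<in> CC \<Longrightarrow> (\<lambda>x v. h x) \<in> \<Omega> A 0"
  by (auto simp: forms_def alt_form_def intro: smooth_fun_mono)

lemma dA_diff:
  assumes "\<omega> \<in> \<Omega> A k" "\<eta> \<in> \<Omega> A k"
  shows "dA A k (\<lambda>x v. \<omega> x v - \<eta> x v) = (\<lambda>x v. dA A k \<omega> x v - dA A k \<eta> x v)"
proof (rule hat_inject)
  show "dA A k (\<lambda>x v. \<omega> x v - \<eta> x v) \<in> \<Omega> A (Suc k)" by (rule dA_spec[OF form_arith(1)[OF assms]])
  show "(\<lambda>x v. dA A k \<omega> x v - dA A k \<eta> x v) \<in> \<Omega> A (Suc k)" by (intro form_arith dA_spec assms)
  show "hat (Suc k) (dA A k (\<lambda>x v. \<omega> x v - \<eta> x v)) = hat (Suc k) (\<lambda>x v. dA A k \<omega> x v - dA A k \<eta> x v)"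
    unfolding dA_spec(2)[OF form_arith(1)[OF assms]] hat_lin dA_spec(2)[OF assms(1)] dA_spec(2)[OF assms(2)]
    by (intro dd_diff supported_hat assms)
qed

text \<open>A primitive of \<omega>' - \<eta> minus \<zeta> is a primitive of \<omega> - \<eta>. The
  reverse inclusion in \<open>cohomology_class_eq\<close> follows with -\<zeta>.\<close>

lemma cohomology_class_mono:
  assumes "\<omega> \<in> cocycles A (Suc n)" "\<zeta> \<in> \<Omega> A n" "dA A n \<zeta> = (\<lambda>x v. \<omega>' x v - \<omega> x v)"
  shows "cohomology_class A (Suc n) \<omega>' \<subseteq> cohomology_class A (Suc n) \<omega>"
proof
  fix \<eta> assume "\<eta> \<in> cohomology_class A (Suc n) \<omega>'"
  then obtain \<xi> where \<eta>: "\<eta> \<in> cocycles A (Suc n)" and \<xi>: "\<xi> \<in> \<Omega> A n" "(\<lambda>x v. \<omega>' x v - \<eta> x v) = dA A n \<xi>"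
    by (auto simp: cohomology_class_def cohomologous_def coboundaries_def)
  have "(\<lambda>x v. \<omega> x v - \<eta> x v) = (\<lambda>x v. dA A n \<xi> x v - dA A n \<zeta> x v)"
    unfolding assms(3) \<xi>(2)[symmetric] by (simp add: fun_eq_iff)
  also have "\<dots> = dA A n (\<lambda>x v. \<xi> x v - \<zeta> x v)" by (rule dA_diff[OF \<xi>(1) assms(2), symmetric])
  finally have "(\<lambda>x v. \<omega> x v - \<eta> x v) \<in> coboundaries A (Suc n)"
    using form_arith(1)[OF \<xi>(1) assms(2)] by (simp add: coboundaries_def)
  then show "\<eta> \<in> cohomology_class A (Suc n) \<omega>"
    using \<eta> assms(1) by (simp add: cohomology_class_def cohomologous_def)
qed

lemma cohomology_class_eq:
  assumes "\<omega> \<in> cocycles A (Suc n)" "\<omega>' \<in> cocycles A (Suc n)" "\<zeta> \<in> \<Omega> A n"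
    "dA A n \<zeta> = (\<lambda>x v. \<omega>' x v - \<omega> x v)"
  shows "cohomology_class A (Suc n) \<omega>' = cohomology_class A (Suc n) \<omega>"
proof
  show "cohomology_class A (Suc n) \<omega>' \<subseteq> cohomology_class A (Suc n) \<omega>"
    by (rule cohomology_class_mono[OF assms(1,3,4)])
  have "dA A n (\<lambda>x v. 0 - \<zeta> x v) = (\<lambda>x v. dA A n (\<lambda>x v. 0) x v - dA A n \<zeta> x v)"
    by (rule dA_diff[OF form_zero assms(3)])
  moreover have "dA A n (\<lambda>x v. 0) = (\<lambda>x v. 0)"
    using dA_diff[OF assms(3,3)] by simp
  ultimately have "dA A n (\<lambda>x v. 0 - \<zeta> x v) = (\<lambda>x v. \<omega> x v - \<omega>' x v)"
    by (simp add: assms(4))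
  from cohomology_class_mono[OF assms(2) form_arith(1)[OF form_zero assms(3)] this]
  show "cohomology_class A (Suc n) \<omega> \<subseteq> cohomology_class A (Suc n) \<omega>'" .
qed

lemma cohomology_class_in: "\<omega> \<in> cocycles A k \<Longrightarrow> cohomology_class A k \<omega> \<in> cohomology A k"
  unfolding cohomology_class_def cohomology_def by (rule quotientI)

lemma bar_hat: "bar (hat k \<omega>) = (if even k then hat k \<omega> else - hat k \<omega>)"
  by (auto simp: fun_eq_iff hat_def bar_def minus_one_power_apply)

lemma dA_1_form: "\<beta> \<in> \<Omega> A 1 \<Longrightarrow> dA A 1 \<beta> \<in> \<Omega> A 2" "\<beta> \<in> \<Omega> A 1 \<Longrightarrow> hat 2 (dA A 1 \<beta>) = dd (hat 1 \<beta>)"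
  using dA_spec[of \<beta> 1] by (simp_all add: numeral_2_eq_2)

lemma wedge_power_form:
  assumes "\<omega> \<in> \<Omega> A 2"
  shows "wedge_power 2 \<omega> n \<in> \<Omega> A (2 * n) \<and> hat (2 * n) (wedge_power 2 \<omega> n) = shuffle_power (hat 2 \<omega>) n"
proof (induction n)
  case 0
  have "hat 0 (\<lambda>x v. 1) = (\<lambda>vs. if vs = [] then 1 else 0)" by (auto simp: hat_def fun_eq_iff)
  then show ?case using form_function[OF CC_const[of 1]] by simp
next
  case (Suc n)
  then show ?case using wedge_form[OF assms, of _ "2 * n"] hat_wedge[OF assms, of _ "2 * n"] by simp
qed

lemma gv_form:
  assumes "\<beta> \<in> \<Omega> A 1"
  shows "gv_form A q \<beta> \<in> \<Omega> A (2 * q + 1)"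
    "hat (2 * q + 1) (gv_form A q \<beta>) = shuffle (hat 1 \<beta>) (shuffle_power (dd (hat 1 \<beta>)) q)"
  using wedge_form[OF assms, of _ "2 * q"] hat_wedge[OF assms, of _ "2 * q"]
    wedge_power_form[OF dA_1_form(1)[OF assms], of q] dA_1_form(2)[OF assms]
  by (simp_all add: gv_form_def add.commute)

lemma dd_hat_function:
  assumes "h \<in> CC" "u \<in> \<Gamma> A"
  shows "dd (hat 0 (\<lambda>x v. h x)) [u] = lie_derivative A u h"
proof -
  have "hat 0 (\<lambda>x v. h x) [] = h" by (simp add: hat_def)
  then show ?thesis using assms(2) by (simp add: dd_def)
qed

text \<open>A chain rule from the product rule alone: ln g is a constant plus (g - g x) times the
  smooth function S o g. The first factor vanishes at x, so only X g times S(g x) = 1 / g x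
  survives.\<close>

lemma tangent_ln:
  assumes X: "tangent_vector (charts A) x X" and g: "g \<in> CC" "\<And>y. g y > 0"
  shows "(\<lambda>y. ln (g y)) \<in> CC" "X (\<lambda>y. ln (g y)) = X g / g x"
proof -
  have comp: "(\<lambda>y. F (g y)) \<in> CC" if "smooth_on {0<..} F" for F
    using smooth_fun_compose_real[OF man open_UNIV _ that] g by auto
  show "(\<lambda>y. ln (g y)) \<in> CC" by (rule comp[OF smooth_on_ln])
  obtain S where S: "smooth_on {0<..} S" "S (g x) = 1 / g x" "\<And>t. t > 0 \<Longrightarrow> ln t = ln (g x) + (t - g x) * S t"
    using smooth_ln_quotient[OF g(2)[of x]] by blast
  have Sg: "(\<lambda>y. S (g y)) \<in> CC" by (rule comp[OF S(1)])
  have d: "(\<lambda>y. 1 * g y + (- g x) * 1) \<in> CC"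
    by (intro CC_arith CC_const g)
  have p: "(\<lambda>y. (1 * g y + (- g x) * 1) * S (g y)) \<in> CC" by (rule CC_arith(2)[OF d Sg])
  have "X (\<lambda>y. ln (g y)) = X (\<lambda>y. 1 * ln (g x) + 1 * ((1 * g y + (- g x) * 1) * S (g y)))"
  proof (rule arg_cong[where f=X], rule ext)
    fix y show "ln (g y) = 1 * ln (g x) + 1 * ((1 * g y + (- g x) * 1) * S (g y))"
      using S(3)[OF g(2)[of y]] by simp
  qed
  also have "\<dots> = 1 * X (\<lambda>y. ln (g x)) + 1 * X (\<lambda>y. (1 * g y + (- g x) * 1) * S (g y))"
    by (rule tangent_lin[OF X CC_const p])
  also have "X (\<lambda>y. (1 * g y + (- g x) * 1) * S (g y)) =
      (1 * g x + (- g x) * 1) * X (\<lambda>y. S (g y)) + S (g x) * X (\<lambda>y. 1 * g y + (- g x) * 1)"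
    by (rule tangent_mult[OF X d Sg])
  also have "X (\<lambda>y. 1 * g y + (- g x) * 1) = 1 * X g + (- g x) * X (\<lambda>y. 1)"
    by (rule tangent_lin[OF X g(1) CC_const])
  finally show "X (\<lambda>y. ln (g y)) = X g / g x"
    by (simp add: S(2) tangent_const[OF X])
qed

text \<open>The function is ln|f|, written with f^2 so that the logarithm is applied to a positive
  smooth function whatever the sign of f.\<close>

lemma lie_derivative_ln_abs:
  assumes f: "f \<in> CC" "\<And>y. f y \<noteq> 0"
  shows "(\<lambda>y. ln (f y * f y) / 2) \<in> CC"
    "u \<in> \<Gamma> A \<Longrightarrow> lie_derivative A u (\<lambda>y. ln (f y * f y) / 2) x = lie_derivative A u f x / f x"
proof -
  let ?g = "\<lambda>y. f y * f y"
  have g: "?g \<in> CC" by (rule CC_arith(2)[OF f(1,1)])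
  have pos: "?g y > 0" for y using f(2)[of y] by (auto simp: zero_less_mult_iff)
  \<comment> \<open>The smoothness claim of \<open>tangent_ln\<close> also presupposes a tangent
    vector; the zero vector of the fibre provides one.\<close>
  have "tangent_vector (charts A) x (anchor A x 0)" for x
    by (rule anchor_tangent) (rule subspace_0[OF fib_subspace])
  from tangent_ln(1)[OF this g pos] have ln: "(\<lambda>y. ln (?g y)) \<in> CC" .
  have eq: "(\<lambda>y. ln (?g y) / 2) = (\<lambda>y. (1/2) * ln (?g y) + 0 * ln (?g y))" by simp
  show "(\<lambda>y. ln (?g y) / 2) \<in> CC"
    unfolding eq by (intro CC_arith CC_const ln)
  assume u: "u \<in> \<Gamma> A"
  let ?X = "anchor A x (u x)"
  have X: "tangent_vector (charts A) x ?X" by (rule anchor_tangent[OF section_in[OF u]])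
  have "?X (\<lambda>y. ln (?g y) / 2) = (1/2) * ?X (\<lambda>y. ln (?g y)) + 0 * ?X (\<lambda>y. ln (?g y))"
    unfolding eq by (rule tangent_lin[OF X ln ln])
  also have "?X (\<lambda>y. ln (?g y)) = ?X ?g / ?g x" by (rule tangent_ln(2)[OF X g pos])
  also have "?X ?g = f x * ?X f + f x * ?X f" by (rule tangent_mult[OF X f(1,1)])
  finally show "lie_derivative A u (\<lambda>y. ln (?g y) / 2) x = lie_derivative A u f x / f x"
    using f(2)[of x] by (simp add: lie_derivative_def field_simps)
qed

end

section \<open>Defining forms\<close>

text \<open>In each term of the permutation sum the vector v i enters exactly one of the 1-forms,
  and all of them vanish on it.\<close>

lemma wedge_list_vanish:
  assumes "\<forall>\<omega>\<in>set \<alpha>s. alt_form 1 V (\<omega> x)" "\<forall>\<omega>\<in>set \<alpha>s. \<omega> x (\<lambda>_. v i) = 0" "i < length \<alpha>s"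
  shows "wedge_list \<alpha>s x v = 0"
  using assms
proof (induction \<alpha>s arbitrary: v i)
  case (Cons \<omega> \<alpha>s)
  let ?n = "length \<alpha>s"
  have "\<omega> x (\<lambda>j. v (\<sigma> j)) * wedge_list \<alpha>s x (\<lambda>j. v (\<sigma> (1 + j))) = 0" if \<sigma>: "\<sigma> permutes {..<1 + ?n}" for \<sigma>
  proof -
    \<comment> \<open>The slot that receives v i: slot 0 belongs to the first factor, the others to
      the product of the remaining ones.\<close>
    obtain p where p: "\<sigma> p = i" using permutes_surj[OF \<sigma>] by (metis surjD)
    have "p < 1 + ?n" using permutes_in_image[OF \<sigma>, of p] p Cons.prems(3) by simp
    show ?thesis
    proof (cases p)
      case 0
      have "alt_form 1 V (\<omega> x)" using Cons.prems(1) by simp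
      then have "\<omega> x (\<lambda>j. v (\<sigma> j)) = \<omega> x (\<lambda>_. v i)"
        by (rule alt_form_cong) (use p 0 in simp)
      then show ?thesis using Cons.prems(2) by simp
    next
      case (Suc p')
      have "wedge_list \<alpha>s x (\<lambda>j. v (\<sigma> (1 + j))) = 0"
        by (rule Cons.IH[of _ p']) (use Cons.prems Suc p \<open>p < 1 + ?n\<close> in auto)
      then show ?thesis by simp
    qed
  qed
  then have "(\<Sum>\<sigma> | \<sigma> permutes {..<1 + ?n}. of_int (sign \<sigma>) *
      (\<omega> x (\<lambda>j. v (\<sigma> j)) * wedge_list \<alpha>s x (\<lambda>j. v (\<sigma> (1 + j))))) = 0"
    by (intro sum.neutral) simp
  then show ?case by (simp add: wedge_def mult.assoc)
qed simp

section \<open>Sections of the subalgebroid and the filtration it defines\<close>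

locale subalgebroid_loc = algebroid_loc A
  for A :: "('m::{t2_space,second_countable_topology}, 'e::real_inner, 'a::real_vector, 'z) algebroid_scheme" +
  fixes B :: "'m \<Rightarrow> 'a set" and q :: nat
  assumes subalgebroid: "lie_subalgebroid A B q"
begin

definition "\<Gamma>B = {s \<in> \<Gamma> A. \<forall>x. s x \<in> B x}"

abbreviation "inB x \<equiv> (\<lambda>s. s x \<in> B x)"

lemma corank_le: "q \<le> rk A"
  using subalgebroid by (simp add: lie_subalgebroid_def subbundle_def)

lemma adapted_frame:
  obtains U f where "open U" "x \<in> U" "\<forall>i<rk A. local_section A U (f i)"
    "\<forall>y\<in>U. is_basis (fib A y) (rk A) (\<lambda>i. f i y)" "\<forall>y\<in>U. is_basis (B y) (rk A - q) (\<lambda>i. f i y)"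
proof -
  have "\<exists>U f. open U \<and> x \<in> U \<and> (\<forall>i<rk A. local_section A U (f i)) \<and>
        (\<forall>y\<in>U. is_basis (fib A y) (rk A) (\<lambda>i. f i y) \<and> is_basis (B y) (rk A - q) (\<lambda>i. f i y))"
    using subalgebroid unfolding lie_subalgebroid_def subbundle_def by blast
  then show ?thesis using that by blast
qed

lemma B_zero: "0 \<in> B x"
proof -
  obtain U f where "x \<in> U" "\<forall>y\<in>U. is_basis (B y) (rk A - q) (\<lambda>i. f i y)" by (rule adapted_frame[of x])
  then have "is_basis (B x) (rk A - q) (\<lambda>i. f i x)" by blast
  then show ?thesis using is_basis_subspace subspace_0 by blast
qed

lemma ex_adapted_basis: "\<exists>b. is_basis (fib A x) (rk A) b \<and> is_basis (B x) (rk A - q) b"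
proof -
  obtain U f where "x \<in> U" "\<forall>y\<in>U. is_basis (fib A y) (rk A) (\<lambda>i. f i y)"
    "\<forall>y\<in>U. is_basis (B y) (rk A - q) (\<lambda>i. f i y)" by (rule adapted_frame[of x])
  then show ?thesis by blast
qed

lemma section_through_B:
  assumes "v \<in> B x"
  shows "\<exists>s\<in>\<Gamma>B. s x = v"
proof -
  obtain U f where U: "open U" "x \<in> U" "\<forall>i<rk A. local_section A U (f i)"
    "\<forall>y\<in>U. is_basis (B y) (rk A - q) (\<lambda>i. f i y)" by (rule adapted_frame[of x])
  have "\<exists>s\<in>\<Gamma> A. s x = v \<and> (\<forall>y. s y \<in> B y)"
    by (rule section_through_frame[where F=B and n="rk A - q" and f=f, OF U(1,2)]) (use U(3,4) B_zero assms in auto)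
  then show ?thesis by (auto simp: \<Gamma>B_def)
qed

lemma \<Gamma>B_in: "s \<in> \<Gamma>B \<Longrightarrow> s \<in> \<Gamma> A" "s \<in> \<Gamma>B \<Longrightarrow> s x \<in> B x"
  by (auto simp: \<Gamma>B_def)

lemma \<Gamma>B_bracket:
  assumes "u \<in> \<Gamma>B" "v \<in> \<Gamma>B"
  shows "bracket A u v \<in> \<Gamma>B"
proof -
  have "\<forall>x. bracket A u v x \<in> B x"
    using subalgebroid assms unfolding lie_subalgebroid_def \<Gamma>B_def by blast
  then show ?thesis using bracket_section assms by (auto simp: \<Gamma>B_def)
qed

text \<open>The cochain \<open>\<omega>\<close> depends only on the values at \<open>x\<close>, so sections with values in \<open>B x\<close> at the
  single point \<open>x\<close> may be replaced by sections of \<open>B\<close>.\<close>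

lemma filt_1I:
  assumes "tensor \<omega>" "\<And>vs. set vs \<subseteq> \<Gamma>B \<Longrightarrow> \<omega> vs x = 0"
  shows "filt (inB x) x 1 \<omega>"
  unfolding filt_def
proof (intro allI impI)
  fix vs assume vs: "set vs \<subseteq> \<Gamma> A" and l: "length (filter (\<lambda>s. \<not> s x \<in> B x) vs) < 1"
  have "\<forall>s\<in>set vs. s x \<in> B x" using l by (simp add: filter_empty_conv)
  then have "\<exists>us. set us \<subseteq> \<Gamma>B \<and> map (\<lambda>s. s x) us = map (\<lambda>s. s x) vs"
  proof (induction vs)
    case (Cons s vs)
    then obtain us where us: "set us \<subseteq> \<Gamma>B" "map (\<lambda>s. s x) us = map (\<lambda>s. s x) vs" by auto
    obtain t where "t \<in> \<Gamma>B" "t x = s x" using section_through_B[of "s x" x] Cons.prems by auto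
    then show ?case using us by (intro exI[of _ "t # us"]) simp
  qed (intro exI[of _ "[]"], simp)
  then obtain us where us: "set us \<subseteq> \<Gamma>B" "map (\<lambda>s. s x) us = map (\<lambda>s. s x) vs" by blast
  have "set us \<subseteq> \<Gamma> A" using us(1) \<Gamma>B_in(1) by blast
  from tensor_pointwise[OF assms(1), of "[]" us vs x] this us vs have "\<omega> us x = \<omega> vs x" by simp
  then show "\<omega> vs x = 0" using assms(2)[OF us(1)] by simp
qed

text \<open>In a basis adapted to B x, a tuple with at most q entries outside the basis of B x
  extends to sections with at most q values outside B x, which the hypothesis covers. By
  \<open>alt_form_eq_zero_filtration\<close> such tuples determine the form.\<close>

lemma form_eq_zero_filt:
  assumes \<rho>: "\<rho> \<in> \<Omega> A n" and f: "\<And>x. filt (inB x) x (Suc q) (hat n \<rho>)"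
  shows "\<rho> = (\<lambda>x v. 0)"
proof (intro ext)
  fix x v
  obtain b where b: "is_basis (fib A x) (rk A) b" "is_basis (B x) (rk A - q) b" using ex_adapted_basis by blast
  have alt: "alt_form n (fib A x) (\<rho> x)" using forms_alt[OF \<rho>] by simp
  show "\<rho> x v = 0"
  proof (rule alt_form_eq_zero_filtration[OF alt b(1) corank_le])
    fix v assume v: "\<And>j. j < n \<Longrightarrow> v j \<in> b ` {..<rk A}"
      and c: "card {j. j < n \<and> v j \<notin> b ` {..<rk A - q}} \<le> q"
    have "\<forall>j. \<exists>s\<in>\<Gamma> A. j < n \<longrightarrow> s x = v j"
    proof
      fix j show "\<exists>s\<in>\<Gamma> A. j < n \<longrightarrow> s x = v j"
      proof (cases "j < n")
        case True
        then have "v j \<in> fib A x" using v[OF True] is_basis_in[OF b(1)] by auto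
        then show ?thesis using section_through by blast
      qed (use section_zero in blast)
    qed
    then obtain s where s: "\<And>j. s j \<in> \<Gamma> A" "\<And>j. j < n \<Longrightarrow> s j x = v j" by metis
    let ?vs = "map s [0..<n]"
    have "{i. i < length ?vs \<and> \<not> (?vs ! i) x \<in> B x} \<subseteq> {j. j < n \<and> v j \<notin> b ` {..<rk A - q}}"
      using s(2) is_basis_in[OF b(2)] by auto
    then have "card {i. i < length ?vs \<and> \<not> (?vs ! i) x \<in> B x} \<le> q"
      by (rule le_trans[OF card_mono c, rotated]) simp
    then have l: "length (filter (\<lambda>s. \<not> s x \<in> B x) ?vs) < Suc q"
      by (simp only: length_filter_conv_card less_Suc_eq_le)
    have "set ?vs \<subseteq> \<Gamma> A" using s(1) by auto
    then have "hat n \<rho> ?vs x = 0" using f[of x] l unfolding filt_def by blast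
    then have "\<rho> x (\<lambda>j. s j x) = 0" using hat_map[OF \<rho>, of s x] s(1) by simp
    moreover have "\<rho> x v = \<rho> x (\<lambda>j. s j x)" by (rule alt_form_cong[OF alt]) (simp add: s(2))
    ultimately show "\<rho> x v = 0" by simp
  qed
qed

section \<open>Lie derivatives of a defining form along sections of B\<close>

context
  fixes \<alpha>
  assumes defining: "defining_form A B q \<alpha>"
begin

lemma defining_form_in: "\<alpha> \<in> \<Omega> A q"
  using defining by (simp add: defining_form_def)

lemma defining_alt: "alt_form q (fib A x) (\<alpha> x)"
  using forms_alt[OF defining_form_in] by simp

text \<open>From i < q follows q > 0, the case in which a decomposition expresses \<alpha> by
  1-forms. Their common kernel is B x, so \<open>wedge_list_vanish\<close> applies.\<close>

lemma defining_vanish: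
  assumes "i < q" "v i \<in> B x"
  shows "\<alpha> x v = 0"
proof -
  obtain U \<alpha>s where U: "x \<in> U" "decomposition A q \<alpha> U \<alpha>s"
    using defining unfolding defining_form_def by blast
  have B: "B x = {v \<in> fib A x. \<forall>\<omega>\<in>set \<alpha>s. \<omega> x (\<lambda>_. v) = 0}"
    using defining U unfolding defining_form_def by blast
  have dec: "length \<alpha>s = q" "set \<alpha>s \<subseteq> forms A U 1" "\<alpha> x = wedge_list \<alpha>s x"
    using U assms(1) by (auto simp: decomposition_def)
  have "wedge_list \<alpha>s x v = 0"
  proof (rule wedge_list_vanish)
    show "\<forall>\<omega>\<in>set \<alpha>s. alt_form 1 (fib A x) (\<omega> x)" using dec(2) U(1) forms_alt by blast
    show "\<forall>\<omega>\<in>set \<alpha>s. \<omega> x (\<lambda>_. v i) = 0" using assms(2) B by blast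
    show "i < length \<alpha>s" using assms(1) dec(1) by simp
  qed
  then show ?thesis using dec(3) by simp
qed

text \<open>Allows \<alpha> to be cancelled at x in identities between cochains.\<close>

lemma defining_nonzero: "\<exists>ws. set ws \<subseteq> \<Gamma> A \<and> hat q \<alpha> ws x \<noteq> 0"
proof -
  obtain v where v: "\<alpha> x v \<noteq> 0" using defining unfolding defining_form_def by blast
  then have fib: "v j \<in> fib A x" if "j < q" for j using alt_form_outside[OF defining_alt that] by blast
  have "\<forall>j. \<exists>s\<in>\<Gamma> A. j < q \<longrightarrow> s x = v j"
    using fib section_through section_zero by metis
  then obtain s where s: "\<And>j. s j \<in> \<Gamma> A" "\<And>j. j < q \<Longrightarrow> s j x = v j" by metis
  have "\<alpha> x v = \<alpha> x (\<lambda>j. s j x)" by (rule alt_form_cong[OF defining_alt]) (simp add: s(2))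
  then have "hat q \<alpha> (map s [0..<q]) x \<noteq> 0" using hat_map[OF defining_form_in, of s x] s(1) v by simp
  moreover have "set (map s [0..<q]) \<subseteq> \<Gamma> A" using s(1) by auto
  ultimately show ?thesis by blast
qed

lemma ins_hat_defining: "u \<in> \<Gamma>B \<Longrightarrow> ins u (hat q \<alpha>) = 0"
proof (intro ext)
  fix vs x assume u: "u \<in> \<Gamma>B"
  have "\<alpha> x (\<lambda>i. ((u # vs) ! i) x) = 0" if "length (u # vs) = q"
    by (rule defining_vanish[of 0]) (use that \<Gamma>B_in(2)[OF u] in auto)
  then show "ins u (hat q \<alpha>) vs x = 0 vs x" by (simp add: hat_def)
qed

context
  fixes \<beta>
  assumes \<beta>: "\<beta> \<in> \<Omega> A 1" and d\<alpha>: "dA A q \<alpha> = wedge 1 q \<beta> \<alpha>"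
begin

text \<open>Contract d\<alpha> = \<beta> \<and> \<alpha> with u. As i_u \<alpha> = 0, Cartan's
  formula leaves L_u \<alpha> on the left, and \<beta>(u) \<alpha> remains on the right.\<close>

lemma Lie_defining:
  assumes u: "u \<in> \<Gamma>B" and ws: "set ws \<subseteq> \<Gamma> A"
  shows "Lie u (hat q \<alpha>) ws = hat 1 \<beta> [u] * hat q \<alpha> ws"
proof -
  have uA: "u \<in> \<Gamma> A" by (rule \<Gamma>B_in[OF u])
  have z: "ins u (hat q \<alpha>) = 0" by (rule ins_hat_defining[OF u])
  have "dd (hat q \<alpha>) = hat (Suc q) (dA A q \<alpha>)" by (rule dA_spec(2)[OF defining_form_in, symmetric])
  also have "\<dots> = shuffle (hat 1 \<beta>) (hat q \<alpha>)"
    unfolding d\<alpha> using hat_wedge[OF \<beta> defining_form_in] by simp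
  finally have "dd (hat q \<alpha>) (u # ws) = shuffle (hat 1 \<beta>) (hat q \<alpha>) (u # ws)" by (rule fun_cong)
  moreover have "dd (hat q \<alpha>) (u # ws) = Lie u (hat q \<alpha>) ws"
    using uA ws z by (simp add: dd_def D_zero)
  moreover have "shuffle (hat 1 \<beta>) (hat q \<alpha>) (u # ws) = shuffle (ins u (hat 1 \<beta>)) (hat q \<alpha>) ws"
    using z by simp
  moreover have "ins u (hat 1 \<beta>) = (\<lambda>vs. if vs = [] then hat 1 \<beta> [u] else 0)"
    by (intro ext) (simp add: hat_def)
  ultimately show ?thesis by (simp only: shuffle_unit)
qed

lemma hat_\<beta>_C: "u \<in> \<Gamma> A \<Longrightarrow> hat 1 \<beta> [u] \<in> CC"
  using supportedD(3)[OF supported_hat[OF \<beta>]] by (simp add: val_def)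

text \<open>It suffices to test on sections u, v of B. As [u, v] is again one, L_[u,v] \<alpha> =
  \<beta>([u,v]) \<alpha>. The commutator of L_u and L_v gives (L_u \<beta>(v) - L_v \<beta>(u))
  \<alpha>, since the products \<beta>(u) \<beta>(v) cancel. Where \<alpha> is nonzero this says
  d\<beta>(u, v) = 0.\<close>

lemma d\<beta>_filt: "filt (inB x) x 1 (dd (hat 1 \<beta>))"
proof (rule filt_1I)
  show "tensor (dd (hat 1 \<beta>))" by (intro supportedD(1) supported_dd supported_hat \<beta>)
  fix vs assume vs: "set vs \<subseteq> \<Gamma>B"
  then have vsA: "set vs \<subseteq> \<Gamma> A" using \<Gamma>B_in(1) by blast
  show "dd (hat 1 \<beta>) vs x = 0"
  proof (cases "length vs = 2")
    case False
    have "D (hat 1 \<beta>) vs = 0"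
      by (rule D_degree[of 1]) (use False vsA in \<open>auto simp: hat_def fun_eq_iff\<close>)
    then show ?thesis by (simp add: dd_def)
  next
    case True
    then obtain u v where uv: "vs = [u, v]" by (auto simp: numeral_2_eq_2 length_Suc_conv)
    have u: "u \<in> \<Gamma>B" "u \<in> \<Gamma> A" and v: "v \<in> \<Gamma>B" "v \<in> \<Gamma> A" using vs vsA uv by auto
    define a where "a = hat q \<alpha>"
    define bu bv where "bu = hat 1 \<beta> [u]" and "bv = hat 1 \<beta> [v]"
    have a: "val a" "mlin a" using supportedD[OF supported_hat[OF defining_form_in]] by (auto simp: a_def)
    have C: "bu \<in> CC" "bv \<in> CC" using hat_\<beta>_C u v by (auto simp: bu_def bv_def)
    obtain ws where ws: "set ws \<subseteq> \<Gamma> A" "a ws x \<noteq> 0" using defining_nonzero unfolding a_def by blast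
    have Lu: "Lie u a us = bu * a us" and Lv: "Lie v a us = bv * a us" if "set us \<subseteq> \<Gamma> A" for us
      using Lie_defining[OF u(1) that] Lie_defining[OF v(1) that] by (simp_all add: a_def bu_def bv_def)
    have "Lie u (Lie v a) ws = Lie u (\<lambda>us. bv * a us) ws"
      by (rule Lie_cong[OF Lv u(2) ws(1)])
    also have "\<dots> = bv * (bu * a ws) + lie_derivative A u bv * a ws"
      using Lie_scale[OF a(1) C(2) u(2) ws(1)] Lu[OF ws(1)] by simp
    finally have 1: "Lie u (Lie v a) ws = \<dots>" .
    have "Lie v (Lie u a) ws = Lie v (\<lambda>us. bu * a us) ws"
      by (rule Lie_cong[OF Lu v(2) ws(1)])
    also have "\<dots> = bu * (bv * a ws) + lie_derivative A v bu * a ws"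
      using Lie_scale[OF a(1) C(1) v(2) ws(1)] Lv[OF ws(1)] by simp
    finally have 2: "Lie v (Lie u a) ws = \<dots>" .
    have "hat 1 \<beta> [bracket A u v] * a ws = Lie (bracket A u v) a ws"
      using Lie_defining[OF \<Gamma>B_bracket[OF u(1) v(1)] ws(1)] by (simp add: a_def)
    also have "\<dots> = Lie u (Lie v a) ws - Lie v (Lie u a) ws"
      by (rule Lie_commute[OF a u(2) v(2) ws(1)])
    finally have "hat 1 \<beta> [bracket A u v] x * a ws x =
        (lie_derivative A u bv x - lie_derivative A v bu x) * a ws x"
      unfolding 1 2 by (simp add: fun_eq_iff algebra_simps)
    then have "hat 1 \<beta> [bracket A u v] x = lie_derivative A u bv x - lie_derivative A v bu x"
      using ws(2) by simp
    then show ?thesis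
      using u v by (simp add: uv dd_def bu_def bv_def)
  qed
qed

end

end

text \<open>In each fibre both forms kill B x, so they are proportional by
  \<open>alt_form_proportional\<close>. The ratio is smooth because near any point it is a quotient
  of components in a local frame.\<close>

lemma defining_ratio:
  assumes \<alpha>: "defining_form A B q \<alpha>" and \<alpha>': "defining_form A B q \<alpha>'"
  shows "\<exists>f\<in>CC. (\<forall>x. f x \<noteq> 0) \<and> (\<forall>x v. \<alpha>' x v = f x * \<alpha> x v)"
proof -
  have ratio: "\<alpha>' x v * \<alpha> x u = \<alpha> x v * \<alpha>' x u" for x v u
  proof -
    obtain b where b: "is_basis (fib A x) (rk A) b" "is_basis (B x) (rk A - q) b" using ex_adapted_basis by blast
    have "b ` {..<rk A - q} \<subseteq> B x" using is_basis_in[OF b(2)] by auto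
    then show ?thesis
      using defining_vanish[OF \<alpha>] defining_vanish[OF \<alpha>']
      by (intro alt_form_proportional[OF defining_alt[OF \<alpha>] defining_alt[OF \<alpha>'] b(1) corank_le]) blast+
  qed
  have nz: "\<exists>v. \<alpha> x v \<noteq> 0" "\<exists>v. \<alpha>' x v \<noteq> 0" for x
    using \<alpha>[unfolded defining_form_def] \<alpha>'[unfolded defining_form_def] by simp_all
  \<comment> \<open>An arbitrary choice at each point, without any continuity. Cross-multiplication
    shows that f does not depend on it.\<close>
  define w where "w x = (SOME v. \<alpha> x v \<noteq> 0)" for x
  have w: "\<alpha> x (w x) \<noteq> 0" for x unfolding w_def by (rule someI_ex[OF nz(1)])
  define f where "f x = \<alpha>' x (w x) / \<alpha> x (w x)" for x
  have f: "\<alpha>' x v = f x * \<alpha> x v" for x v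
    using ratio[of x v "w x"] w[of x] by (simp add: f_def field_simps)
  have "f x \<noteq> 0" for x using nz(2)[of x] f[of x] by auto
  moreover have "smooth_fun (charts A) UNIV f"
  proof (rule smooth_fun_locally[OF man])
    fix x0
    obtain V e where V: "(V, e) \<in> frames A" "x0 \<in> V" using ex_frame by blast
    have o: "open V" by (rule frame_open[OF V(1)])
    \<comment> \<open>A component of \<alpha> that is nonzero at the given point stays nonzero
      nearby and serves as denominator.\<close>
    have "\<exists>I. (\<forall>j<q. I j < rk A) \<and> \<alpha> x0 (\<lambda>j. e (I j) x0) \<noteq> 0"
    proof (rule ccontr)
      assume n: "\<not> ?thesis"
      have "\<alpha> x0 v = 0" for v
        by (rule alt_form_eq_zero_basis[OF defining_alt[OF \<alpha>] frame_basis[OF V]]) (use n in blast)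
      then show False using nz(1) by blast
    qed
    then obtain I where I: "\<And>j. j < q \<Longrightarrow> I j < rk A" "\<alpha> x0 (\<lambda>j. e (I j) x0) \<noteq> 0" by blast
    define g where "g = (\<lambda>x. \<alpha> x (\<lambda>j. e (I j) x))"
    define g' where "g' = (\<lambda>x. \<alpha>' x (\<lambda>j. e (I j) x))"
    have g: "smooth_fun (charts A) V g" "smooth_fun (charts A) V g'"
      using forms_smooth[OF defining_form_in[OF \<alpha>] V(1) I(1)] forms_smooth[OF defining_form_in[OF \<alpha>'] V(1) I(1)]
      by (simp_all add: g_def g'_def)
    define N where "N = V \<inter> g -` (- {0})"
    have N: "open N" unfolding N_def
      by (rule continuous_open_preimage[OF smooth_fun_continuous[OF man o g(1)] o]) auto
    have "smooth_fun (charts A) N (\<lambda>x. g' x * inverse (g x))"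
      by (intro smooth_fun_mult[OF man N] smooth_fun_inverse[OF man N] smooth_fun_mono[OF g(1)] smooth_fun_mono[OF g(2)])
         (auto simp: N_def)
    then have "smooth_fun (charts A) N f"
      by (rule smooth_fun_cong[OF man N]) (use f in \<open>auto simp: N_def g_def g'_def\<close>)
    moreover have "x0 \<in> N" using V(2) I(2) by (simp add: N_def g_def)
    ultimately show "\<exists>N. open N \<and> x0 \<in> N \<and> smooth_fun (charts A) N f" using N by blast
  qed
  ultimately show ?thesis using f by blast
qed

lemma gv_form_cocycle:
  assumes "defining_form A B q \<alpha>" "\<beta> \<in> \<Omega> A 1" "dA A q \<alpha> = wedge 1 q \<beta> \<alpha>"
  shows "gv_form A q \<beta> \<in> cocycles A (2 * q + 1)"
proof -
  let ?b = "hat 1 \<beta>"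
  have b: "supported ?b" by (rule supported_hat[OF assms(2)])
  have w: "supported (dd ?b)" by (rule supported_dd[OF b])
  note gv = gv_form[OF assms(2), of q]
  have "hat (Suc (2 * q + 1)) (dA A (2 * q + 1) (gv_form A q \<beta>)) = dd (shuffle ?b (shuffle_power (dd ?b) q))"
    unfolding dA_spec(2)[OF gv(1)] gv(2) ..
  also have "\<dots> = shuffle (dd ?b) (shuffle_power (dd ?b) q)"
    unfolding dd_shuffle[OF b supported_shuffle_power[OF w]] dd_shuffle_power[OF w dd_dd[OF b]] by simp
  finally have h: "hat (Suc (2 * q + 1)) (dA A (2 * q + 1) (gv_form A q \<beta>)) = \<dots>" .
  have "dA A (2 * q + 1) (gv_form A q \<beta>) = (\<lambda>x v. 0)"
  proof (rule form_eq_zero_filt[OF dA_spec(1)[OF gv(1)]])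
    fix x
    have f: "filt (inB x) x 1 (dd ?b)" by (rule d\<beta>_filt[OF assms])
    show "filt (inB x) x (Suc q) (hat (Suc (2 * q + 1)) (dA A (2 * q + 1) (gv_form A q \<beta>)))"
      unfolding h using filt_shuffle[OF f filt_shuffle_power[OF f, of q]] by simp
  qed
  then show ?thesis using gv(1) by (simp add: cocycles_def)
qed

text \<open>Coboundaries are derivatives of forms, so the transgression cochain has to be realised
  by a form, here of degree 2n.\<close>

lemma transgression_form:
  assumes "\<beta> \<in> \<Omega> A 1" "\<gamma> \<in> \<Omega> A 1" "\<omega> \<in> \<Omega> A 2" "\<omega>' \<in> \<Omega> A 2"
  shows "\<exists>\<epsilon>\<in>\<Omega> A (2 * n). hat (2 * n) \<epsilon> = transgression (hat 1 \<beta>) (hat 1 \<gamma>) (hat 2 \<omega>) (hat 2 \<omega>') n"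
proof (induction n)
  case 0
  show ?case
    by (rule bexI[of _ "\<lambda>x v. 0"]) (simp_all only: transgression.simps hat_lin mult_0_right form_zero)
next
  case (Suc n)
  then obtain \<epsilon> where \<epsilon>: "\<epsilon> \<in> \<Omega> A (2 * n)"
    "hat (2 * n) \<epsilon> = transgression (hat 1 \<beta>) (hat 1 \<gamma>) (hat 2 \<omega>) (hat 2 \<omega>') n" by blast
  have p: "wedge_power 2 \<omega> n \<in> \<Omega> A (2 * n)" "hat (2 * n) (wedge_power 2 \<omega> n) = shuffle_power (hat 2 \<omega>) n"
    using wedge_power_form[OF assms(3), of n] by auto
  define \<eta> where "\<eta> = wedge 1 (1 + 2 * n) \<beta> (wedge 1 (2 * n) \<gamma> (wedge_power 2 \<omega> n))"
  define \<xi> where "\<xi> = wedge 2 (2 * n) \<omega>' \<epsilon>"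
  have e: "1 + (1 + 2 * n) = 2 * Suc n" "2 + 2 * n = 2 * Suc n" by auto
  have \<eta>: "\<eta> \<in> \<Omega> A (2 * Suc n)" "hat (2 * Suc n) \<eta> = shuffle (hat 1 \<beta>) (shuffle (hat 1 \<gamma>) (shuffle_power (hat 2 \<omega>) n))"
    using wedge_form[OF assms(1) wedge_form[OF assms(2) p(1)]] hat_wedge[OF assms(1) wedge_form[OF assms(2) p(1)]]
      hat_wedge[OF assms(2) p(1)] p(2) unfolding e \<eta>_def by simp_all
  have \<xi>: "\<xi> \<in> \<Omega> A (2 * Suc n)"
    "hat (2 * Suc n) \<xi> = shuffle (hat 2 \<omega>') (transgression (hat 1 \<beta>) (hat 1 \<gamma>) (hat 2 \<omega>) (hat 2 \<omega>') n)"
    using wedge_form[OF assms(4) \<epsilon>(1)] hat_wedge[OF assms(4) \<epsilon>(1)] \<epsilon>(2) unfolding e \<xi>_def by simp_all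
  have "hat (2 * Suc n) (\<lambda>x v. \<xi> x v + \<eta> x v) =
      transgression (hat 1 \<beta>) (hat 1 \<gamma>) (hat 2 \<omega>) (hat 2 \<omega>') (Suc n)"
    unfolding hat_lin \<eta>(2) \<xi>(2) transgression.simps ..
  then show ?case using form_arith(2)[OF \<xi>(1) \<eta>(1)] by blast
qed

lemma gv_class_unique:
  assumes \<alpha>: "defining_form A B q \<alpha>" "\<beta> \<in> \<Omega> A 1" "dA A q \<alpha> = wedge 1 q \<beta> \<alpha>"
    and \<alpha>': "defining_form A B q \<alpha>'" "\<beta>' \<in> \<Omega> A 1" "dA A q \<alpha>' = wedge 1 q \<beta>' \<alpha>'"
  shows "cohomology_class A (2 * q + 1) (gv_form A q \<beta>') = cohomology_class A (2 * q + 1) (gv_form A q \<beta>)"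
proof -
  obtain f where f: "f \<in> CC" "\<And>x. f x \<noteq> 0" "\<And>x v. \<alpha>' x v = f x * \<alpha> x v"
    using defining_ratio[OF \<alpha>(1) \<alpha>'(1)] by blast
  define h where "h y = ln (f y * f y) / 2" for y
  have h: "h \<in> CC" using lie_derivative_ln_abs(1)[OF f(1,2)] by (simp add: h_def[abs_def])
  have Lh: "lie_derivative A u h x = lie_derivative A u f x / f x" if "u \<in> \<Gamma> A" for u x
    using lie_derivative_ln_abs(2)[OF f(1,2) that, of x] by (simp add: h_def[abs_def])
  define \<phi> where "\<phi> = (\<lambda>(x::'m) (v::nat \<Rightarrow> 'a). h x)"
  have \<phi>: "\<phi> \<in> \<Omega> A 0" unfolding \<phi>_def by (rule form_function[OF h])
  have d\<phi>: "dA A 0 \<phi> \<in> \<Omega> A 1" "hat 1 (dA A 0 \<phi>) = dd (hat 0 \<phi>)" using dA_spec[OF \<phi>] by simp_all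
  \<comment> \<open>The remainder of \<beta>' - \<beta> after dh. Once it is known to vanish on B,
    it is the cochain c of the transgression.\<close>
  define \<gamma> where "\<gamma> = (\<lambda>x v. (\<beta>' x v - \<beta> x v) - dA A 0 \<phi> x v)"
  have \<gamma>: "\<gamma> \<in> \<Omega> A 1" unfolding \<gamma>_def by (intro form_arith \<alpha>(2) \<alpha>'(2) d\<phi>(1))
  let ?b = "hat 1 \<beta>" and ?b' = "hat 1 \<beta>'" and ?c = "hat 1 \<gamma>" and ?h = "hat 0 \<phi>"
  have c: "?c = (?b' - ?b) - dd ?h" unfolding \<gamma>_def hat_lin d\<phi>(2) ..
  have key: "hat 1 \<beta>' [u] x = hat 1 \<beta> [u] x + lie_derivative A u h x" if u: "u \<in> \<Gamma>B" for u x
  proof -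
    \<comment> \<open>A list on which \<alpha> is nonzero at x: the comparison of coefficients below
      cancels \<alpha> there and then divides by f.\<close>
    obtain ws where ws: "set ws \<subseteq> \<Gamma> A" "hat q \<alpha> ws x \<noteq> 0" using defining_nonzero[OF \<alpha>(1)] by blast
    have a': "hat q \<alpha>' = (\<lambda>vs. f * hat q \<alpha> vs)" by (intro ext) (simp add: hat_def f(3))
    have "hat 1 \<beta>' [u] * (f * hat q \<alpha> ws) = Lie u (\<lambda>vs. f * hat q \<alpha> vs) ws"
      using Lie_defining[OF \<alpha>' u ws(1)] unfolding a' by simp
    also have "\<dots> = f * Lie u (hat q \<alpha>) ws + lie_derivative A u f * hat q \<alpha> ws"
      by (rule Lie_scale[OF supportedD(3)[OF supported_hat[OF defining_form_in[OF \<alpha>(1)]]] f(1) \<Gamma>B_in(1)[OF u] ws(1)])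
    also have "Lie u (hat q \<alpha>) ws = hat 1 \<beta> [u] * hat q \<alpha> ws" by (rule Lie_defining[OF \<alpha> u ws(1)])
    finally have "(hat 1 \<beta>' [u] * (f * hat q \<alpha> ws)) x =
        (f * (hat 1 \<beta> [u] * hat q \<alpha> ws) + lie_derivative A u f * hat q \<alpha> ws) x" by (rule fun_cong)
    then have "(hat 1 \<beta>' [u] x * f x) * hat q \<alpha> ws x =
        (hat 1 \<beta> [u] x * f x + lie_derivative A u f x) * hat q \<alpha> ws x" by (simp add: algebra_simps)
    then have "hat 1 \<beta>' [u] x * f x = hat 1 \<beta> [u] x * f x + lie_derivative A u f x" using ws(2) by simp
    then have "hat 1 \<beta>' [u] x * f x = (hat 1 \<beta> [u] x + lie_derivative A u f x / f x) * f x"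
      using f(2)[of x] by (simp add: distrib_right)
    then show ?thesis using f(2)[of x] unfolding Lh[OF \<Gamma>B_in(1)[OF u]] mult_cancel_right by blast
  qed
  have s: "supported ?b" "supported ?b'" "supported ?c" "supported ?h"
    by (intro supported_hat \<alpha>(2) \<alpha>'(2) \<gamma> \<phi>)+
  have fc: "filt (inB x) x 1 ?c" for x
  proof (rule filt_1I[OF supportedD(1)[OF s(3)]])
    fix vs assume vs: "set vs \<subseteq> \<Gamma>B"
    show "?c vs x = 0"
    proof (cases "length vs = 1")
      case True
      then obtain u where u: "vs = [u]" by (auto simp: length_Suc_conv)
      then have "u \<in> \<Gamma>B" using vs by simp
      then show ?thesis
        using key[of u x] dd_hat_function[OF h \<Gamma>B_in(1), of u] unfolding c u \<phi>_def by simp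
    qed (simp add: hat_def)
  qed
  have fb: "filt (inB x) x 1 (dd ?b)" "filt (inB x) x 1 (dd ?b')" for x
    by (rule d\<beta>_filt[OF \<alpha>], rule d\<beta>_filt[OF \<alpha>'])
  have b': "?b' = ?b + ?c + dd ?h" unfolding c by simp
  note w = dA_1_form[OF \<alpha>(2)] and w' = dA_1_form[OF \<alpha>'(2)]
  have bars: "bar ?b = - ?b" "bar ?b' = - ?b'" "bar ?c = - ?c" "bar ?h = ?h"
    "bar (dd ?b) = dd ?b" "bar (dd ?b') = dd ?b'"
    unfolding w(2)[symmetric] w'(2)[symmetric] bar_hat by simp_all
  obtain \<epsilon> where \<epsilon>: "\<epsilon> \<in> \<Omega> A (2 * q)" "hat (2 * q) \<epsilon> = transgression ?b ?c (dd ?b) (dd ?b') q"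
    using transgression_form[OF \<alpha>(2) \<gamma> w(1) w'(1), of q] unfolding w(2) w'(2) by blast
  have p': "wedge_power 2 (dA A 1 \<beta>') q \<in> \<Omega> A (2 * q)"
    "hat (2 * q) (wedge_power 2 (dA A 1 \<beta>') q) = shuffle_power (dd ?b') q"
    using wedge_power_form[OF w'(1), of q] unfolding w'(2) by auto
  define \<xi> where "\<xi> = wedge 0 (2 * q) \<phi> (wedge_power 2 (dA A 1 \<beta>') q)"
  have \<xi>: "\<xi> \<in> \<Omega> A (2 * q)" "hat (2 * q) \<xi> = shuffle ?h (shuffle_power (dd ?b') q)"
    using wedge_form[OF \<phi> p'(1)] hat_wedge[OF \<phi> p'(1)] p'(2) unfolding \<xi>_def by simp_all
  define \<zeta> where "\<zeta> = (\<lambda>x v. \<xi> x v - \<epsilon> x v)"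
  have \<zeta>: "\<zeta> \<in> \<Omega> A (2 * q)" unfolding \<zeta>_def by (rule form_arith(1)[OF \<xi>(1) \<epsilon>(1)])
  have d\<zeta>: "dA A (2 * q) \<zeta> \<in> \<Omega> A (2 * q + 1)"
    "hat (2 * q + 1) (dA A (2 * q) \<zeta>) = dd (shuffle ?h (shuffle_power (dd ?b') q) - transgression ?b ?c (dd ?b) (dd ?b') q)"
    using dA_spec[OF \<zeta>] unfolding \<zeta>_def hat_lin \<xi>(2) \<epsilon>(2) by simp_all
  note gv = gv_form[OF \<alpha>(2), of q] and gv' = gv_form[OF \<alpha>'(2), of q]
  \<comment> \<open>The error of the proposed primitive \<zeta>. It lies in F_(q+1) at every point,
    hence is 0, and \<zeta> is an exact primitive of the difference.\<close>
  define \<rho> where "\<rho> = (\<lambda>x v. (gv_form A q \<beta>' x v - gv_form A q \<beta> x v) - dA A (2 * q) \<zeta> x v)"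
  have \<rho>: "\<rho> \<in> \<Omega> A (2 * q + 1)" unfolding \<rho>_def by (intro form_arith gv(1) gv'(1) d\<zeta>(1))
  have "\<rho> = (\<lambda>x v. 0)"
  proof (rule form_eq_zero_filt[OF \<rho>])
    fix x
    show "filt (inB x) x (Suc q) (hat (2 * q + 1) \<rho>)"
      unfolding \<rho>_def hat_lin gv(2) gv'(2) d\<zeta>(2)
      by (rule godbillon_vey_difference_filt[OF s b' bars fc fb])
  qed
  then have "\<rho> x v = 0" for x v by simp
  then have "dA A (2 * q) \<zeta> = (\<lambda>x v. gv_form A q \<beta>' x v - gv_form A q \<beta> x v)"
    by (simp add: \<rho>_def fun_eq_iff)
  then show ?thesis
    using cohomology_class_eq[of "gv_form A q \<beta>" "2 * q" "gv_form A q \<beta>'" \<zeta>] \<zeta>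
      gv_form_cocycle[OF \<alpha>] gv_form_cocycle[OF \<alpha>'] by simp
qed

end

theorem theorem3p1:
  fixes A :: "('m::{t2_space,second_countable_topology}, 'e::real_inner, 'a::real_vector) algebroid"
    and B :: "'m \<Rightarrow> 'a set" and q :: nat and \<alpha> \<beta> :: "('m, 'a) form"
  assumes "lie_algebroid A"
    and "lie_subalgebroid A B q" and "coorientable A B q"
    and "defining_form A B q \<alpha>"
    and "\<beta> \<in> \<Omega> A 1" and "dA A q \<alpha> = wedge 1 q \<beta> \<alpha>"
  shows "gv_form A q \<beta> \<in> cocycles A (2 * q + 1) \<and>
    cohomology_class A (2 * q + 1) (gv_form A q \<beta>) \<in> cohomology A (2 * q + 1) \<and>
    (\<forall>\<alpha>' \<beta>'. defining_form A B q \<alpha>' \<and> \<beta>' \<in> \<Omega> A 1 \<and> dA A q \<alpha>' = wedge 1 q \<beta>' \<alpha>' \<longrightarrow>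
       cohomology_class A (2 * q + 1) (gv_form A q \<beta>')
         = cohomology_class A (2 * q + 1) (gv_form A q \<beta>))"
proof -
  interpret subalgebroid_loc A B q
    by unfold_locales (rule assms)+
  note gv = gv_form_cocycle[OF assms(4-6)]
  show ?thesis
    using gv cohomology_class_in[OF gv] gv_class_unique[OF assms(4-6)] by blast
qed

end
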